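(* Let $g=\{g_k\}_{k\ge0}$, $g_k\subset S^kT^*\otimes N$, be an involutive symbolic system over $\mathbb C$. Then a subspace $V^*\subset T^*$ is strongly characteristic for $g$ if and only if it contains a (non-zero) characteristic covector for $g$.
   Context: $T$ and $N$ are finite-dimensional vector spaces over $\mathbb C$, $n=\dim T$. The Spencer operator $\delta:S^iT^*\otimes N\otimes\Lambda^jT^*\to S^{i-1}T^*\otimes N\otimes\Lambda^{j+1}T^*$ is the exterior differential of $N$-valued polynomial differential forms on $T$; for $v\in T$, $\delta_v$ is the derivative in the direction $v$. The first prolongation of a subspace $h\subset S^kT^*\otimes N$ is $h^{(1)}=\{p\in S^{k+1}T^*\otimes N : \delta p\in h\otimes T^*\}$. A symbolic system is a sequence of subspaces $g_k\subset S^kT^*\otimes N$, $k\ge0$, with $g_0=N$ and $g_k\subset g_{k-1}^{(1)}$ for $k\ge1$. Orders: $\operatorname{ord}(g)=\{k\ge1 : g_k\ne g_{k-1}^{(1)}\}$, a finite set; $r_{\max}(g)$ is its maximum. Involutivity: a subspace $g_k\subset S^kT^*\otimes N$ is involutive if for a generic basis $v_1,\dots,v_n$ of $T$ the maps $\delta_{v_i}:g_k^{(1)}\cap S^{k+1}\operatorname{ann}\langle v_1,\dots,v_{i-1}\rangle\otimes N\to g_k\cap S^k\operatorname{ann}\langle v_1,\dots,v_{i-1}\rangle\otimes N$ are surjective for all $1\le i\le n$. A symbolic system $g$ is involutive if every $g_k$ is involutive (this is a condition only for $k\in\operatorname{ord}(g)$). A subspace $V^*\subset T^*$ is strongly characteristic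 for $g$ if $g_k\cap (S^kV^*\otimes N)\ne0$ for $k=r_{\max}(g)$ (equivalently, with $W=\operatorname{ann}(V^* )\subset T$, there is $\omega\in g_k\setminus\{0\}$ with $\delta_\xi\omega=0$ for all $\xi\in W$). A covector $v\in T^*\setminus\{0\}$ is characteristic for $g_k$ if $v^k\otimes w\in g_k$ for some $w\in N\setminus\{0\}$; it is characteristic for $g$ if it is characteristic for every $g_k$ (equivalently for $k=r_{\max}(g)$). *)

theory Defs
  imports "HOL-Analysis.Analysis" "HOL-Library.Function_Algebras"
begin

text \<open>
  The spaces \<open>T\<close> and \<open>N\<close> are the types \<open>'t\<close> and \<open>'n\<close> with scalar multiplications \<open>sT\<close> and \<open>sN\<close>.
  Elements of \<open>S\<^sup>kT\<^sup>* \<otimes> N\<close> are represented by homogeneous polynomial maps \<open>T \<rightarrow> N\<close> of degree \<open>k\<close>;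
  over the complex numbers this representation is faithful. Spaces of maps carry the pointwise
  structure, with addition from \<open>Function_Algebras\<close> and scalar multiplication \<open>pscale\<close>.
\<close>

definition pscale :: "(complex \<Rightarrow> 'b \<Rightarrow> 'b) \<Rightarrow> complex \<Rightarrow> ('a \<Rightarrow> 'b) \<Rightarrow> 'a \<Rightarrow> 'b" where
  "pscale s c f = (\<lambda>x. s c (f x))"

definition dual_space :: "(complex \<Rightarrow> 'v::ab_group_add \<Rightarrow> 'v) \<Rightarrow> ('v \<Rightarrow> complex) set" where
  "dual_space s = {\<phi>. Vector_Spaces.linear s (*) \<phi>}"

definition ann :: "(complex \<Rightarrow> 't::ab_group_add \<Rightarrow> 't) \<Rightarrow> 't set \<Rightarrow> ('t \<Rightarrow> complex) set" where
  "ann sT W = {\<phi> \<in> dual_space sT. \<forall>x\<in>W. \<phi> x = 0}"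

text \<open>\<open>sym_tensor sN V k\<close> is \<open>S\<^sup>kV \<otimes> N\<close> for a subspace \<open>V\<close> of \<open>T\<^sup>*\<close>.\<close>

definition sym_tensor ::
  "(complex \<Rightarrow> 'n::ab_group_add \<Rightarrow> 'n) \<Rightarrow> ('t \<Rightarrow> complex) set \<Rightarrow> nat \<Rightarrow> ('t \<Rightarrow> 'n) set" where
  "sym_tensor sN V k =
     module.span (pscale sN) {\<lambda>x. sN (\<Prod>i<k. \<phi> i x) w | \<phi> w. \<forall>i<k. \<phi> i \<in> V}"

text \<open>
  \<open>'t\<close> and \<open>'n\<close> carry no topology, so the derivative of \<open>p\<close> in the direction \<open>v\<close> is taken weakly,
  i.e. after composition with each linear functional on \<open>N\<close>; these functionals separate points.
\<close>

definition dir_deriv ::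
  "(complex \<Rightarrow> 't::ab_group_add \<Rightarrow> 't) \<Rightarrow> (complex \<Rightarrow> 'n::ab_group_add \<Rightarrow> 'n) \<Rightarrow>
   't \<Rightarrow> ('t \<Rightarrow> 'n) \<Rightarrow> 't \<Rightarrow> 'n" where
  "dir_deriv sT sN v p = (\<lambda>x. THE w. \<forall>f \<in> dual_space sN.
     ((\<lambda>t. f (p (x + sT t v))) has_field_derivative f w) (at 0))"

text \<open>
  The Spencer operator is only needed on \<open>S\<^sup>kT\<^sup>* \<otimes> N\<close>, with values in \<open>S\<^sup>k\<^sup>-\<^sup>1T\<^sup>* \<otimes> N \<otimes> T\<^sup>*\<close>. An element
  \<open>q \<otimes> \<phi>\<close> of the latter is represented by the map taking \<open>v\<close> to \<open>\<phi>(v) q\<close>.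
\<close>

definition spencer ::
  "(complex \<Rightarrow> 't::ab_group_add \<Rightarrow> 't) \<Rightarrow> (complex \<Rightarrow> 'n::ab_group_add \<Rightarrow> 'n) \<Rightarrow>
   ('t \<Rightarrow> 'n) \<Rightarrow> 't \<Rightarrow> 't \<Rightarrow> 'n" where
  "spencer sT sN p = (\<lambda>v. dir_deriv sT sN v p)"

definition tensor_dual ::
  "(complex \<Rightarrow> 't::ab_group_add \<Rightarrow> 't) \<Rightarrow> (complex \<Rightarrow> 'n::ab_group_add \<Rightarrow> 'n) \<Rightarrow>
   ('t \<Rightarrow> 'n) set \<Rightarrow> ('t \<Rightarrow> 't \<Rightarrow> 'n) set" where
  "tensor_dual sT sN h =
     module.span (pscale (pscale sN)) {\<lambda>v. pscale sN (\<phi> v) q | \<phi> q. \<phi> \<in> dual_space sT \<and> q \<in> h}"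

text \<open>\<open>prolongation sT sN k h\<close> is the first prolongation of a subspace \<open>h\<close> of \<open>S\<^sup>kT\<^sup>* \<otimes> N\<close>.\<close>

definition prolongation ::
  "(complex \<Rightarrow> 't::ab_group_add \<Rightarrow> 't) \<Rightarrow> (complex \<Rightarrow> 'n::ab_group_add \<Rightarrow> 'n) \<Rightarrow>
   nat \<Rightarrow> ('t \<Rightarrow> 'n) set \<Rightarrow> ('t \<Rightarrow> 'n) set" where
  "prolongation sT sN k h =
     {p \<in> sym_tensor sN (dual_space sT) (Suc k). spencer sT sN p \<in> tensor_dual sT sN h}"

text \<open>The condition \<open>g\<^sub>0 = N\<close> reads \<open>g 0 = S\<^sup>0T\<^sup>* \<otimes> N\<close>, the space of constant maps.\<close>

definition symbolic_system ::
  "(complex \<Rightarrow> 't::ab_group_add \<Rightarrow> 't) \<Rightarrow> (complex \<Rightarrow> 'n::ab_group_add \<Rightarrow> 'n) \<Rightarrow>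
   (nat \<Rightarrow> ('t \<Rightarrow> 'n) set) \<Rightarrow> bool" where
  "symbolic_system sT sN g \<longleftrightarrow>
     (\<forall>k. module.subspace (pscale sN) (g k) \<and> g k \<subseteq> sym_tensor sN (dual_space sT) k) \<and>
     g 0 = sym_tensor sN (dual_space sT) 0 \<and>
     (\<forall>k\<ge>1. g k \<subseteq> prolongation sT sN (k - 1) (g (k - 1)))"

definition orders ::
  "(complex \<Rightarrow> 't::ab_group_add \<Rightarrow> 't) \<Rightarrow> (complex \<Rightarrow> 'n::ab_group_add \<Rightarrow> 'n) \<Rightarrow>
   (nat \<Rightarrow> ('t \<Rightarrow> 'n) set) \<Rightarrow> nat set" where
  "orders sT sN g = {k. k \<ge> 1 \<and> g k \<noteq> prolongation sT sN (k - 1) (g (k - 1))}"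

text \<open>
  The set of orders of a symbolic system is finite by Hilbert's basis theorem. It is empty
  exactly for the free system \<open>g\<^sub>k = S\<^sup>kT\<^sup>* \<otimes> N\<close>, where the maximum is undefined; then
  \<open>r_max\<close> is taken to be 1, the least value an order can have.
\<close>

definition r_max ::
  "(complex \<Rightarrow> 't::ab_group_add \<Rightarrow> 't) \<Rightarrow> (complex \<Rightarrow> 'n::ab_group_add \<Rightarrow> 'n) \<Rightarrow>
   (nat \<Rightarrow> ('t \<Rightarrow> 'n) set) \<Rightarrow> nat" where
  "r_max sT sN g = (if orders sT sN g = {} then 1 else Max (orders sT sN g))"

definition ordered_basis :: "(complex \<Rightarrow> 't::ab_group_add \<Rightarrow> 't) \<Rightarrow> 't list \<Rightarrow> bool" where
  "ordered_basis sT vs \<longleftrightarrow>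
     distinct vs \<and> \<not> module.dependent sT (set vs) \<and> module.span sT (set vs) = UNIV"

text \<open>Polynomial functions on \<open>T\<^sup>n\<close>, with \<open>n = dim T\<close> and points of \<open>T\<^sup>n\<close> given as lists.\<close>

inductive_set poly_fun :: "(complex \<Rightarrow> 't::ab_group_add \<Rightarrow> 't) \<Rightarrow> ('t list \<Rightarrow> complex) set"
  for sT :: "complex \<Rightarrow> 't::ab_group_add \<Rightarrow> 't" where
  const: "(\<lambda>_. c) \<in> poly_fun sT"
| coord: "i < vector_space.dim sT UNIV \<Longrightarrow> \<phi> \<in> dual_space sT \<Longrightarrow> (\<lambda>vs. \<phi> (vs ! i)) \<in> poly_fun sT"
| add: "P \<in> poly_fun sT \<Longrightarrow> Q \<in> poly_fun sT \<Longrightarrow> (\<lambda>vs. P vs + Q vs) \<in> poly_fun sT"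
| mult: "P \<in> poly_fun sT \<Longrightarrow> Q \<in> poly_fun sT \<Longrightarrow> (\<lambda>vs. P vs * Q vs) \<in> poly_fun sT"

text \<open>
  A property holds for a generic basis if it holds on a nonempty Zariski open subset of the
  variety of ordered bases; it suffices to consider complements of hypersurfaces.
\<close>

definition for_generic_basis ::
  "(complex \<Rightarrow> 't::ab_group_add \<Rightarrow> 't) \<Rightarrow> ('t list \<Rightarrow> bool) \<Rightarrow> bool" where
  "for_generic_basis sT R \<longleftrightarrow> (\<exists>P \<in> poly_fun sT.
     (\<exists>vs. ordered_basis sT vs \<and> P vs \<noteq> 0) \<and>
     (\<forall>vs. ordered_basis sT vs \<and> P vs \<noteq> 0 \<longrightarrow> R vs))"

text \<open>List positions start at 0, so \<open>vs ! i\<close> is \<open>v\<^sub>i\<^sub>+\<^sub>1\<close> and \<open>take i vs\<close> is \<open>v\<^sub>1, \<dots>, v\<^sub>i\<close>.\<close>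

definition involutive_subspace ::
  "(complex \<Rightarrow> 't::ab_group_add \<Rightarrow> 't) \<Rightarrow> (complex \<Rightarrow> 'n::ab_group_add \<Rightarrow> 'n) \<Rightarrow>
   nat \<Rightarrow> ('t \<Rightarrow> 'n) set \<Rightarrow> bool" where
  "involutive_subspace sT sN k h \<longleftrightarrow> for_generic_basis sT (\<lambda>vs. \<forall>i < length vs.
     dir_deriv sT sN (vs ! i) `
       (prolongation sT sN k h \<inter> sym_tensor sN (ann sT (module.span sT (set (take i vs)))) (Suc k)) =
     h \<inter> sym_tensor sN (ann sT (module.span sT (set (take i vs)))) k)"

definition involutive_system ::
  "(complex \<Rightarrow> 't::ab_group_add \<Rightarrow> 't) \<Rightarrow> (complex \<Rightarrow> 'n::ab_group_add \<Rightarrow> 'n) \<Rightarrow>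
   (nat \<Rightarrow> ('t \<Rightarrow> 'n) set) \<Rightarrow> bool" where
  "involutive_system sT sN g \<longleftrightarrow>
     symbolic_system sT sN g \<and> (\<forall>k. involutive_subspace sT sN k (g k))"

definition strongly_characteristic ::
  "(complex \<Rightarrow> 't::ab_group_add \<Rightarrow> 't) \<Rightarrow> (complex \<Rightarrow> 'n::ab_group_add \<Rightarrow> 'n) \<Rightarrow>
   (nat \<Rightarrow> ('t \<Rightarrow> 'n) set) \<Rightarrow> ('t \<Rightarrow> complex) set \<Rightarrow> bool" where
  "strongly_characteristic sT sN g V \<longleftrightarrow>
     g (r_max sT sN g) \<inter> sym_tensor sN V (r_max sT sN g) \<noteq> {0}"

definition characteristic_at ::
  "(complex \<Rightarrow> 't::ab_group_add \<Rightarrow> 't) \<Rightarrow> (complex \<Rightarrow> 'n::ab_group_add \<Rightarrow> 'n) \<Rightarrow>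
   nat \<Rightarrow> ('t \<Rightarrow> 'n) set \<Rightarrow> ('t \<Rightarrow> complex) \<Rightarrow> bool" where
  "characteristic_at sT sN k h v \<longleftrightarrow>
     v \<in> dual_space sT \<and> v \<noteq> 0 \<and> (\<exists>w. w \<noteq> 0 \<and> (\<lambda>x. sN (v x ^ k) w) \<in> h)"

definition characteristic ::
  "(complex \<Rightarrow> 't::ab_group_add \<Rightarrow> 't) \<Rightarrow> (complex \<Rightarrow> 'n::ab_group_add \<Rightarrow> 'n) \<Rightarrow>
   (nat \<Rightarrow> ('t \<Rightarrow> 'n) set) \<Rightarrow> ('t \<Rightarrow> complex) \<Rightarrow> bool" where
  "characteristic sT sN g v \<longleftrightarrow> (\<forall>k. characteristic_at sT sN k (g k) v)"

end

theory Submission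
  imports Defs "HOL-Library.Multiset_Order" "HOL-Computational_Algebra.Fundamental_Theorem_Algebra"
begin

text \<open>
  Write \<open>M\<close> for the graded module dual to \<open>g\<close> and \<open>W\<close> for the annihilator of \<open>V\<close>, so that
  \<open>M / W M\<close> is dual to the spaces \<open>g\<^sub>k \<inter> S\<^sup>kV \<otimes> N\<close>. Involutivity of \<open>g\<^sub>k\<close>, \<open>k \<ge> r_max\<close>, makes a generic
  flag quasi-regular, hence the Koszul complex of \<open>T\<close> on \<open>g\<close> exact in degrees at least \<open>r_max\<close>. If
  some \<open>g\<^sub>l \<inter> S\<^sup>lV \<otimes> N\<close> vanishes, then for every \<open>v\<close> a power of \<open>v\<close> lies in \<open>W\<close> modulo the
  annihilator of \<open>M\<close>, so it acts as zero on the Koszul cohomology of any subspace containing \<open>W\<close>.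
  Removing \<open>v\<close> from an exact Koszul complex makes \<open>v\<close> surjective on the cohomology of the
  smaller complex, which therefore vanishes; going down from \<open>T\<close> to \<open>W\<close> one arrives at
  \<open>g\<^sub>k \<inter> S\<^sup>kV \<otimes> N = 0\<close> for \<open>k = r_max\<close>. Hence, if \<open>V\<close> is strongly characteristic, no
  \<open>g\<^sub>l \<inter> S\<^sup>lV \<otimes> N\<close> vanishes, and a Nullstellensatz, proved on a minimal subsystem that is nonzero in
  all degrees, yields a characteristic covector in \<open>V\<close>.
\<close>

subsection \<open>Linear algebra\<close>

text \<open>The module is never formed: polynomials in vectors of \<open>T\<close> appear as
  commuting operators on scalar functions of multisets. Two finiteness facts carry the argument:
  finiteness of the set of orders, so that \<open>r_max\<close> is a true maximum, and the
  descending chain condition for systems, which supplies the minimal subsystem. Both come from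
  Dickson's lemma applied to leading multisets. A generic flag is given for each degree
  \<open>k\<close> separately, and infinitely many degrees are involved, so no common flag is at
  hand. For each \<open>k\<close> a fixed basis and generators of \<open>W\<close> are therefore
  appended to the flag, and the flag vectors, now redundant, are deleted again; this leaves the same
  list in every degree. Deleting a basis vector \<open>v\<close> costs more: at degree
  \<open>k\<close> it uses exactness in as many consecutive degrees, starting at \<open>k\<close>,
  as the exponent of \<open>v\<close> in its relation. Hence exactness has to be kept in all degrees
  from \<open>r_max\<close> on until only the generators of \<open>W\<close> remain. Form degree 0
  then gives the vanishing.\<close>

text \<open>Induction on the functionals: on the kernel of \<open>l i\<close> the remaining ones
  suffice, and what is left of \<open>f\<close> vanishes on that kernel, hence is a multiple of
  \<open>l i\<close> on \<open>Y\<close>.\<close>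

lemma functional_in_span:
  fixes s :: "complex \<Rightarrow> 'b::ab_group_add \<Rightarrow> 'b" and l :: "'i \<Rightarrow> 'b \<Rightarrow> complex" and f :: "'b \<Rightarrow> complex"
  assumes "finite I"
    and Y: "0 \<in> Y" "\<And>x y. x \<in> Y \<Longrightarrow> y \<in> Y \<Longrightarrow> x + y \<in> Y" "\<And>c x. x \<in> Y \<Longrightarrow> s c x \<in> Y"
    and add_l: "\<And>i x y. l i (x + y) = l i x + l i y" and scale_l: "\<And>i c x. l i (s c x) = c * l i x"
    and add_f: "\<And>x y. f (x + y) = f x + f y" and scale_f: "\<And>c x. f (s c x) = c * f x"
    and ker: "\<And>x. x \<in> Y \<Longrightarrow> (\<And>i. i \<in> I \<Longrightarrow> l i x = 0) \<Longrightarrow> f x = 0"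
  shows "\<exists>c. \<forall>x\<in>Y. f x = (\<Sum>i\<in>I. c i * l i x)"
  using assms(1) Y ker
proof (induction I arbitrary: Y rule: finite_induct)
  case empty
  then show ?case by simp
next
  case (insert i I)
  define Z where "Z = {x \<in> Y. l i x = 0}"
  have "0 = l i 0" using add_l[of i 0 0] by simp
  then have Z: "0 \<in> Z" "\<And>x y. x \<in> Z \<Longrightarrow> y \<in> Z \<Longrightarrow> x + y \<in> Z" "\<And>c x. x \<in> Z \<Longrightarrow> s c x \<in> Z"
    using insert.prems by (auto simp: Z_def add_l scale_l)
  have "\<And>x. x \<in> Z \<Longrightarrow> (\<And>j. j \<in> I \<Longrightarrow> l j x = 0) \<Longrightarrow> f x = 0"
    using insert.prems(4) by (auto simp: Z_def)
  from insert.IH[OF Z this] obtain c where c: "\<And>x. x \<in> Z \<Longrightarrow> f x = (\<Sum>j\<in>I. c j * l j x)"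
    by blast
  have *: "\<exists>a. \<forall>x\<in>Y. f x = a * l i x + (\<Sum>j\<in>I. c j * l j x)"
  proof (cases "\<exists>y\<in>Y. l i y \<noteq> 0")
    case False
    then show ?thesis using c by (auto simp: Z_def)
  next
    case True
    then obtain y where y: "y \<in> Y" "l i y \<noteq> 0" by blast
    define h where "h x = f x - (\<Sum>j\<in>I. c j * l j x)" for x
    have h: "h (x + z) = h x + h z" "h (s a x) = a * h x" for x z a
      by (simp_all add: h_def add_f scale_f add_l scale_l distrib_left sum.distrib sum_distrib_left
          algebra_simps)
    have "h x = (h y / l i y) * l i x" if "x \<in> Y" for x
    proof -
      have "x + s (- (l i x / l i y)) y \<in> Z"
        using that y insert.prems by (auto simp: Z_def add_l scale_l)
      then have "h (x + s (- (l i x / l i y)) y) = 0"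
        using c by (simp add: h_def)
      then show ?thesis using y by (simp add: h field_simps)
    qed
    then show ?thesis by (intro exI[of _ "h y / l i y"]) (auto simp: h_def algebra_simps)
  qed
  then obtain a where a: "\<And>x. x \<in> Y \<Longrightarrow> f x = a * l i x + (\<Sum>j\<in>I. c j * l j x)" by blast
  have "f x = (\<Sum>j\<in>insert i I. (c(i := a)) j * l j x)" if "x \<in> Y" for x
  proof -
    have "(\<Sum>j\<in>I. (c(i := a)) j * l j x) = (\<Sum>j\<in>I. c j * l j x)"
      using insert.hyps by (intro sum.cong) auto
    then show ?thesis using a[OF that] insert.hyps by simp
  qed
  then show ?case by blast
qed

text \<open>\<open>A\<close> is only required to be linear on \<open>Y\<close>, since it will be
  given there by a choice function. A polynomial \<open>p\<close> of least degree with
  \<open>p(A) x = 0\<close> has a root \<open>c\<close>; with \<open>p = (X - c) q\<close>, the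
  vector \<open>q(A) x\<close> is nonzero by minimality and is an eigenvector.\<close>

lemma eigenvector_exists:
  fixes s :: "complex \<Rightarrow> 'b::ab_group_add \<Rightarrow> 'b"
  assumes vs: "vector_space s" and fin: "finite S" and YS: "Y \<subseteq> module.span s S"
    and Y: "module.subspace s Y" and nz: "Y \<noteq> {0}"
    and A: "\<And>x. x \<in> Y \<Longrightarrow> A x \<in> Y" "\<And>x y. x \<in> Y \<Longrightarrow> y \<in> Y \<Longrightarrow> A (x + y) = A x + A y"
      "\<And>c x. x \<in> Y \<Longrightarrow> A (s c x) = s c (A x)"
  shows "\<exists>x\<in>Y. x \<noteq> 0 \<and> (\<exists>c. A x = s c x)"
proof -
  interpret vector_space s by fact
  have Y0: "0 \<in> Y" using Y subspace_0 by blast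
  then obtain x where x: "x \<in> Y" "x \<noteq> 0" using nz by blast
  have Ap: "(A ^^ i) x \<in> Y" for i by (induction i) (auto simp: x A(1))
  have A0: "A 0 = 0" using A(2)[OF Y0 Y0] by simp
  have Asum: "(\<Sum>i\<in>I. f i) \<in> Y \<and> A (\<Sum>i\<in>I. f i) = (\<Sum>i\<in>I. A (f i))"
    if "finite I" "\<And>i. i \<in> I \<Longrightarrow> f i \<in> Y" for I :: "nat set" and f
    using that by (induction I rule: finite_induct) (auto simp: A0 A(2) Y0 subspace_add[OF Y])
  \<comment> \<open>\<open>ev p\<close> is \<open>p(A) x\<close>.\<close>
  define ev where "ev p = (\<Sum>i\<le>degree p. s (coeff p i) ((A ^^ i) x))" for p
  have ev: "ev p = (\<Sum>i\<le>N. s (coeff p i) ((A ^^ i) x))" if "degree p \<le> N" for p N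
    unfolding ev_def by (rule sum.mono_neutral_left) (use that in \<open>auto simp: coeff_eq_0\<close>)
  have evY: "ev p \<in> Y" for p
    unfolding ev_def by (intro subspace_sum[OF Y] subspace_scale[OF Y] Ap)
  have ev_add: "ev (p + q) = ev p + ev q" for p q
  proof -
    let ?N = "max (degree p) (degree q)"
    have "degree (p + q) \<le> ?N" by (rule degree_add_le_max)
    then show ?thesis
      by (subst (1 2 3) ev[where N = ?N]) (auto simp: scale_left_distrib sum.distrib)
  qed
  have ev_smult: "ev (smult c p) = s c (ev p)" for c p
    by (subst (1 2) ev[where N = "degree p"]) (auto simp: scale_sum_right)
  have ev_shift: "ev (pCons 0 p) = A (ev p)" for p
  proof -
    have "degree (pCons 0 p) \<le> Suc (degree p)" by (rule degree_pCons_le)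
    then have "ev (pCons 0 p) = (\<Sum>i\<le>degree p. s (coeff p i) ((A ^^ Suc i) x))"
      by (subst ev[where N = "Suc (degree p)"]) (auto simp: sum.atMost_Suc_shift simp del: sum.atMost_Suc)
    also have "\<dots> = (\<Sum>i\<le>degree p. A (s (coeff p i) ((A ^^ i) x)))"
      by (simp add: A(3)[OF Ap])
    also have "\<dots> = A (ev p)" unfolding ev_def
      by (rule Asum[THEN conjunct2, symmetric]) (auto intro: subspace_scale[OF Y] Ap)
    finally show ?thesis .
  qed
  have "\<exists>p. p \<noteq> 0 \<and> ev p = 0"
  \<comment> \<open>Coinciding iterates give a relation directly. They are split off because the
    dependence argument of the other case needs \<open>card S + 1\<close> distinct iterates.\<close>
  proof (cases "inj (\<lambda>i. (A ^^ i) x)")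
    case False
    then obtain i j where ij: "(A ^^ i) x = (A ^^ j) x" "i < j"
      by (metis injI linorder_neqE_nat)
    have evm: "ev (monom 1 i) = (A ^^ i) x" for i
      by (subst ev[where N = i]) (auto simp: degree_monom_le if_distrib[of "\<lambda>c. s c _"] cong: if_cong)
    have "coeff (monom 1 j + smult (- 1) (monom 1 i)) j = (1 :: complex)" using ij by simp
    then have "monom 1 j + smult (- 1) (monom 1 i) \<noteq> (0 :: complex poly)" by (metis coeff_0 zero_neq_one)
    moreover have "ev (monom 1 j + smult (- 1) (monom 1 i)) = 0"
      by (subst ev_add, subst ev_smult) (simp add: evm ij)
    ultimately show ?thesis by blast
  next
    case True
    let ?a = "\<lambda>i. (A ^^ i) x"
    let ?T = "?a ` {..card S}"
    have inj: "inj_on ?a {..card S}" using True inj_on_subset by blast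
    have "dependent ?T"
    proof (rule ccontr)
      assume "\<not> dependent ?T"
      then have "card ?T \<le> card S"
        using independent_span_bound[OF fin, of ?T] Ap YS by blast
      then show False using card_image[OF inj] by simp
    qed
    then obtain u v where u: "(\<Sum>v\<in>?T. s (u v) v) = 0" "v \<in> ?T" "u v \<noteq> 0"
      using dependent_finite[of ?T] by auto
    define p where "p = (\<Sum>i\<le>card S. monom (u (?a i)) i)"
    have cp: "coeff p i = (if i \<le> card S then u (?a i) else 0)" for i
      by (simp add: p_def coeff_sum if_distrib cong: if_cong)
    then have "degree p \<le> card S" by (intro degree_le) auto
    then have "ev p = (\<Sum>i\<le>card S. s (u (?a i)) (?a i))"
      by (subst ev) (auto simp: cp intro: sum.cong)
    also have "\<dots> = 0" using u(1) by (simp add: sum.reindex[OF inj])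
    finally have "ev p = 0" .
    moreover have "p \<noteq> 0" using u(2,3) cp by (metis (no_types, lifting) atMost_iff coeff_0 imageE)
    ultimately show ?thesis by blast
  qed
  then obtain p where p: "p \<noteq> 0" "ev p = 0" and min: "\<And>q. q \<noteq> 0 \<Longrightarrow> ev q = 0 \<Longrightarrow> degree p \<le> degree q"
    using ex_has_least_nat[of "\<lambda>q. q \<noteq> 0 \<and> ev q = 0" _ degree] by blast
  have "degree p \<noteq> 0"
  proof
    assume "degree p = 0"
    then have "ev p = s (coeff p 0) x" "coeff p 0 \<noteq> 0"
      using p(1) by (simp_all add: ev_def) (metis leading_coeff_neq_0)
    then show False using p(2) x(2) by simp
  qed
  then have "\<not> constant (poly p)" by (simp add: constant_degree)
  then obtain c where "poly p c = 0" using fundamental_theorem_of_algebra by blast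
  then obtain q where q: "p = [:- c, 1:] * q" by (auto simp: poly_eq_0_iff_dvd dvd_def)
  then have "q \<noteq> 0" using p(1) by auto
  moreover have "degree p = Suc (degree q)"
    using \<open>q \<noteq> 0\<close> unfolding q by (subst degree_mult_eq) auto
  ultimately have "ev q \<noteq> 0" using min[of q] by auto
  have "p = pCons 0 q + smult (- c) q" by (simp add: q)
  then have "A (ev q) + s (- c) (ev q) = 0" using p(2) by (metis ev_add ev_shift ev_smult)
  then have "A (ev q) = s c (ev q)" by (simp add: eq_neg_iff_add_eq_0 scale_minus_left)
  then show ?thesis using \<open>ev q \<noteq> 0\<close> evY by blast
qed

subsection \<open>Dickson's lemma\<close>

text \<open>A sequence has a monotone or an antitone subsequence; an antitone one in
  \<open>nat\<close> is constant once it has reached its least value.\<close>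

lemma nat_seq_mono_subseq:
  fixes f :: "nat \<Rightarrow> nat"
  shows "\<exists>s :: nat \<Rightarrow> nat. strict_mono s \<and> mono (f \<circ> s)"
proof -
  obtain s where s: "strict_mono s" "monoseq (\<lambda>n. f (s n))" using seq_monosub by blast
  show ?thesis
  proof (cases "\<forall>m n. m \<le> n \<longrightarrow> f (s m) \<le> f (s n)")
    case True
    then have "mono (f \<circ> s)" by (intro monoI) simp
    then show ?thesis using s(1) by blast
  next
    case False
    then have dec: "\<And>m n. m \<le> n \<Longrightarrow> f (s n) \<le> f (s m)" using s(2) by (auto simp: monoseq_def)
    obtain N where N: "\<And>n. f (s N) \<le> f (s n)"
      using ex_has_least_nat[of "\<lambda>_. True" _ "\<lambda>n. f (s n)"] by auto
    have "f (s (N + n)) = f (s N)" for n using dec[of N "N + n"] N[of "N + n"] by simp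
    then have "mono (f \<circ> (\<lambda>n. s (N + n)))" by (simp add: mono_def)
    moreover have "strict_mono (\<lambda>n. s (N + n))" using s(1) by (simp add: strict_mono_def)
    ultimately show ?thesis by blast
  qed
qed

text \<open>Passing to a subsequence once for each element of \<open>B\<close> makes all
  multiplicities monotone along one sequence; its first two members are then comparable.\<close>

lemma dickson:
  fixes e :: "nat \<Rightarrow> 'a multiset"
  assumes "finite B" "\<And>i. set_mset (e i) \<subseteq> B"
  shows "\<exists>i j. i < j \<and> e i \<subseteq># e j"
proof -
  have "\<exists>s :: nat \<Rightarrow> nat. strict_mono s \<and> (\<forall>b\<in>B. mono (\<lambda>i. count (e (s i)) b))"
    using assms(1)
  proof (induction B rule: finite_induct)
    case empty
    then show ?case by (intro exI[of _ "\<lambda>i. i"]) (auto intro: strict_monoI)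
  next
    case (insert b B)
    then obtain s :: "nat \<Rightarrow> nat" where s: "strict_mono s" "\<forall>b\<in>B. mono (\<lambda>i. count (e (s i)) b)" by blast
    obtain t :: "nat \<Rightarrow> nat" where t: "strict_mono t" "mono ((\<lambda>i. count (e (s i)) b) \<circ> t)"
      using nat_seq_mono_subseq by blast
    have "strict_mono (s \<circ> t)" using s(1) t(1) by (simp add: strict_mono_def)
    moreover have "\<forall>b'\<in>insert b B. mono (\<lambda>i. count (e ((s \<circ> t) i)) b')"
      using s(2) t by (auto simp: mono_def strict_mono_less_eq)
    ultimately show ?case by blast
  qed
  then obtain s :: "nat \<Rightarrow> nat" where s: "strict_mono s" "\<forall>b\<in>B. mono (\<lambda>i. count (e (s i)) b)" by blast
  have "count (e (s 0)) b \<le> count (e (s 1)) b" for b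
  proof (cases "b \<in> B")
    case True
    then have "mono (\<lambda>i. count (e (s i)) b)" using s by blast
    then show ?thesis by (rule monoD) simp
  next
    case False
    then have "b \<notin># e (s 0)" using assms(2) by blast
    then show ?thesis by (simp add: not_in_iff)
  qed
  then have "e (s 0) \<subseteq># e (s 1)" by (simp add: mset_subset_eq_count subseteq_mset_def)
  moreover have "s 0 < s 1" using s(1) by (simp add: strict_mono_def)
  ultimately show ?thesis by blast
qed

subsection \<open>Koszul complexes\<close>

text \<open>
  The Koszul complex of commuting operators \<open>D v\<close>, \<open>v\<close> in a list \<open>vs\<close>, on a graded family \<open>g\<close>,
  built as an iterated mapping cone. A cochain is indexed by bit lists of the same length as \<open>vs\<close>
  that encode the subsets of \<open>vs\<close>; its values at other lists are irrelevant. The form degree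
  is not recorded, so that \<open>acyclic vs k\<close> means exactness at polynomial degree \<open>k\<close> in every
  form degree.
\<close>

locale koszul =
  fixes D :: "'v \<Rightarrow> 'x::ab_group_add \<Rightarrow> 'x" and g :: "nat \<Rightarrow> 'x set"
  assumes D_add: "D v (x + y) = D v x + D v y"
    and D_comm: "D u (D v x) = D v (D u x)"
    and g_zero: "0 \<in> g k"
    and g_diff: "x \<in> g k \<Longrightarrow> y \<in> g k \<Longrightarrow> x - y \<in> g k"
    and D_g: "x \<in> g (Suc k) \<Longrightarrow> D v x \<in> g k"
begin

lemma D_zero [simp]: "D v 0 = 0"
  using D_add[of v 0 0] by simp

lemma D_diff: "D v (x - y) = D v x - D v y"
  using D_add[of v "x - y" y] by (simp add: algebra_simps)

lemma D_minus: "D v (- x) = - D v x"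
  using D_diff[of v 0 x] by simp

lemma g_minus: "x \<in> g k \<Longrightarrow> - x \<in> g k"
  using g_diff[OF g_zero, of x k] by simp

lemma g_add: "x \<in> g k \<Longrightarrow> y \<in> g k \<Longrightarrow> x + y \<in> g k"
  using g_diff[of x k "- y"] g_minus by simp

lemma g_sum: "finite I \<Longrightarrow> (\<And>i. i \<in> I \<Longrightarrow> f i \<in> g k) \<Longrightarrow> (\<Sum>i\<in>I. f i) \<in> g k"
  by (induction I rule: finite_induct) (auto intro: g_zero g_add)

lemma D_pow_g: "x \<in> g (k + i) \<Longrightarrow> (D v ^^ i) x \<in> g k"
  by (induction i arbitrary: x) (auto simp: funpow_swap1 intro: D_g)

lemma D_pow_diff: "(D v ^^ i) (x - y) = (D v ^^ i) x - (D v ^^ i) y"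
  by (induction i) (auto simp: D_diff)

lemma D_pow_comm: "(D v ^^ i) (D u x) = D u ((D v ^^ i) x)"
  by (induction i) (auto simp: D_comm)

text \<open>The head bit tells whether the head vector belongs to the subset. The minus sign comes
  from moving the differential past the covector of the head; it makes the composite of
  \<open>kd\<close> with itself vanish.\<close>

fun kd :: "'v list \<Rightarrow> (bool list \<Rightarrow> 'x) \<Rightarrow> bool list \<Rightarrow> 'x" where
  "kd [] c bs = 0"
| "kd (v # vs) c [] = 0"
| "kd (v # vs) c (False # bs) = kd vs (\<lambda>t. c (False # t)) bs"
| "kd (v # vs) c (True # bs) = D v (c (False # bs)) - kd vs (\<lambda>t. c (True # t)) bs"

definition cochain :: "'v list \<Rightarrow> nat \<Rightarrow> (bool list \<Rightarrow> 'x) \<Rightarrow> bool" where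
  "cochain vs k c \<longleftrightarrow> (\<forall>bs. length bs = length vs \<longrightarrow> c bs \<in> g k)"

definition cocycle :: "'v list \<Rightarrow> nat \<Rightarrow> (bool list \<Rightarrow> 'x) \<Rightarrow> bool" where
  "cocycle vs k c \<longleftrightarrow> cochain vs k c \<and> (\<forall>bs. length bs = length vs \<longrightarrow> kd vs c bs = 0)"

definition exact :: "'v list \<Rightarrow> nat \<Rightarrow> (bool list \<Rightarrow> 'x) \<Rightarrow> bool" where
  "exact vs k c \<longleftrightarrow> (\<exists>y. cochain vs (Suc k) y \<and> (\<forall>bs. length bs = length vs \<longrightarrow> c bs = kd vs y bs))"

definition acyclic :: "'v list \<Rightarrow> nat \<Rightarrow> bool" where
  "acyclic vs k \<longleftrightarrow> (\<forall>c. cocycle vs k c \<longrightarrow> exact vs k c)"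

lemma kd_zero [simp]: "kd vs (\<lambda>t. 0) bs = 0"
  by (induction vs "\<lambda>t::bool list. 0::'x" bs rule: kd.induct) simp_all

lemma kd_diff: "kd vs (\<lambda>t. c t - c' t) bs = kd vs c bs - kd vs c' bs"
  by (induction vs c bs arbitrary: c' rule: kd.induct) (simp_all add: D_diff algebra_simps)

lemma kd_minus: "kd vs (\<lambda>t. - c t) bs = - kd vs c bs"
  using kd_diff[of vs "\<lambda>t. 0" c bs] by simp

lemma kd_add: "kd vs (\<lambda>t. c t + c' t) bs = kd vs c bs + kd vs c' bs"
  using kd_diff[of vs c "\<lambda>t. - c' t" bs] by (simp add: kd_minus)

lemma kd_sum: "finite I \<Longrightarrow> kd vs (\<lambda>t. \<Sum>i\<in>I. c i t) bs = (\<Sum>i\<in>I. kd vs (c i) bs)"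
  by (induction I rule: finite_induct) (auto simp: kd_add)

text \<open>An additive operator that commutes with every \<open>D v\<close> is a map of Koszul
  complexes; this is applied to \<open>D v\<close>, to its powers and to the cofactors
  \<open>Q i\<close>.\<close>

lemma kd_commute:
  assumes "\<And>x y. A (x - y) = A x - A y" "\<And>v x. A (D v x) = D v (A x)"
  shows "kd vs (\<lambda>t. A (c t)) bs = A (kd vs c bs)"
proof -
  have "A 0 = 0" using assms(1)[of 0 0] by simp
  then show ?thesis
    by (induction vs c bs rule: kd.induct) (simp_all add: assms)
qed

lemma kd_replicate_False [simp]: "kd vs c (replicate n False) = 0"
proof (induction vs arbitrary: c n)
  case (Cons v vs)
  then show ?case by (cases n) auto
qed simp

text \<open>Interior product with the \<open>i\<close>-th vector, with one sign change for each
  chosen vector in front of it. A position outside the list gives 0.\<close>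

fun con :: "nat \<Rightarrow> (bool list \<Rightarrow> 'x) \<Rightarrow> bool list \<Rightarrow> 'x" where
  "con i c [] = 0"
| "con 0 c (False # t) = c (True # t)"
| "con 0 c (True # t) = 0"
| "con (Suc i) c (False # t) = con i (\<lambda>t. c (False # t)) t"
| "con (Suc i) c (True # t) = - con i (\<lambda>t. c (True # t)) t"

lemma con_diff: "con i (\<lambda>t. c t - c' t) bs = con i c bs - con i c' bs"
  by (induction i c bs arbitrary: c' rule: con.induct) (simp_all add: algebra_simps)

lemma con_D: "con i (\<lambda>t. D v (c t)) bs = D v (con i c bs)"
  by (induction i c bs rule: con.induct) (simp_all add: D_minus)

lemma con_zero: "(\<And>t. length t = length bs \<Longrightarrow> c t = 0) \<Longrightarrow> con i c bs = 0"
  by (induction i c bs rule: con.induct) auto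

lemma cochain_con: "cochain vs k c \<Longrightarrow> cochain vs k (con i c)"
proof -
  have "con i c bs \<in> g k" if "\<And>t. length t = length bs \<Longrightarrow> c t \<in> g k" for bs
    using that by (induction i c bs rule: con.induct) (auto intro: g_zero g_minus)
  then show "cochain vs k c \<Longrightarrow> cochain vs k (con i c)" by (auto simp: cochain_def)
qed

text \<open>Contraction is a homotopy from the \<open>i\<close>-th operator to zero.\<close>

lemma kd_con:
  "i < length vs \<Longrightarrow> length bs = length vs \<Longrightarrow>
    kd vs (con i c) bs + con i (kd vs c) bs = D (vs ! i) (c bs)"
proof (induction vs arbitrary: i c bs)
  case (Cons v vs)
  then obtain b t where bs: "bs = b # t" "length t = length vs" by (cases bs) auto
  show ?case
  proof (cases i)
    case 0
    then show ?thesis by (cases b) (simp_all add: bs)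
  next
    case (Suc j)
    then have j: "j < length vs" using Cons.prems by simp
    note IH = Cons.IH[OF j bs(2)]
    show ?thesis
    proof (cases b)
      case True
      then show ?thesis
        using IH[of "\<lambda>t. c (True # t)"]
        by (simp add: bs Suc kd_minus con_diff con_D algebra_simps)
    next
      case False
      then show ?thesis using IH[of "\<lambda>t. c (False # t)"] by (simp add: bs Suc)
    qed
  qed
qed simp

text \<open>The element \<open>x\<close> is viewed as a cochain of form degree 0. It is closed by
  assumption, and every coboundary vanishes at the list of \<open>False\<close>s, so exactness
  leaves only 0.\<close>

lemma acyclic_kernel:
  assumes "acyclic vs k" "x \<in> g k" "\<And>v. v \<in> set vs \<Longrightarrow> D v x = 0"
  shows "x = 0"
proof -
  define e where "e = (\<lambda>bs. if True \<in> set bs then 0 else x)"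
  have "kd us e bs = 0" if "set us \<subseteq> set vs" for us bs
    using that
  proof (induction us arbitrary: bs)
    case (Cons u us)
    show ?case
    proof (cases bs)
      case (Cons b t)
      then show ?thesis using Cons.IH[of t] Cons.prems assms(3) by (cases b) (auto simp: e_def)
    qed simp
  qed simp
  then have "cocycle vs k e" using assms(2) by (auto simp: cocycle_def cochain_def e_def g_zero)
  then obtain y where "\<And>bs. length bs = length vs \<Longrightarrow> e bs = kd vs y bs"
    using assms(1) by (auto simp: acyclic_def exact_def)
  from this[of "replicate (length vs) False"] show ?thesis by (auto simp: e_def split: if_splits)
qed

section \<open>Enlarging and shrinking the list of vectors\<close>

text \<open>The sign of the form degree, which enters when a vector joins the list at the end: its
  covector has to pass all the earlier ones.\<close>

definition sg :: "bool list \<Rightarrow> 'x \<Rightarrow> 'x" where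
  "sg bs x = (if even (length (filter id bs)) then x else - x)"

lemma sg_simps [simp]: "sg [] x = x" "sg (False # bs) x = sg bs x" "sg (True # bs) x = - sg bs x"
  by (auto simp: sg_def)

lemma sg_D: "sg bs (D v x) = D v (sg bs x)"
  by (simp add: sg_def D_minus)

text \<open>The differential raises the form degree by one, so it anticommutes with the
  sign.\<close>

lemma kd_sg: "kd vs (\<lambda>t. sg t (c t)) bs = - sg bs (kd vs c bs)"
proof (induction vs c bs rule: kd.induct)
  case (4 v vs c bs)
  then show ?case by (simp add: kd_minus sg_D) (simp add: sg_def D_minus)
qed (simp_all add: sg_def)

lemma kd_append_False:
  "length bs = length vs \<Longrightarrow> kd (vs @ [w]) c (bs @ [False]) = kd vs (\<lambda>t. c (t @ [False])) bs"
proof (induction vs c bs rule: kd.induct)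
qed auto

lemma kd_append_True:
  "length bs = length vs \<Longrightarrow>
    kd (vs @ [w]) c (bs @ [True]) = kd vs (\<lambda>t. c (t @ [True])) bs + sg bs (D w (c (bs @ [False])))"
proof (induction vs c bs rule: kd.induct)
qed auto

text \<open>This is the cone of \<open>D w\<close> between two copies of one acyclic complex. The
  part without \<open>w\<close> has a primitive \<open>y\<close>; the signed correction by
  \<open>D w\<close> of \<open>y\<close> makes the part with \<open>w\<close> closed, so that it has
  a primitive too.\<close>

lemma acyclic_snoc:
  assumes ac: "acyclic vs k"
  shows "acyclic (vs @ [w]) k"
  unfolding acyclic_def
proof (intro allI impI)
  fix c assume c: "cocycle (vs @ [w]) k c"
  define cF where "cF = (\<lambda>t. c (t @ [False]))"
  define cT where "cT = (\<lambda>t. c (t @ [True]))"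
  have c': "c (bs @ [b]) \<in> g k" "kd (vs @ [w]) c (bs @ [b]) = 0" if "length bs = length vs" for bs b
    using c that by (auto simp: cocycle_def cochain_def)
  have "cocycle vs k cF"
    using c'(1) c'(2)[of _ False] kd_append_False[of _ vs w c]
    by (auto simp: cocycle_def cochain_def cF_def)
  then obtain y where y: "cochain vs (Suc k) y" "\<And>bs. length bs = length vs \<Longrightarrow> cF bs = kd vs y bs"
    using ac by (auto simp: acyclic_def exact_def)
  define e where "e = (\<lambda>t. cT t - sg t (D w (y t)))"
  have "cochain vs k e"
    using c' y(1) unfolding cochain_def e_def cT_def sg_def
    by (auto simp del: diff_minus_eq_add intro!: g_diff D_g g_minus)
  moreover have "kd vs e bs = 0" if "length bs = length vs" for bs
  proof -
    have "kd vs cT bs + sg bs (D w (cF bs)) = 0"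
      using c'(2)[OF that, of True] kd_append_True[OF that, of w c] by (simp add: cT_def cF_def)
    then show ?thesis
      using that by (simp add: e_def kd_diff kd_sg kd_commute[of "D w"] D_diff D_comm y(2))
  qed
  ultimately have "cocycle vs k e" by (simp add: cocycle_def)
  then obtain z where z: "cochain vs (Suc k) z" "\<And>bs. length bs = length vs \<Longrightarrow> e bs = kd vs z bs"
    using ac by (auto simp: acyclic_def exact_def)
  define Y where "Y s = (if last s then z (butlast s) else y (butlast s))" for s
  have "c bs = kd (vs @ [w]) Y bs \<and> Y bs \<in> g (Suc k)" if len: "length bs = length (vs @ [w])" for bs
  proof -
    obtain t b where bs: "bs = t @ [b]" "length t = length vs"
      using len by (cases bs rule: rev_cases) auto
    have "c (t @ [True]) = kd vs z t + sg t (D w (y t))"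
      using z(2)[OF bs(2)] by (simp add: e_def cT_def algebra_simps)
    moreover have "c (t @ [False]) = kd vs y t" using y(2)[OF bs(2)] by (simp add: cF_def)
    ultimately show ?thesis
      using y(1) z(1) bs
      by (cases b) (simp_all add: kd_append_True kd_append_False Y_def cochain_def)
  qed
  then show "exact (vs @ [w]) k c" by (auto simp: exact_def cochain_def)
qed

lemma acyclic_append: "acyclic vs k \<Longrightarrow> acyclic (vs @ ws) k"
proof (induction ws rule: rev_induct)
  case (snoc w ws)
  then show ?case using acyclic_snoc[of "vs @ ws" k w] by simp
qed simp

text \<open>
  Acyclicity of the larger complex makes \<open>D v\<close> surjective on the cohomology of the smaller one,
  while the factorisation of \<open>D v ^^ L\<close> makes it nilpotent there.
\<close>

lemma acyclic_remove:
  assumes ac: "\<And>j. k \<le> j \<Longrightarrow> j < k + L \<Longrightarrow> acyclic (v # vs) j"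
    and Q: "\<And>i x y. Q i (x - y) = Q i x - Q i y" "\<And>i u x. Q i (D u x) = D u (Q i x)"
      "\<And>i x. x \<in> g (k + L) \<Longrightarrow> Q i x \<in> g (Suc k)"
    and I: "finite I" "\<And>i. i \<in> I \<Longrightarrow> u i \<in> set vs"
    and fac: "\<And>x. x \<in> g (k + L) \<Longrightarrow> (D v ^^ L) x = (\<Sum>i\<in>I. D (u i) (Q i x))"
  shows "acyclic vs k"
  unfolding acyclic_def
proof (intro allI impI)
  fix c assume c: "cocycle vs k c"
  \<comment> \<open>Invariant: up to a coboundary, \<open>c\<close> is \<open>D v ^^ i\<close> of a
    cocycle living \<open>i\<close> degrees higher.\<close>
  have "\<exists>y z. cocycle vs (k + i) y \<and> cochain vs (Suc k) z \<and>
      (\<forall>bs. length bs = length vs \<longrightarrow> c bs = (D v ^^ i) (y bs) + kd vs z bs)" if "i \<le> L" for i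
    using that
  proof (induction i)
    case 0
    show ?case using c by (intro exI[of _ c] exI[of _ "\<lambda>t. 0"]) (auto simp: cochain_def g_zero)
  next
    case (Suc i)
    then obtain y z where y: "cocycle vs (k + i) y" and z: "cochain vs (Suc k) z"
      and yz: "\<And>bs. length bs = length vs \<Longrightarrow> c bs = (D v ^^ i) (y bs) + kd vs z bs"
      by (auto simp: Suc_le_eq)
    \<comment> \<open>Wedging \<open>y\<close> with the covector of \<open>v\<close> gives a cocycle
      of the larger complex. A primitive with components \<open>a\<close> and \<open>b\<close>
      yields \<open>y = D v a - kd b\<close> with \<open>a\<close> closed, which is surjectivity of
      \<open>D v\<close> on cohomology.\<close>
    define e where "e s = (if hd s then y (tl s) else 0)" for s
    have eT: "(\<lambda>t. e (True # t)) = y" and eF: "(\<lambda>t. e (False # t)) = (\<lambda>t. 0)" by (auto simp: e_def)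
    have "e bs \<in> g (k + i) \<and> kd (v # vs) e bs = 0" if len: "length bs = length (v # vs)" for bs
    proof -
      obtain b t where bs: "bs = b # t" "length t = length vs" using len by (cases bs) auto
      show ?thesis
      proof (cases b)
        case True
        then show ?thesis using y bs eT by (simp add: cocycle_def cochain_def e_def)
      next
        case False
        then show ?thesis using bs eF by (simp add: e_def g_zero)
      qed
    qed
    then have "cocycle (v # vs) (k + i) e" by (simp add: cocycle_def cochain_def)
    moreover have "acyclic (v # vs) (k + i)" using ac Suc.prems by simp
    ultimately obtain w where w: "cochain (v # vs) (Suc (k + i)) w"
      and ew: "\<And>bs. length bs = length (v # vs) \<Longrightarrow> e bs = kd (v # vs) w bs"
      by (auto simp: acyclic_def exact_def)
    define a where "a = (\<lambda>t. w (False # t))"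
    define b where "b = (\<lambda>t. w (True # t))"
    have ab: "cochain vs (Suc (k + i)) a" "cochain vs (Suc (k + i)) b"
      using w by (auto simp: cochain_def a_def b_def)
    have "kd vs a t = 0" "y t = D v (a t) - kd vs b t" if "length t = length vs" for t
      using ew[of "False # t"] ew[of "True # t"] that by (auto simp: a_def b_def e_def)
    note kd_ab = this
    have "cocycle vs (k + Suc i) a" using ab kd_ab by (simp add: cocycle_def)
    moreover have "cochain vs (Suc k) (\<lambda>t. z t - (D v ^^ i) (b t))"
      using z ab(2) by (auto simp: cochain_def intro!: g_diff D_pow_g)
    moreover have "c bs = (D v ^^ Suc i) (a bs) + kd vs (\<lambda>t. z t - (D v ^^ i) (b t)) bs"
      if "length bs = length vs" for bs
      using yz[OF that] kd_ab(2)[OF that]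
      by (simp add: kd_diff kd_commute[of "D v ^^ i"] D_pow_diff D_pow_comm)
    ultimately show ?case by blast
  qed
  from this[of L] obtain y z where y: "cocycle vs (k + L) y" and z: "cochain vs (Suc k) z"
    and yz: "\<And>bs. length bs = length vs \<Longrightarrow> c bs = (D v ^^ L) (y bs) + kd vs z bs"
    by auto
  have "\<forall>i\<in>I. \<exists>p<length vs. vs ! p = u i" using I(2) by (simp add: in_set_conv_nth)
  then obtain p where p: "\<And>i. i \<in> I \<Longrightarrow> p i < length vs" "\<And>i. i \<in> I \<Longrightarrow> vs ! p i = u i"
    by metis
  \<comment> \<open>Each \<open>u i\<close> lies in \<open>vs\<close>, so \<open>D (u i)\<close> is
    homotopic to zero by contraction at its position \<open>p i\<close>; summing these homotopies
    gives a primitive of \<open>(D v ^^ L) y\<close>.\<close>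
  define h where "h = (\<lambda>t. (\<Sum>i\<in>I. con (p i) (\<lambda>t. Q i (y t)) t))"
  have yg: "y t \<in> g (k + L)" if "length t = length vs" for t
    using y that by (simp add: cocycle_def cochain_def)
  have "cochain vs (Suc k) (\<lambda>t. Q i (y t))" for i
    using yg Q(3) by (simp add: cochain_def)
  then have "cochain vs (Suc k) (con (p i) (\<lambda>t. Q i (y t)))" for i by (rule cochain_con)
  then have "cochain vs (Suc k) (\<lambda>t. h t + z t)"
    using z by (auto simp: h_def cochain_def intro!: g_add g_sum I(1))
  moreover have "c bs = kd vs (\<lambda>t. h t + z t) bs" if bs: "length bs = length vs" for bs
  proof -
    have Q0: "Q i 0 = 0" for i using Q(1)[of i 0 0] by simp
    have "D (u i) (Q i (y bs)) = kd vs (con (p i) (\<lambda>t. Q i (y t))) bs" if "i \<in> I" for i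
    proof -
      have "con (p i) (kd vs (\<lambda>t. Q i (y t))) bs = 0"
        using y bs by (intro con_zero) (simp add: kd_commute[of "Q i"] Q Q0 cocycle_def)
      then show ?thesis using kd_con[OF p(1)[OF that] bs, of "\<lambda>t. Q i (y t)"] p(2)[OF that] by simp
    qed
    then have "(D v ^^ L) (y bs) = kd vs h bs"
      using fac[OF yg[OF bs]] by (simp add: h_def kd_sum I(1))
    then show ?thesis using yz[OF bs] by (simp add: kd_add)
  qed
  ultimately show "exact vs k c" by (auto simp: exact_def)
qed

text \<open>Quasi-regularity of a flag kills the Koszul cohomology in positive form degree.\<close>

lemma exact_of_quasi_regular:
  assumes "\<And>i x. i < length fl \<Longrightarrow> x \<in> g k \<Longrightarrow> (\<And>u. u \<in> set (take i fl) \<Longrightarrow> D u x = 0) \<Longrightarrow>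
      \<exists>y\<in>g (Suc k). (\<forall>u\<in>set (take i fl). D u y = 0) \<and> D (fl ! i) y = x"
    and "cocycle (rev fl) k c" "c (replicate (length fl) False) = 0"
  shows "exact (rev fl) k c"
  using assms
proof (induction fl arbitrary: c rule: rev_induct)
  case Nil
  then show ?case by (auto simp: exact_def cochain_def intro!: exI[of _ "\<lambda>t. 0"] g_zero)
next
  case (snoc v fl)
  \<comment> \<open>The flag is reversed because the differential splits off the head of a list,
    while the induction removes the last flag vector.\<close>
  let ?vs = "rev fl" and ?F = "replicate (length fl) False"
  have reg: "\<exists>y\<in>g (Suc k). (\<forall>u\<in>set (take i fl). D u y = 0) \<and> D (fl ! i) y = x"
    if "i < length fl" "x \<in> g k" "\<And>u. u \<in> set (take i fl) \<Longrightarrow> D u x = 0" for i x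
    using snoc.prems(1)[of i x] that by (simp add: nth_append)
  have reg_v: "\<exists>y\<in>g (Suc k). (\<forall>u\<in>set fl. D u y = 0) \<and> D v y = x"
    if "x \<in> g k" "\<And>u. u \<in> set fl \<Longrightarrow> D u x = 0" for x
    using snoc.prems(1)[of "length fl" x] that by simp
  have IH: "exact ?vs k c'" if "cocycle ?vs k c'" "c' ?F = 0" for c'
    by (rule snoc.IH[OF _ that]) (rule reg)
  define a where "a = (\<lambda>t. c (False # t))"
  define b where "b = (\<lambda>t. c (True # t))"
  have c: "c (q # t) \<in> g k" "kd (v # ?vs) c (q # t) = 0" if "length t = length fl" for q t
    using snoc.prems(2) that by (auto simp: cocycle_def cochain_def)
  have "cocycle ?vs k a" "a ?F = 0"
    using c(1)[of _ False] c(2)[of _ False] snoc.prems(3) by (auto simp: cocycle_def cochain_def a_def)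
  then obtain y where y: "cochain ?vs (Suc k) y" "\<And>t. length t = length fl \<Longrightarrow> a t = kd ?vs y t"
    using IH[of a] by (auto simp: exact_def)
  define e where "e = (\<lambda>t. b t - D v (y t))"
  have e: "e t \<in> g k" if "length t = length fl" for t
    using c(1)[OF that, of True] y(1) that by (auto simp: e_def b_def cochain_def intro!: g_diff D_g)
  have kd_e: "kd ?vs e t = 0" if "length t = length fl" for t
    using c(2)[OF that, of True] y(2)[OF that]
    by (simp add: e_def kd_diff kd_commute[of "D v"] D_diff D_comm a_def b_def)
  \<comment> \<open>Both terms of the homotopy formula vanish at \<open>?F\<close>: the contraction
    of \<open>kd e\<close> because \<open>e\<close> is closed, and a value of \<open>kd\<close> at
    the list of \<open>False\<close>s always.\<close>
  have "D u (e ?F) = 0" if "u \<in> set fl" for u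
  proof -
    from that obtain i where i: "i < length ?vs" "?vs ! i = u" by (metis in_set_conv_nth set_rev)
    have "con i (kd ?vs e) ?F = 0" by (intro con_zero) (simp add: kd_e)
    then show ?thesis using kd_con[OF i(1), of ?F e] i(2) by simp
  qed
  from reg_v[OF e this] obtain x where x: "x \<in> g (Suc k)" "\<And>u. u \<in> set fl \<Longrightarrow> D u x = 0" "D v x = e ?F"
    by auto
  \<comment> \<open>\<open>y\<close> may be changed by the closed cochain built from
    \<open>x\<close>. Quasi-regularity provides an \<open>x\<close> for which the form degree 0 part
    of \<open>e - D v \<eta>\<close> vanishes, as the induction hypothesis demands.\<close>
  define \<eta> where "\<eta> bs = (if True \<in> set bs then 0 else x)" for bs
  have \<eta>: "kd us \<eta> bs = 0" if "set us \<subseteq> set fl" for us bs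
    using that
  proof (induction us arbitrary: bs)
    case (Cons u us)
    show ?case
    proof (cases bs)
      case (Cons q t)
      then show ?thesis using Cons.IH[of t] Cons.prems x(2) by (cases q) (auto simp: \<eta>_def)
    qed simp
  qed simp
  have \<eta>g: "\<eta> t \<in> g (Suc k)" for t using x(1) by (simp add: \<eta>_def g_zero)
  define f where "f = (\<lambda>t. e t - D v (\<eta> t))"
  have "cocycle ?vs k f"
    using e kd_e \<eta>g \<eta>[of ?vs]
    by (auto simp: f_def cocycle_def cochain_def kd_diff kd_commute[of "D v"] D_diff D_comm
        intro!: g_diff D_g)
  moreover have "f ?F = 0" using x(3) by (simp add: f_def \<eta>_def)
  ultimately obtain z where z: "cochain ?vs (Suc k) z" "\<And>t. length t = length fl \<Longrightarrow> f t = kd ?vs z t"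
    using IH[of f] by (auto simp: exact_def)
  define Y where "Y s = (if hd s then - z (tl s) else y (tl s) + \<eta> (tl s))" for s
  have "c bs = kd (v # ?vs) Y bs \<and> Y bs \<in> g (Suc k)" if len: "length bs = length (v # ?vs)" for bs
  proof -
    obtain q t where bs: "bs = q # t" "length t = length fl" using len by (cases bs) auto
    have "c (False # t) = kd ?vs (\<lambda>t. y t + \<eta> t) t"
      using y(2)[OF bs(2)] \<eta>[of ?vs] by (simp add: kd_add a_def)
    moreover have "c (True # t) = D v (y t + \<eta> t) + kd ?vs z t"
      using z(2)[OF bs(2)] by (simp add: f_def e_def b_def D_add algebra_simps)
    ultimately show ?thesis
      using y(1) z(1) bs \<eta>g
      by (cases q) (auto simp: Y_def cochain_def kd_minus intro: g_add g_minus)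
  qed
  then show ?case by (auto simp: exact_def cochain_def)
qed

text \<open>The form degree 0 part of a cocycle is killed by the whole flag, hence zero by
  \<open>ker\<close>; this is the extra condition under which a quasi-regular flag gives
  exactness.\<close>

lemma acyclic_of_quasi_regular:
  assumes "\<And>i x. i < length fl \<Longrightarrow> x \<in> g k \<Longrightarrow> (\<And>u. u \<in> set (take i fl) \<Longrightarrow> D u x = 0) \<Longrightarrow>
      \<exists>y\<in>g (Suc k). (\<forall>u\<in>set (take i fl). D u y = 0) \<and> D (fl ! i) y = x"
    and ker: "\<And>x. x \<in> g k \<Longrightarrow> (\<And>u. u \<in> set fl \<Longrightarrow> D u x = 0) \<Longrightarrow> x = 0"
  shows "acyclic (rev fl) k"
  unfolding acyclic_def
proof (intro allI impI)
  fix c assume c: "cocycle (rev fl) k c"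
  let ?F = "replicate (length fl) False"
  have "D u (c ?F) = 0" if "u \<in> set fl" for u
  proof -
    from that obtain i where i: "i < length (rev fl)" "rev fl ! i = u"
      by (metis in_set_conv_nth set_rev)
    have "con i (kd (rev fl) c) ?F = 0" using c by (intro con_zero) (simp add: cocycle_def)
    then show ?thesis using kd_con[OF i(1), of ?F c] i(2) by simp
  qed
  then have "c ?F = 0" using c by - (rule ker, auto simp: cocycle_def cochain_def)
  show "exact (rev fl) k c"
    by (rule exact_of_quasi_regular[OF _ c \<open>c ?F = 0\<close>]) (rule assms(1))
qed

end

subsection \<open>Symbolic systems in coordinates\<close>

interpretation cf: vector_space "pscale (*) :: complex \<Rightarrow> ('a \<Rightarrow> complex) \<Rightarrow> 'a \<Rightarrow> complex"
  by unfold_locales (auto simp: pscale_def fun_eq_iff algebra_simps)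

lemma sum_apply: "(\<Sum>i\<in>I. f i) x = (\<Sum>i\<in>I. f i x)"
  for f :: "'i \<Rightarrow> 'a \<Rightarrow> 'b::comm_monoid_add"
  by (induction I rule: infinite_finite_induct) auto

text \<open>
  With \<open>n = dim T\<close> and \<open>d = dim N\<close>, a polynomial map \<open>p\<close> of degree \<open>k\<close> is encoded by the scalar
  function that takes the multiset \<open>add_mset (n + j) m\<close>, with \<open>m\<close> a multiset of size \<open>k\<close> over
  \<open>{..<n}\<close> and \<open>j < d\<close>, to the \<open>j\<close>-th coordinate of the iterated partial derivative of \<open>p\<close>
  indexed by \<open>m\<close>. Derivatives then become shifts.
\<close>

locale macaulay =
  fixes n d :: nat
begin

definition idx :: "nat \<Rightarrow> nat multiset set" where
  "idx k = {add_mset j m | j m. n \<le> j \<and> j < n + d \<and> set_mset m \<subseteq> {..<n} \<and> size m = k}"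

definition X :: "nat \<Rightarrow> (nat multiset \<Rightarrow> complex) set" where
  "X k = {F. \<forall>x. x \<notin> idx k \<longrightarrow> F x = 0}"

definition D :: "(nat \<Rightarrow> complex) \<Rightarrow> (nat multiset \<Rightarrow> complex) \<Rightarrow> nat multiset \<Rightarrow> complex" where
  "D v F = (\<lambda>x. \<Sum>b<n. v b * F (add_mset b x))"

definition unit_vec :: "nat \<Rightarrow> nat \<Rightarrow> complex" where
  "unit_vec b = (\<lambda>i. if i = b then 1 else 0)"

definition system :: "(nat \<Rightarrow> (nat multiset \<Rightarrow> complex) set) \<Rightarrow> bool" where
  "system g \<longleftrightarrow> (\<forall>k. cf.subspace (g k) \<and> g k \<subseteq> X k \<and> (\<forall>v. \<forall>F\<in>g (Suc k). D v F \<in> g k))"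

text \<open>The multiset order on naturals is a well-founded linear order compatible with
  \<open>add_mset\<close>, so it serves as a monomial order. As derivatives are shifts, the leading
  multisets of a system are closed under removing variables, like standard monomials modulo an
  ideal.\<close>

definition leads :: "(nat multiset \<Rightarrow> complex) set \<Rightarrow> nat multiset set" where
  "leads S = {x. \<exists>F\<in>S. F x \<noteq> 0 \<and> (\<forall>y>x. F y = 0)}"

lemma D_add: "D v (F + G) = D v F + D v G"
  by (simp add: D_def fun_eq_iff distrib_left sum.distrib)

lemma D_diff: "D v (F - G) = D v F - D v G"
  by (simp add: D_def fun_eq_iff algebra_simps sum_subtractf)

lemma D_scale: "D v (pscale (*) c F) = pscale (*) c (D v F)"
  by (simp add: D_def pscale_def fun_eq_iff sum_distrib_left algebra_simps)

lemma D_zero [simp]: "D v 0 = 0"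
  by (simp add: D_def fun_eq_iff)

lemma D_comm: "D u (D v F) = D v (D u F)"
proof
  fix x
  have "D u (D v F) x = (\<Sum>b<n. \<Sum>c<n. u b * (v c * F (add_mset c (add_mset b x))))"
    by (simp add: D_def sum_distrib_left)
  also have "\<dots> = (\<Sum>c<n. \<Sum>b<n. u b * (v c * F (add_mset c (add_mset b x))))"
    by (rule sum.swap)
  also have "\<dots> = D v (D u F) x"
    by (simp add: D_def sum_distrib_left add_mset_commute mult.left_commute)
  finally show "D u (D v F) x = D v (D u F) x" .
qed

lemma D_unit: "b < n \<Longrightarrow> D (unit_vec b) F = (\<lambda>x. F (add_mset b x))"
proof
  fix x assume b: "b < n"
  have "D (unit_vec b) F x = (\<Sum>i<n. if i = b then F (add_mset i x) else 0)"
    unfolding D_def unit_vec_def by (intro sum.cong) auto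
  then show "D (unit_vec b) F x = F (add_mset b x)" using b by simp
qed

lemma D_expand: "D v F = (\<lambda>x. \<Sum>b<n. v b * D (unit_vec b) F x)"
  by (subst D_def) (auto simp: D_unit intro!: ext sum.cong)

lemma D_lin: "D (\<lambda>b. u b - c * v b) F = D u F - pscale (*) c (D v F)"
  by (simp add: D_def pscale_def fun_eq_iff algebra_simps sum_subtractf sum_distrib_left)

lemma idx_add_mset_iff: "b < n \<Longrightarrow> add_mset b x \<in> idx (Suc k) \<longleftrightarrow> x \<in> idx k"
proof
  assume b: "b < n" and "add_mset b x \<in> idx (Suc k)"
  then obtain j m where *: "add_mset b x = add_mset j m" "n \<le> j" "j < n + d" "set_mset m \<subseteq> {..<n}"
    "size m = Suc k" by (auto simp: idx_def)
  then obtain m' where m': "m = add_mset b m'" "x = add_mset j m'"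
    using b by (auto simp: add_eq_conv_ex)
  show "x \<in> idx k"
    unfolding idx_def m'(2) mem_Collect_eq
    by (rule exI[of _ j], rule exI[of _ m']) (use * m'(1) in auto)
next
  assume b: "b < n" and "x \<in> idx k"
  then obtain j m where *: "x = add_mset j m" "n \<le> j" "j < n + d" "set_mset m \<subseteq> {..<n}" "size m = k"
    by (auto simp: idx_def)
  show "add_mset b x \<in> idx (Suc k)"
    unfolding idx_def *(1) mem_Collect_eq
    by (rule exI[of _ j], rule exI[of _ "add_mset b m"]) (use * b in \<open>auto simp: add_mset_commute\<close>)
qed

lemma idx_subset: "x \<in> idx k \<Longrightarrow> set_mset x \<subseteq> {..<n + d}"
  by (auto simp: idx_def)

lemma size_idx: "x \<in> idx k \<Longrightarrow> size x = Suc k"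
  by (auto simp: idx_def)

lemma idx_Suc_cases:
  assumes "x \<in> idx (Suc k)"
  obtains b y where "b < n" "y \<in> idx k" "x = add_mset b y"
proof -
  from assms obtain j m where *: "x = add_mset j m" "n \<le> j" "j < n + d" "set_mset m \<subseteq> {..<n}"
    "size m = Suc k" by (auto simp: idx_def)
  from *(5) obtain b m' where m: "m = add_mset b m'" by (cases m) auto
  then have b: "b < n" using * by auto
  have x: "x = add_mset b (add_mset j m')" using * m by (simp add: add_mset_commute)
  then have "add_mset j m' \<in> idx k" using assms idx_add_mset_iff[OF b] by simp
  then show ?thesis using b x that by blast
qed

lemma finite_idx: "finite (idx k)"
proof (induction k)
  case 0
  have "idx 0 = (\<lambda>j. {#j#}) ` {n..<n + d}" by (auto simp: idx_def)
  then show ?case by simp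
next
  case (Suc k)
  have "idx (Suc k) \<subseteq> (\<lambda>(b, y). add_mset b y) ` ({..<n} \<times> idx k)"
    by (auto elim!: idx_Suc_cases)
  then show ?case using Suc by (meson finite_SigmaI finite_imageI finite_lessThan finite_subset)
qed

lemma subspace_X: "cf.subspace (X k)"
  by (auto simp: cf.subspace_def X_def pscale_def)

lemma D_X: "F \<in> X (Suc k) \<Longrightarrow> D v F \<in> X k"
  by (auto simp: X_def D_def idx_add_mset_iff intro!: sum.neutral)

lemma D_X_0: "F \<in> X 0 \<Longrightarrow> D v F = 0"
proof
  fix x assume F: "F \<in> X 0"
  have "F (add_mset b x) = 0" if "b < n" for b
  proof -
    have "add_mset b x \<notin> idx 0" using that by (auto simp: idx_def)
    then show ?thesis using F by (simp add: X_def)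
  qed
  then show "D v F x = 0 x" by (simp add: D_def)
qed

text \<open>In positive degree every index contains a variable, so each value of \<open>F\<close> is
  a value of one of its partial derivatives. Constants show why degree 0 is excluded.\<close>

lemma eq_zero_of_D:
  assumes "F \<in> X (Suc k)" "\<And>v. D v F = 0"
  shows "F = 0"
proof
  fix x show "F x = 0 x"
  proof (cases "x \<in> idx (Suc k)")
    case True
    then obtain b y where b: "b < n" "x = add_mset b y" by (auto elim: idx_Suc_cases)
    then show ?thesis using assms(2)[of "unit_vec b"] by (simp add: D_unit fun_eq_iff)
  qed (use assms(1) in \<open>auto simp: X_def\<close>)
qed

lemma X_subset_span: "X k \<subseteq> cf.span ((\<lambda>x y. if y = x then 1 else 0) ` idx k)"
proof
  fix F assume F: "F \<in> X k"
  have "F = (\<Sum>x\<in>idx k. pscale (*) (F x) (\<lambda>y. if y = x then 1 else 0))"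
  proof
    fix y
    have "(\<Sum>x\<in>idx k. pscale (*) (F x) (\<lambda>y. if y = x then 1 else 0)) y = (\<Sum>x\<in>idx k. if y = x then F x else 0)"
      by (simp add: pscale_def sum_apply if_distrib cong: if_cong)
    also have "\<dots> = F y" using F finite_idx[of k] by (auto simp: X_def)
    finally show "F y = (\<Sum>x\<in>idx k. pscale (*) (F x) (\<lambda>y. if y = x then 1 else 0)) y" by simp
  qed
  also have "\<dots> \<in> cf.span ((\<lambda>x y. if y = x then 1 else 0) ` idx k)"
    by (intro cf.span_sum cf.span_scale cf.span_base) auto
  finally show "F \<in> cf.span ((\<lambda>x y. if y = x then 1 else 0) ` idx k)" .
qed

lemma systemD:
  assumes "system g"
  shows "cf.subspace (g k)" "g k \<subseteq> X k" "F \<in> g (Suc k) \<Longrightarrow> D v F \<in> g k"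
  using assms by (auto simp: system_def)

lemma system_zero: "system g \<Longrightarrow> 0 \<in> g k"
  using systemD(1) cf.subspace_0 by blast

section \<open>Leading multisets and finiteness\<close>

lemma subset_X_support_finite: "S \<subseteq> X k \<Longrightarrow> F \<in> S \<Longrightarrow> finite {x. F x \<noteq> 0}"
  by (rule finite_subset[OF _ finite_idx[of k]]) (auto simp: X_def)

lemma lead_exists:
  assumes "F \<in> X k" "F \<noteq> 0"
  obtains x where "F x \<noteq> 0" "\<And>y. x < y \<Longrightarrow> F y = 0"
proof -
  let ?A = "{x. F x \<noteq> 0}"
  have fin: "finite ?A" by (rule subset_X_support_finite[OF subset_refl assms(1)])
  moreover have ne: "?A \<noteq> {}" using assms(2) by (auto simp: fun_eq_iff)
  ultimately have "F (Max ?A) \<noteq> 0" using Max_in by blast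
  moreover have "F y = 0" if lt: "Max ?A < y" for y
    by (rule ccontr) (use Max_ge[OF fin, of y] lt in \<open>auto dest: leD\<close>)
  ultimately show ?thesis using that by blast
qed

lemma leads_subset_idx: "S \<subseteq> X k \<Longrightarrow> leads S \<subseteq> idx k"
  by (auto simp: leads_def X_def)

lemma leads_mono: "S \<subseteq> S' \<Longrightarrow> leads S \<subseteq> leads S'"
  by (auto simp: leads_def)

text \<open>\<open>add_mset b\<close> preserves the order strictly, so the partial derivative along
  \<open>b\<close> moves the leading multiset \<open>add_mset b x\<close> of \<open>F\<close> to
  \<open>x\<close>.\<close>

lemma leads_D:
  assumes "\<And>F v. F \<in> S \<Longrightarrow> D v F \<in> S'" "b < n" "add_mset b x \<in> leads S"
  shows "x \<in> leads S'"
proof -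
  obtain F where F: "F \<in> S" "F (add_mset b x) \<noteq> 0" "\<And>y. add_mset b x < y \<Longrightarrow> F y = 0"
    using assms(3) by (auto simp: leads_def)
  have "add_mset b x < add_mset b y" if "x < y" for y using that by simp
  then show ?thesis
    using F assms(1)[OF F(1), of "unit_vec b"] assms(2)
    by (auto simp: leads_def D_unit intro!: bexI[of _ "D (unit_vec b) F"])
qed

lemma leads_system:
  assumes "system g" "set_mset m \<subseteq> {..<n}" "x + m \<in> leads (g (k + size m))"
  shows "x \<in> leads (g k)"
  using assms(2,3)
proof (induction m)
  case (add b m)
  have "x + m \<in> leads (g (k + size m))"
    by (rule leads_D[where S = "g (Suc (k + size m))" and b = b])
      (use add.prems systemD(3)[OF assms(1)] in auto)
  then show ?case using add by simp
qed simp

text \<open>Reduction: subtracting a multiple of a member of \<open>S\<close> with the same leading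
  multiset lowers the leading multiset, and the order is well-founded. This takes the place of
  counting dimensions.\<close>

lemma subspace_eq_of_leads:
  assumes S: "cf.subspace S" "cf.subspace S'" "S \<subseteq> S'" "S' \<subseteq> X k" and le: "leads S' \<subseteq> leads S"
  shows "S = S'"
proof -
  have *: "\<forall>F\<in>S'. F x \<noteq> 0 \<and> (\<forall>y>x. F y = 0) \<longrightarrow> F \<in> S" for x
  proof (induction x rule: less_induct)
    case (less x)
    show ?case
    proof (intro ballI impI)
      fix F assume F: "F \<in> S'" "F x \<noteq> 0 \<and> (\<forall>y>x. F y = 0)"
      then have "x \<in> leads S" using le by (auto simp: leads_def)
      then obtain G where G: "G \<in> S" "G x \<noteq> 0" "\<And>y. x < y \<Longrightarrow> G y = 0" by (auto simp: leads_def)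
      define H where "H = F - pscale (*) (F x / G x) G"
      have H: "H \<in> S'" unfolding H_def
        using F(1) G(1) S by (intro cf.subspace_diff cf.subspace_scale) auto
      have Hx: "H y = 0" if "x \<le> y" for y
        using that F(2) G(2,3) by (cases "y = x") (auto simp: H_def pscale_def)
      have "H \<in> S"
      proof (cases "H = 0")
        case True
        then show ?thesis using S(1) cf.subspace_0 by simp
      next
        case False
        then obtain z where z: "H z \<noteq> 0" "\<And>y. z < y \<Longrightarrow> H y = 0"
          using lead_exists[of H k] H S(4) by blast
        then have "z < x" using Hx by (meson not_le)
        then show ?thesis using less[of z] H z by blast
      qed
      moreover have "F = H + pscale (*) (F x / G x) G" by (simp add: H_def)
      ultimately show "F \<in> S" using S(1) G(1) by (metis cf.subspace_add cf.subspace_scale)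
    qed
  qed
  have "F \<in> S" if "F \<in> S'" for F
  proof (cases "F = 0")
    case True
    then show ?thesis using S(1) cf.subspace_0 by simp
  next
    case False
    then show ?thesis using lead_exists[of F k] that S(4) * by blast
  qed
  then show ?thesis using S(3) by blast
qed

text \<open>Dickson's lemma is applied to variables and markers alike. Each index has exactly one
  marker, so comparable indices share it and differ by variables only, along which one can
  differentiate.\<close>

lemma idx_diff:
  assumes "x \<in> idx k" "y \<in> idx l" "x \<subseteq># y"
  obtains m where "y = x + m" "set_mset m \<subseteq> {..<n}" "l = k + size m"
proof -
  obtain m where m: "y = x + m" using assms(3) by (auto simp: subset_mset.le_iff_add)
  obtain j x' where x: "x = add_mset j x'" "n \<le> j" using assms(1) by (auto simp: idx_def)
  obtain i y' where y: "y = add_mset i y'" "set_mset y' \<subseteq> {..<n}" using assms(2) by (auto simp: idx_def)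
  have "j = i"
  proof (rule ccontr)
    assume "j \<noteq> i"
    moreover have "j \<in># y" using m x by simp
    ultimately have "j \<in># y'" using y by auto
    then show False using y(2) x(2) by auto
  qed
  then have "y' = x' + m" using m x y by simp
  then have "set_mset m \<subseteq> {..<n}" using y(2) by auto
  moreover have "l = k + size m" using size_idx[OF assms(1)] size_idx[OF assms(2)] m by simp
  ultimately show ?thesis using that m by blast
qed

text \<open>For each \<open>k\<close> in the set some leading multiset \<open>e k\<close> of the
  prolongation \<open>P k\<close> is missing from \<open>g (Suc k)\<close>. If there were infinitely
  many, two would be comparable, and differentiating from the larger down to the smaller would
  contradict the choice of the smaller.\<close>

lemma finite_orders:
  assumes g: "system g"
  shows "finite {k. \<exists>F\<in>X (Suc k). (\<forall>v. D v F \<in> g k) \<and> F \<notin> g (Suc k)}" (is "finite ?O")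
proof (rule ccontr)
  assume inf: "infinite ?O"
  define P where "P k = {F \<in> X (Suc k). \<forall>v. D v F \<in> g k}" for k
  have subP: "cf.subspace (P k)" for k
    using subspace_X[of "Suc k"] systemD(1)[OF g, of k]
    by (auto simp: cf.subspace_def P_def D_add D_scale)
  have gP: "g (Suc k) \<subseteq> P k" for k using systemD[OF g] by (auto simp: P_def)
  have "\<exists>e. e \<in> leads (P k) - leads (g (Suc k))" if "k \<in> ?O" for k
  proof (rule ccontr)
    assume "\<not> ?thesis"
    then have "g (Suc k) = P k"
      using systemD(1)[OF g] subP gP by (intro subspace_eq_of_leads[where k = "Suc k"]) (auto simp: P_def)
    then show False using that by (auto simp: P_def)
  qed
  then obtain e where e: "\<And>k. k \<in> ?O \<Longrightarrow> e k \<in> leads (P k)" "\<And>k. k \<in> ?O \<Longrightarrow> e k \<notin> leads (g (Suc k))"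
    by (metis (no_types, lifting) DiffD1 DiffD2)
  define s where "s = enumerate ?O"
  have s: "s i \<in> ?O" for i unfolding s_def by (rule enumerate_in_set[OF inf])
  have e_idx: "e (s i) \<in> idx (Suc (s i))" for i
    using e(1)[OF s] leads_subset_idx[of "P (s i)" "Suc (s i)"] by (auto simp: P_def)
  then obtain i j where ij: "i < j" "e (s i) \<subseteq># e (s j)"
    using dickson[of "{..<n + d}" "\<lambda>i. e (s i)"] idx_subset by blast
  obtain m where m: "e (s j) = e (s i) + m" "set_mset m \<subseteq> {..<n}" "Suc (s j) = Suc (s i) + size m"
    using idx_diff[OF e_idx e_idx ij(2)] by blast
  \<comment> \<open>This makes \<open>m\<close> nonempty. One of its elements is spent on passing
    from \<open>P (s j)\<close> to \<open>g (s j)\<close>; within \<open>g\<close> the others can be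
    removed freely.\<close>
  have "s i < s j" unfolding s_def by (rule enumerate_mono[OF ij(1) inf])
  then obtain b m' where m': "m = add_mset b m'" using m(3) by (cases m) auto
  have "e (s i) + m' \<in> leads (g (s j))"
    by (rule leads_D[where S = "P (s j)" and b = b])
      (use m m' e(1)[OF s[of j]] in \<open>auto simp: P_def\<close>)
  moreover have "s j = Suc (s i) + size m'" using m(3) m' by simp
  ultimately have "e (s i) \<in> leads (g (Suc (s i)))"
    using leads_system[OF g, of m' "e (s i)" "Suc (s i)"] m(2) m' by auto
  then show False using e(2)[OF s] by blast
qed

text \<open>The chain condition dual to the Noetherian property. Each strict inclusion loses a
  leading multiset in some degree; if an earlier lost one is contained in a later one,
  differentiation brings it back into a later and smaller system.\<close>

lemma wf_systems: "wf {(h, g). system h \<and> system g \<and> h < g}"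
  unfolding wf_iff_no_infinite_down_chain
proof
  assume "\<exists>f. \<forall>i. (f (Suc i), f i) \<in> {(h, g). system h \<and> system g \<and> h < g}"
  then obtain f where sys: "\<And>i. system (f i)" and less: "\<And>i. f (Suc i) < f i" by blast
  have anti: "f j k \<subseteq> f i k" if "i \<le> j" for i j k
  proof -
    have "f j \<le> f i" by (rule lift_Suc_antimono_le[of f, OF _ that]) (use less in \<open>simp add: less_imp_le\<close>)
    then show ?thesis by (simp add: le_fun_def)
  qed
  have "\<exists>k e. e \<in> leads (f i k) - leads (f (Suc i) k)" for i
  proof (rule ccontr)
    assume "\<not> ?thesis"
    then have "f (Suc i) k = f i k" for k
      using systemD[OF sys] anti[of i "Suc i"] by (intro subspace_eq_of_leads[where k = k]) auto
    then show False using less[of i] by (simp add: less_le fun_eq_iff)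
  qed
  then obtain \<kappa> e where e: "\<And>i. e i \<in> leads (f i (\<kappa> i))" "\<And>i. e i \<notin> leads (f (Suc i) (\<kappa> i))"
    by (metis DiffD1 DiffD2)
  have e_idx: "e i \<in> idx (\<kappa> i)" for i using e(1) leads_subset_idx systemD(2)[OF sys] by blast
  then obtain i j where ij: "i < j" "e i \<subseteq># e j"
    using dickson[of "{..<n + d}" e] idx_subset by blast
  obtain m where m: "e j = e i + m" "set_mset m \<subseteq> {..<n}" "\<kappa> j = \<kappa> i + size m"
    using idx_diff[OF e_idx e_idx ij(2)] by blast
  have "e i \<in> leads (f j (\<kappa> i))" using leads_system[OF sys m(2), of "e i"] e(1)[of j] m by auto
  then show False using e(2)[of i] leads_mono[OF anti[of "Suc i" j "\<kappa> i"]] ij(1) by auto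
qed


subsection \<open>A Nullstellensatz for systems\<close>

lemma system_nonzero: "system g \<Longrightarrow> g k \<noteq> {0} \<longleftrightarrow> (\<exists>F\<in>g k. F \<noteq> 0)"
  using system_zero[of g k] by blast

lemma system_nonzero_below:
  assumes "system g" "g (k + i) \<noteq> {0}"
  shows "g k \<noteq> {0}"
  using assms(2)
proof (induction i)
  case (Suc i)
  then obtain F where F: "F \<in> g (Suc (k + i))" "F \<noteq> 0"
    by (auto simp only: add_Suc_right system_nonzero[OF assms(1)])
  then obtain v where "D v F \<noteq> 0" using eq_zero_of_D[of F] systemD(2)[OF assms(1)] by blast
  moreover have "D v F \<in> g (k + i)" using systemD(3)[OF assms(1)] F(1) by blast
  ultimately show ?case using Suc.IH by blast
qed simp

lemma system_kernel:
  assumes "system g"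
  shows "system (\<lambda>k. {F \<in> g k. \<forall>w\<in>W. D w F = 0})"
  unfolding system_def
proof (intro allI conjI ballI)
  fix k
  show "cf.subspace {F \<in> g k. \<forall>w\<in>W. D w F = 0}"
    using systemD(1)[OF assms, of k] by (auto simp: cf.subspace_def D_add D_scale)
  show "{F \<in> g k. \<forall>w\<in>W. D w F = 0} \<subseteq> X k" using systemD(2)[OF assms] by blast
next
  fix k v F assume "F \<in> {F \<in> g (Suc k). \<forall>w\<in>W. D w F = 0}"
  then show "D v F \<in> {F \<in> g k. \<forall>w\<in>W. D w F = 0}"
    using systemD(3)[OF assms] by (simp add: D_comm[of _ v])
qed

text \<open>
  On a minimal system that is nonzero in all degrees every \<open>D v\<close> is zero or onto, so an
  eigenvalue argument shows that all \<open>D v\<close> are proportional there.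
\<close>

lemma nullstellensatz:
  assumes g0: "system g0" "\<And>k. g0 k \<noteq> {0}"
  shows "\<exists>\<mu>. (\<exists>b<n. \<mu> b \<noteq> 0) \<and>
    (\<forall>k. \<exists>F\<in>g0 k. F \<noteq> 0 \<and> (\<forall>v. (\<Sum>b<n. v b * \<mu> b) = 0 \<longrightarrow> D v F = 0)) \<and>
    (\<forall>w. (\<forall>k. \<forall>F\<in>g0 k. D w F = 0) \<longrightarrow> (\<Sum>b<n. w b * \<mu> b) = 0)"
proof -
  let ?G = "{g. system g \<and> g \<le> g0 \<and> (\<forall>k. g k \<noteq> {0})}"
  obtain g where gG: "g \<in> ?G" and gmin: "\<And>h. (h, g) \<in> {(h, g). system h \<and> system g \<and> h < g} \<Longrightarrow> h \<notin> ?G"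
    using wfE_min[OF wf_systems, of g0 ?G] g0 by blast
  have g: "system g" and g_le: "\<And>k. g k \<subseteq> g0 k" and g_nz: "\<And>k. g k \<noteq> {0}"
    using gG by (auto simp: le_fun_def)
  \<comment> \<open>Being nonzero in arbitrarily high degrees is enough to compete with
    \<open>g\<close>, because nonvanishing passes to lower degrees.\<close>
  have min: "h = g" if h: "system h" "\<And>k. h k \<subseteq> g k" "\<And>k. \<exists>j\<ge>k. h j \<noteq> {0}" for h
  proof (rule ccontr)
    assume "h \<noteq> g"
    then have "h < g" using h(2) by (simp add: less_le le_fun_def)
    moreover have "h k \<noteq> {0}" for k
      using h(3)[of k] system_nonzero_below[OF h(1), of k] by (metis le_Suc_ex)
    moreover have "h \<le> g0" using h(2) g_le by (auto simp: le_fun_def)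
    ultimately show False using gmin[of h] h(1) g by auto
  qed
  define K where "K v = (\<lambda>k. {F \<in> g k. D v F = 0})" for v
  have K_sys: "system (K v)" for v using system_kernel[OF g, of "{v}"] by (simp add: K_def)
  have K_zero: "D v F = 0" if "\<And>k. \<exists>j\<ge>k. K v j \<noteq> {0}" "F \<in> g k" for v F k
  proof -
    have "K v = g" by (rule min[OF K_sys _ that(1)]) (auto simp: K_def)
    then show ?thesis using that(2) by (auto simp: K_def fun_eq_iff)
  qed
  \<comment> \<open>The image of \<open>D v\<close> is a subsystem. If it is nonzero in every
    degree, it is all of \<open>g\<close>; otherwise the kernel of \<open>D v\<close> is everything
    from some degree on, hence in all degrees by minimality.\<close>
  have onto_or_zero: "(\<forall>k. D v ` g (Suc k) = g k) \<or> (\<forall>k. \<forall>F\<in>g k. D v F = 0)" for v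
  proof (cases "\<forall>k. \<exists>F\<in>g (Suc k). D v F \<noteq> 0")
    case True
    define h where "h k = D v ` g (Suc k)" for k
    have "cf.subspace (h k)" for k
      unfolding cf.subspace_def
    proof (intro conjI ballI allI)
      show "0 \<in> h k" using system_zero[OF g, of "Suc k"] by (auto simp: h_def intro!: image_eqI[of _ _ 0])
    next
      fix x y assume "x \<in> h k" "y \<in> h k"
      then obtain F G where FG: "F \<in> g (Suc k)" "G \<in> g (Suc k)" "x = D v F" "y = D v G"
        by (auto simp: h_def)
      then have "F + G \<in> g (Suc k)" using cf.subspace_add[OF systemD(1)[OF g]] by blast
      then show "x + y \<in> h k" unfolding h_def FG by (intro image_eqI[of _ _ "F + G"]) (simp_all add: D_add)
    next
      fix c x assume "x \<in> h k"
      then obtain F where F: "F \<in> g (Suc k)" "x = D v F" by (auto simp: h_def)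
      then have "pscale (*) c F \<in> g (Suc k)" using cf.subspace_scale[OF systemD(1)[OF g]] by blast
      then show "pscale (*) c x \<in> h k" unfolding h_def F
        by (intro image_eqI[of _ _ "pscale (*) c F"]) (simp_all add: D_scale)
    qed
    moreover have hg: "h k \<subseteq> g k" for k using systemD(3)[OF g] by (auto simp: h_def)
    moreover have "D u F \<in> h k" if F: "F \<in> h (Suc k)" for u F k
    proof -
      obtain G where G: "G \<in> g (Suc (Suc k))" "F = D v G" using F by (auto simp: h_def)
      have "D u F = D v (D u G)" by (simp add: G(2) D_comm)
      then show ?thesis using systemD(3)[OF g G(1)] by (simp add: h_def)
    qed
    ultimately have "system h" using systemD(2)[OF g] unfolding system_def by blast
    moreover have "\<exists>j\<ge>k. h j \<noteq> {0}" for k using True unfolding h_def by blast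
    ultimately have "h = g" using hg by (intro min) auto
    then show ?thesis by (auto simp: h_def fun_eq_iff)
  next
    case False
    then obtain k where k: "\<And>F. F \<in> g (Suc k) \<Longrightarrow> D v F = 0" by blast
    \<comment> \<open>Once \<open>D v\<close> vanishes in one degree it vanishes in the next, where
      all derivatives of \<open>D v F\<close> are zero.\<close>
    have Dz: "\<forall>F\<in>g (Suc (k + i)). D v F = 0" for i
    proof (induction i)
      case (Suc i)
      show ?case
      proof
        fix F assume F: "F \<in> g (Suc (k + Suc i))"
        then have "D u F \<in> g (Suc (k + i))" for u using systemD(3)[OF g, of F] by simp
        then have "D u (D v F) = 0" for u using Suc.IH by (subst D_comm) blast
        moreover have "D v F \<in> X (Suc (k + i))" using systemD(2,3)[OF g] F by fastforce
        ultimately show "D v F = 0" using eq_zero_of_D by blast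
      qed
    qed (use k in simp)
    have "K v (Suc (k + i)) \<noteq> {0}" for i
    proof -
      have "K v (Suc (k + i)) = g (Suc (k + i))" using Dz by (auto simp: K_def)
      then show ?thesis using g_nz by simp
    qed
    then have "\<exists>j\<ge>i. K v j \<noteq> {0}" for i
      using le_add2[of i "Suc k"] by (metis add_Suc)
    then show ?thesis using K_zero by blast
  qed
  have "\<exists>v. \<exists>F\<in>g 1. D v F \<noteq> 0"
  proof -
    obtain F where "F \<in> g 1" "F \<noteq> 0" using g_nz[of 1] system_nonzero[OF g] by blast
    then show ?thesis using eq_zero_of_D[of F 0] systemD(2)[OF g, of 1] by auto
  qed
  then obtain v where v_nz: "\<exists>F\<in>g 1. D v F \<noteq> 0" by blast
  then have onto: "D v ` g (Suc k) = g k" for k using onto_or_zero[of v] by blast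
  \<comment> \<open>A kernel that is nonzero in arbitrarily high degrees would be all of
    \<open>g\<close>. So \<open>D v\<close>, already onto, is bijective in all high degrees.\<close>
  have "\<exists>k. K v (Suc k) = {0}"
  proof (rule ccontr)
    assume "\<not> ?thesis"
    then have "\<exists>j\<ge>k. K v j \<noteq> {0}" for k using le_SucI by blast
    then show False using K_zero v_nz by blast
  qed
  then obtain k where k: "K v (Suc k) = {0}" by blast
  have inj: "F = 0" if "F \<in> g (Suc (k + i))" "D v F = 0" for F i
  proof -
    have "K v (Suc k + i) = {0}"
      using k system_nonzero_below[OF K_sys, of v "Suc k" i] by blast
    then show ?thesis using that by (auto simp: K_def)
  qed
  have ratio: "\<exists>c. \<forall>j. \<forall>F\<in>g j. D u F = pscale (*) c (D v F)" for u
  proof -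
    let ?Y = "g (Suc k)"
    \<comment> \<open>\<open>A\<close> is \<open>D u\<close> followed by the inverse of
      \<open>D v\<close>, an endomorphism of \<open>g (Suc k)\<close>; an eigenvector with
      eigenvalue \<open>c\<close> is killed by the derivative along \<open>u - c v\<close>.\<close>
    define A where "A F = (SOME G. G \<in> ?Y \<and> D v G = D u F)" for F
    have "\<exists>G. G \<in> ?Y \<and> D v G = D u F" if "F \<in> ?Y" for F
    proof -
      have "D u F \<in> D v ` ?Y" using onto[of k] systemD(3)[OF g that] by simp
      then show ?thesis by force
    qed
    then have A: "A F \<in> ?Y" "D v (A F) = D u F" if "F \<in> ?Y" for F
      unfolding A_def using someI_ex[of "\<lambda>G. G \<in> ?Y \<and> D v G = D u F"] that by blast+
    note sub = systemD(1)[OF g, of "Suc k"]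
    have A_eq: "A F = G" if "F \<in> ?Y" "G \<in> ?Y" "D v G = D u F" for F G
    proof -
      have "A F - G \<in> g (Suc (k + 0))" using A(1)[OF that(1)] that(2) cf.subspace_diff[OF sub] by simp
      moreover have "D v (A F - G) = 0" using A(2)[OF that(1)] that(3) by (simp add: D_diff)
      ultimately show ?thesis using inj[of "A F - G" 0] by simp
    qed
    have "\<exists>F\<in>?Y. F \<noteq> 0 \<and> (\<exists>c. A F = pscale (*) c F)"
    proof (rule eigenvector_exists[OF cf.vector_space_axioms])
      show "?Y \<subseteq> cf.span ((\<lambda>x y. if y = x then 1 else 0) ` idx (Suc k))"
        using X_subset_span systemD(2)[OF g] by blast
      show "finite ((\<lambda>x y. if y = x then (1::complex) else 0) ` idx (Suc k))"
        using finite_idx by simp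
      show "A (F + G) = A F + A G" if "F \<in> ?Y" "G \<in> ?Y" for F G
        using that A by (intro A_eq cf.subspace_add[OF sub]) (auto simp: D_add)
      show "A (pscale (*) c F) = pscale (*) c (A F)" if "F \<in> ?Y" for c F
        using that A by (intro A_eq cf.subspace_scale[OF sub]) (auto simp: D_scale)
    qed (use sub g_nz A in auto)
    then obtain F c where F: "F \<in> ?Y" "F \<noteq> 0" "A F = pscale (*) c F" by blast
    define w where "w = (\<lambda>b. u b - c * v b)"
    have Dw: "D w G = D u G - pscale (*) c (D v G)" for G unfolding w_def by (rule D_lin)
    \<comment> \<open>Bijectivity of \<open>D v\<close> lifts an element killed by
      \<open>D w\<close> to the next degree. The kernel of \<open>D w\<close> is thus nonzero in all
      high degrees, and minimality makes \<open>D w\<close> zero on \<open>g\<close>.\<close>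
    have "\<exists>G\<in>K w (Suc (k + i)). G \<noteq> 0" for i
    proof (induction i)
      case 0
      have "D w F = 0" using A(2)[OF F(1)] F(3) by (simp add: Dw D_scale)
      then show ?case using F(1,2) unfolding K_def add_0_right by blast
    next
      case (Suc i)
      then obtain G where G: "G \<in> g (Suc (k + i))" "D w G = 0" "G \<noteq> 0" unfolding K_def by blast
      then obtain H where H: "H \<in> g (Suc (Suc (k + i)))" "G = D v H"
        using onto[of "Suc (k + i)"] by blast
      have "D v (D w H) = 0" using G(2) unfolding H(2) by (subst D_comm)
      then have "D w H = 0" using inj[of "D w H" i] systemD(3)[OF g H(1)] by blast
      moreover have "H \<noteq> 0" using G(3) H(2) by auto
      ultimately show ?case using H(1) unfolding K_def add_Suc_right by blast
    qed
    then have "K w (Suc (k + i)) \<noteq> {0}" for i by blast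
    then have "\<exists>j\<ge>i. K w j \<noteq> {0}" for i
      using le_add2[of i "Suc k"] by (metis add_Suc)
    then have "D w G = 0" if "G \<in> g j" for G j using K_zero that by blast
    then show ?thesis by (intro exI[of _ c]) (simp add: Dw)
  qed
  \<comment> \<open>The entries are the ratios of the partial derivatives to the fixed
    \<open>D v\<close>, so that \<open>D u\<close> acts on \<open>g\<close> as \<open>D v\<close>
    times the pairing of \<open>u\<close> with \<open>\<mu>\<close>.\<close>
  define \<mu> where "\<mu> b = (SOME c. \<forall>j. \<forall>F\<in>g j. D (unit_vec b) F = pscale (*) c (D v F))" for b
  have \<mu>: "D (unit_vec b) F = pscale (*) (\<mu> b) (D v F)" if "F \<in> g j" for b F j
    unfolding \<mu>_def using someI_ex[OF ratio[of "unit_vec b"]] that by blast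
  have D\<mu>: "D u F = pscale (*) (\<Sum>b<n. u b * \<mu> b) (D v F)" if "F \<in> g j" for u F j
    by (subst D_expand) (simp add: \<mu>[OF that] pscale_def fun_eq_iff sum_distrib_right mult.assoc)
  obtain F1 where F1: "F1 \<in> g 1" "D v F1 \<noteq> 0" using v_nz by blast
  have "\<exists>b<n. \<mu> b \<noteq> 0"
  proof (rule ccontr)
    assume "\<not> ?thesis"
    then have "(\<Sum>b<n. v b * \<mu> b) = 0" by (intro sum.neutral) auto
    then show False using D\<mu>[OF F1(1), of v] F1(2) by (simp add: pscale_def fun_eq_iff)
  qed
  moreover have "\<exists>F\<in>g0 k. F \<noteq> 0 \<and> (\<forall>v. (\<Sum>b<n. v b * \<mu> b) = 0 \<longrightarrow> D v F = 0)" for k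
  proof -
    obtain F where F: "F \<in> g k" "F \<noteq> 0" using g_nz[of k] system_nonzero[OF g] by blast
    have "D u F = 0" if "(\<Sum>b<n. u b * \<mu> b) = 0" for u
      using D\<mu>[OF F(1), of u] that by (simp add: pscale_def fun_eq_iff)
    then show ?thesis using F g_le by blast
  qed
  moreover have "(\<Sum>b<n. w b * \<mu> b) = 0" if "\<forall>k. \<forall>F\<in>g0 k. D w F = 0" for w
  proof -
    have "D w F1 = 0" using that g_le F1(1) by blast
    then show ?thesis using D\<mu>[OF F1(1), of w] F1(2) by (auto simp: pscale_def fun_eq_iff)
  qed
  ultimately show ?thesis by blast
qed


subsection \<open>Annihilating operators\<close>

text \<open>Homogeneous polynomials of degree \<open>k\<close> in the derivatives, given by their
  action on all functions. The order is an index of the predicate, since the zero operator has every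
  order.\<close>

inductive diff_op :: "nat \<Rightarrow> ((nat multiset \<Rightarrow> complex) \<Rightarrow> nat multiset \<Rightarrow> complex) \<Rightarrow> bool" where
  diff_op_zero: "diff_op k (\<lambda>F. 0)"
| diff_op_id: "diff_op 0 (\<lambda>F. F)"
| diff_op_D: "diff_op k A \<Longrightarrow> diff_op (Suc k) (\<lambda>F. D v (A F))"
| diff_op_plus: "diff_op k A \<Longrightarrow> diff_op k B \<Longrightarrow> diff_op k (\<lambda>F. A F + B F)"
| diff_op_scale: "diff_op k A \<Longrightarrow> diff_op k (\<lambda>F. pscale (*) c (A F))"

text \<open>A polynomial in the derivatives commutes with whatever linear operator commutes with
  each of them; this covers derivatives, other such polynomials and shifts.\<close>

lemma diff_op_commute_linear:
  assumes "\<And>F G. B (F + G) = B F + B G" "\<And>c F. B (pscale (*) c F) = pscale (*) c (B F)"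
    "\<And>v F. B (D v F) = D v (B F)" and A: "diff_op k A"
  shows "A (B F) = B (A F)"
proof -
  have B0: "B 0 = 0" using assms(1)[of 0 0] by simp
  show ?thesis using A by (induction rule: diff_op.induct) (simp_all only: assms B0)
qed

lemma diff_op_add: "diff_op k A \<Longrightarrow> A (F + G) = A F + A G"
  by (induction rule: diff_op.induct) (simp_all only: D_add cf.scale_right_distrib add_0_left ac_simps)

lemma diff_op_lin: "diff_op k A \<Longrightarrow> A (pscale (*) c F) = pscale (*) c (A F)"
  by (induction rule: diff_op.induct)
    (simp_all only: D_scale cf.scale_right_distrib cf.scale_zero_right cf.scale_left_commute)

lemma diff_op_comm_D: "diff_op k A \<Longrightarrow> A (D v F) = D v (A F)"
  by (rule diff_op_commute_linear[OF D_add D_scale D_comm])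

lemma diff_op_comm: "diff_op k A \<Longrightarrow> diff_op l B \<Longrightarrow> A (B F) = B (A F)"
  by (rule diff_op_commute_linear[where B = B]) (auto intro: diff_op_add diff_op_lin diff_op_comm_D)

lemma diff_op_diff: "diff_op k A \<Longrightarrow> A (F - G) = A F - A G"
  using diff_op_add[of k A "F - G" G] by (simp add: algebra_simps)

lemma diff_op_0: "diff_op k A \<Longrightarrow> A 0 = 0"
  using diff_op_diff[of k A 0 0] by simp

lemma diff_op_sum: "diff_op k A \<Longrightarrow> A (\<Sum>i\<in>I. f i) = (\<Sum>i\<in>I. A (f i))"
  by (induction I rule: infinite_finite_induct) (simp_all only: diff_op_0 diff_op_add sum.infinite
      sum.empty sum.insert not_False_eq_True)

lemma diff_op_compose: "diff_op k A \<Longrightarrow> diff_op l B \<Longrightarrow> diff_op (k + l) (\<lambda>F. A (B F))"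
  by (induction rule: diff_op.induct) (auto intro: diff_op.intros)

lemma diff_op_pow: "diff_op k (D v ^^ k)"
proof (induction k)
  case 0
  then show ?case using diff_op_id by (simp add: id_def)
next
  case (Suc k)
  then show ?case using diff_op_D[of k "D v ^^ k" v] by (simp add: comp_def)
qed

lemma diff_op_minus: "diff_op k A \<Longrightarrow> diff_op k B \<Longrightarrow> diff_op k (\<lambda>F. A F - B F)"
  using diff_op_plus[OF _ diff_op_scale[where c = "- 1"], of k A B] by (simp add: cf.scale_minus_left)

lemma diff_op_sum_ops: "(\<And>i. i \<in> I \<Longrightarrow> diff_op k (A i)) \<Longrightarrow> diff_op k (\<lambda>F. \<Sum>i\<in>I. A i F)"
proof (induction I rule: infinite_finite_induct)
  case (insert i I)
  then have "diff_op k (\<lambda>F. A i F + (\<Sum>i\<in>I. A i F))" by (intro diff_op_plus) auto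
  then show ?case unfolding sum.insert[OF insert.hyps(1,2)] .
qed (simp_all only: diff_op_zero sum.infinite sum.empty not_False_eq_True)

lemma diff_op_system: "diff_op k A \<Longrightarrow> system g \<Longrightarrow> F \<in> g (j + k) \<Longrightarrow> A F \<in> g j"
proof (induction arbitrary: j rule: diff_op.induct)
  case (diff_op_D k A v)
  then show ?case using systemD(3)[of g] by (metis add_Suc add_Suc_right)
next
  case (diff_op_plus k A B)
  then show ?case using cf.subspace_add[OF systemD(1)] by blast
next
  case (diff_op_scale k A c)
  then show ?case using cf.subspace_scale[OF systemD(1)] by blast
qed (auto intro: system_zero)

text \<open>Operators of order \<open>Suc L\<close> in the ideal generated by the derivatives along \<open>ws\<close>.\<close>

definition ideal_op ::
  "(nat \<Rightarrow> complex) list \<Rightarrow> nat \<Rightarrow> ((nat multiset \<Rightarrow> complex) \<Rightarrow> nat multiset \<Rightarrow> complex) \<Rightarrow> bool" where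
  "ideal_op ws L A \<longleftrightarrow>
    (\<exists>Q. (\<forall>i. diff_op L (Q i)) \<and> (\<forall>F. A F = (\<Sum>i<length ws. D (ws ! i) (Q i F))))"

lemma ideal_op_add: "ideal_op ws L A \<Longrightarrow> ideal_op ws L B \<Longrightarrow> ideal_op ws L (\<lambda>F. A F + B F)"
proof -
  assume "ideal_op ws L A" "ideal_op ws L B"
  then obtain P Q where "\<And>i. diff_op L (P i)" "\<And>F. A F = (\<Sum>i<length ws. D (ws ! i) (P i F))"
    "\<And>i. diff_op L (Q i)" "\<And>F. B F = (\<Sum>i<length ws. D (ws ! i) (Q i F))"
    unfolding ideal_op_def by blast
  then show ?thesis unfolding ideal_op_def
    by (intro exI[of _ "\<lambda>i F. P i F + Q i F"]) (simp add: diff_op_plus D_add sum.distrib)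
qed

lemma ideal_op_diff: "ideal_op ws L A \<Longrightarrow> ideal_op ws L B \<Longrightarrow> ideal_op ws L (\<lambda>F. A F - B F)"
proof -
  assume "ideal_op ws L A" "ideal_op ws L B"
  then obtain P Q where "\<And>i. diff_op L (P i)" "\<And>F. A F = (\<Sum>i<length ws. D (ws ! i) (P i F))"
    "\<And>i. diff_op L (Q i)" "\<And>F. B F = (\<Sum>i<length ws. D (ws ! i) (Q i F))"
    unfolding ideal_op_def by blast
  then show ?thesis unfolding ideal_op_def
    by (intro exI[of _ "\<lambda>i F. P i F - Q i F"]) (simp add: diff_op_minus D_diff sum_subtractf)
qed

lemma ideal_op_zero: "ideal_op ws L (\<lambda>F. 0)"
  unfolding ideal_op_def by (intro exI[of _ "\<lambda>i F. 0"]) (simp add: diff_op_zero)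

lemma ideal_op_comp_right:
  "ideal_op ws L A \<Longrightarrow> diff_op l B \<Longrightarrow> ideal_op ws (L + l) (\<lambda>F. A (B F))"
proof -
  assume "ideal_op ws L A" and B: "diff_op l B"
  then obtain P where "\<And>i. diff_op L (P i)" "\<And>F. A F = (\<Sum>i<length ws. D (ws ! i) (P i F))"
    unfolding ideal_op_def by blast
  then show ?thesis unfolding ideal_op_def
    by (intro exI[of _ "\<lambda>i F. P i (B F)"]) (simp add: B diff_op_compose)
qed

lemma ideal_op_comp_left:
  "ideal_op ws L A \<Longrightarrow> diff_op l B \<Longrightarrow> ideal_op ws (L + l) (\<lambda>F. B (A F))"
proof -
  assume "ideal_op ws L A" and B: "diff_op l B"
  then obtain P where P: "\<And>i. diff_op L (P i)" "\<And>F. A F = (\<Sum>i<length ws. D (ws ! i) (P i F))"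
    unfolding ideal_op_def by blast
  then have "diff_op (L + l) (\<lambda>F. B (P i F))" for i
    using diff_op_compose[OF B P(1)] by (simp add: add.commute)
  then show ?thesis unfolding ideal_op_def P(2)
    by (intro exI[of _ "\<lambda>i F. B (P i F)"]) (simp add: diff_op_sum[OF B] diff_op_comm_D[OF B])
qed

text \<open>
  Gaussian elimination on a square system of relations whose matrix is a multiple of the identity
  modulo the ideal; it plays the part of the determinant trick.
\<close>

lemma elimination:
  assumes "finite J"
    and "\<And>i j. i \<in> J \<Longrightarrow> j \<in> J \<Longrightarrow> diff_op (Suc l) (R i j)"
    and "\<And>i. i \<in> J \<Longrightarrow> ideal_op ws l (\<lambda>F. R i i F - (D v ^^ Suc l) F)"
    and "\<And>i j. i \<in> J \<Longrightarrow> j \<in> J \<Longrightarrow> i \<noteq> j \<Longrightarrow> ideal_op ws l (R i j)"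
  shows "\<exists>L P. diff_op (Suc L) P \<and> ideal_op ws L (\<lambda>F. P F - (D v ^^ Suc L) F) \<and>
    (\<forall>q. (\<forall>i\<in>J. (\<Sum>j\<in>J. R i j (q j)) = 0) \<longrightarrow> (\<forall>j\<in>J. P (q j) = 0))"
  using assms
proof (induction J arbitrary: l R rule: finite_induct)
  case empty
  have "ideal_op ws l (\<lambda>F. (D v ^^ Suc l) F - (D v ^^ Suc l) F)"
    unfolding diff_self by (rule ideal_op_zero)
  then show ?case using diff_op_pow[of "Suc l" v] by blast
next
  case (insert a J)
  \<comment> \<open>Products of two entries have order \<open>2 * Suc l\<close>, which is
    \<open>Suc ?m\<close>; \<open>ideal_op\<close> records one less than the order.\<close>
  let ?m = "l + Suc l"
  note op = insert.prems(1) and diag = insert.prems(2) and off = insert.prems(3)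
  have Raa: "diff_op (Suc l) (R a a)" by (rule op) auto
  \<comment> \<open>Cross-multiplication with the pivot \<open>R a a\<close> clears column
    \<open>a\<close>. The subtracted product has a factor in the ideal, so the new diagonal is again
    a power of \<open>D v\<close> modulo the ideal.\<close>
  define R' where "R' i j = (\<lambda>F. R a a (R i j F) - R i a (R a j F))" for i j
  have R'_op: "diff_op (Suc ?m) (R' i j)" if "i \<in> J" "j \<in> J" for i j
  proof -
    have "diff_op (Suc l + Suc l) (R' i j)" unfolding R'_def
      by (rule diff_op_minus[OF diff_op_compose[OF Raa op] diff_op_compose[OF op op]]) (use that in auto)
    then show ?thesis by (simp only: add_Suc)
  qed
  have corr: "ideal_op ws ?m (\<lambda>F. R i a (R a j F))" if "i \<in> J" "j \<in> J" for i j
    by (rule ideal_op_comp_right[OF off op]) (use that insert.hyps in auto)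
  have R'_diag: "ideal_op ws ?m (\<lambda>F. R' i i F - (D v ^^ Suc ?m) F)" if i: "i \<in> J" for i
  proof -
    have 1: "ideal_op ws ?m (\<lambda>F. R a a (R i i F - (D v ^^ Suc l) F))"
      by (rule ideal_op_comp_left[OF diag Raa]) (use i in auto)
    have 2: "ideal_op ws ?m (\<lambda>F. R a a ((D v ^^ Suc l) F) - (D v ^^ Suc l) ((D v ^^ Suc l) F))"
      by (rule ideal_op_comp_right[OF diag diff_op_pow]) auto
    have "R a a (R i i F - (D v ^^ Suc l) F)
        + (R a a ((D v ^^ Suc l) F) - (D v ^^ Suc l) ((D v ^^ Suc l) F)) - R i a (R a i F)
        = R' i i F - (D v ^^ Suc ?m) F" for F
    proof -
      have "(D v ^^ Suc ?m) F = (D v ^^ Suc l) ((D v ^^ Suc l) F)"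
        by (metis add_Suc comp_apply funpow_add)
      then show ?thesis unfolding R'_def diff_op_diff[OF Raa] by (simp only: algebra_simps)
    qed
    then show ?thesis using ideal_op_diff[OF ideal_op_add[OF 1 2] corr[OF i i]] by (simp only:)
  qed
  have R'_off: "ideal_op ws ?m (R' i j)" if "i \<in> J" "j \<in> J" "i \<noteq> j" for i j
    unfolding R'_def
    by (rule ideal_op_diff[OF ideal_op_comp_left[OF off Raa] corr]) (use that in auto)
  obtain L P where P: "diff_op (Suc L) P"
    "ideal_op ws L (\<lambda>F. P F - (D v ^^ Suc L) F)"
    and PJ: "\<And>q j. (\<forall>i\<in>J. (\<Sum>j\<in>J. R' i j (q j)) = 0) \<Longrightarrow> j \<in> J \<Longrightarrow> P (q j) = 0"
    using insert.IH[of ?m R', OF R'_op R'_diag R'_off] by blast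
  \<comment> \<open>The pivot is kept as a factor: \<open>P\<close> kills \<open>q j\<close> for
    \<open>j\<close> in \<open>J\<close>, and row \<open>a\<close> expresses
    \<open>R a a (q a)\<close> through these, so the product kills \<open>q a\<close> as
    well.\<close>
  let ?P = "\<lambda>F. P (R a a F)" and ?L = "L + Suc l"
  have "diff_op (Suc ?L) ?P" using diff_op_compose[OF P(1) Raa] by (simp only: add_Suc)
  moreover have "ideal_op ws ?L (\<lambda>F. ?P F - (D v ^^ Suc ?L) F)"
  proof -
    have "ideal_op ws (l + Suc L) (\<lambda>F. P (R a a F - (D v ^^ Suc l) F))"
      by (rule ideal_op_comp_left[OF diag P(1)]) simp
    then have 1: "ideal_op ws ?L (\<lambda>F. P (R a a F - (D v ^^ Suc l) F))"
      by (simp only: add_Suc add_Suc_right add.commute[of l])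
    have 2: "ideal_op ws ?L (\<lambda>F. P ((D v ^^ Suc l) F) - (D v ^^ Suc L) ((D v ^^ Suc l) F))"
      by (rule ideal_op_comp_right[OF P(2) diff_op_pow])
    have "P (R a a F - (D v ^^ Suc l) F) + (P ((D v ^^ Suc l) F) - (D v ^^ Suc L) ((D v ^^ Suc l) F))
        = ?P F - (D v ^^ Suc ?L) F" for F
    proof -
      have "(D v ^^ Suc ?L) F = (D v ^^ Suc L) ((D v ^^ Suc l) F)"
        by (metis add_Suc comp_apply funpow_add)
      then show ?thesis unfolding diff_op_diff[OF P(1)] by (simp only: algebra_simps)
    qed
    then show ?thesis using ideal_op_add[OF 1 2] by (simp only:)
  qed
  moreover have "?P (q j) = 0"
    if q: "\<forall>i\<in>insert a J. (\<Sum>j\<in>insert a J. R i j (q j)) = 0" and j: "j \<in> insert a J" for q j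
  proof -
    have row: "R i a (q a) + (\<Sum>j\<in>J. R i j (q j)) = 0" if "i \<in> insert a J" for i
      using q that insert.hyps by auto
    have rowa: "(\<Sum>j\<in>J. R a j (q j)) = - R a a (q a)"
      using row[of a] by (simp add: eq_neg_iff_add_eq_0 add.commute)
    have "(\<Sum>j\<in>J. R' i j (q j)) = 0" if i: "i \<in> J" for i
    proof -
      have Ria: "diff_op (Suc l) (R i a)" using op[of i a] i by simp
      have rowi: "(\<Sum>j\<in>J. R i j (q j)) = - R i a (q a)"
        using row[of i] i by (simp add: eq_neg_iff_add_eq_0 add.commute)
      have neg: "A (- F) = - A F" if "diff_op k A" for k A F
        using diff_op_diff[OF that, of 0 F] diff_op_0[OF that] by simp
      have "(\<Sum>j\<in>J. R' i j (q j)) = R a a (\<Sum>j\<in>J. R i j (q j)) - R i a (\<Sum>j\<in>J. R a j (q j))"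
        by (simp add: R'_def sum_subtractf diff_op_sum[OF Raa] diff_op_sum[OF Ria])
      also have "\<dots> = - R a a (R i a (q a)) + R i a (R a a (q a))"
        by (simp add: rowi rowa neg[OF Raa] neg[OF Ria])
      also have "\<dots> = 0" by (simp add: diff_op_comm[OF Raa Ria])
      finally show ?thesis .
    qed
    then have PqJ: "P (q j) = 0" if "j \<in> J" for j using PJ that by blast
    show ?thesis
    proof (cases "j = a")
      case True
      have "P (R a a (q a)) = - P (\<Sum>j\<in>J. R a j (q j))"
        using diff_op_diff[OF P(1), of 0 "R a a (q a)"] diff_op_0[OF P(1)] by (simp add: rowa)
      also have "P (\<Sum>j\<in>J. R a j (q j)) = (\<Sum>j\<in>J. R a j (P (q j)))"
        unfolding diff_op_sum[OF P(1)]
        by (intro sum.cong refl diff_op_comm[OF P(1) op]) auto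
      also have "\<dots> = 0"
      proof (intro sum.neutral ballI)
        fix j assume "j \<in> J"
        then show "R a j (P (q j)) = 0" unfolding PqJ[OF \<open>j \<in> J\<close>] by (intro diff_op_0[OF op]) auto
      qed
      finally show ?thesis unfolding True minus_zero .
    next
      case False
      then have "P (q j) = 0" using PqJ j by blast
      then show ?thesis using diff_op_comm[OF P(1) Raa, of "q j"] diff_op_0[OF Raa] by (simp only:)
    qed
  qed
  ultimately show ?case by blast
qed

section \<open>The determinant trick for a system\<close>

text \<open>For a multiset of variables this is an iterated partial derivative; for a single marker
  it selects a component of the encoded map.\<close>

definition shift :: "nat multiset \<Rightarrow> (nat multiset \<Rightarrow> complex) \<Rightarrow> nat multiset \<Rightarrow> complex" where
  "shift m F = (\<lambda>x. F (m + x))"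

definition msets :: "nat \<Rightarrow> nat multiset set" where
  "msets k = {m. set_mset m \<subseteq> {..<n} \<and> size m = k}"

lemma shift_add: "shift m (F + G) = shift m F + shift m G"
  by (simp add: shift_def fun_eq_iff)

lemma shift_scale: "shift m (pscale (*) c F) = pscale (*) c (shift m F)"
  by (simp add: shift_def pscale_def)

lemma shift_D: "shift m (D v F) = D v (shift m F)"
  by (simp add: shift_def D_def)

lemma shift_shift: "shift m (shift m' F) = shift m' (shift m F)"
  by (simp add: shift_def union_lcomm)

lemma diff_op_shift: "diff_op k A \<Longrightarrow> A (shift m F) = shift m (A F)"
  by (rule diff_op_commute_linear[OF shift_add shift_scale shift_D])

lemma diff_op_of_shift: "m \<in> msets k \<Longrightarrow> diff_op k (shift m)"
proof (induction k arbitrary: m)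
  case 0
  then have "shift m = (\<lambda>F. F)" by (auto simp: msets_def shift_def)
  then show ?case using diff_op_id by simp
next
  case (Suc k)
  then obtain b m' where m: "m = add_mset b m'" by (cases m) (auto simp: msets_def)
  then have "b < n" "m' \<in> msets k" using Suc.prems by (auto simp: msets_def)
  moreover from this have "shift m = (\<lambda>F. D (unit_vec b) (shift m' F))"
    by (auto simp: D_unit shift_def m)
  ultimately show ?case using diff_op_D[OF Suc.IH] by simp
qed

lemma add_mset_msets: "n \<le> j \<Longrightarrow> j < n + d \<Longrightarrow> m \<in> msets k \<Longrightarrow> add_mset j m \<in> idx k"
  by (auto simp: idx_def msets_def)

lemma idx_eq: "idx k = (\<lambda>(j, m). add_mset j m) ` ({n..<n + d} \<times> msets k)"
proof
  show "idx k \<subseteq> (\<lambda>(j, m). add_mset j m) ` ({n..<n + d} \<times> msets k)"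
    by (force simp: idx_def msets_def)
qed (auto intro: add_mset_msets)

lemma inj_on_idx: "inj_on (\<lambda>(j, m). add_mset j m) ({n..<n + d} \<times> msets k)"
  by (auto simp: inj_on_def msets_def add_eq_conv_ex)

lemma finite_msets: "finite (msets k)"
proof (induction k)
  case (Suc k)
  have "msets (Suc k) \<subseteq> (\<lambda>(b, m). add_mset b m) ` ({..<n} \<times> msets k)"
  proof
    fix m assume m: "m \<in> msets (Suc k)"
    then obtain b m' where "m = add_mset b m'" by (cases m) (auto simp: msets_def)
    then show "m \<in> (\<lambda>(b, m). add_mset b m) ` ({..<n} \<times> msets k)"
      using m by (auto simp: msets_def)
  qed
  then show ?case using Suc by (meson finite_SigmaI finite_imageI finite_lessThan finite_subset)
qed (auto simp: msets_def intro: finite_subset[of _ "{{#}}"])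

lemma shift_marker_support:
  assumes "F \<in> X k" "n \<le> j" "x \<notin> msets k"
  shows "shift {#j#} F x = 0"
proof -
  have "add_mset j x \<notin> idx k"
  proof
    assume "add_mset j x \<in> idx k"
    then obtain i m where "add_mset j x = add_mset i m" "m \<in> msets k" "n \<le> i"
      by (auto simp: idx_eq)
    then show False using assms(2,3) by (auto simp: add_eq_conv_ex msets_def)
  qed
  then show ?thesis using assms(1) by (simp add: shift_def X_def)
qed

text \<open>An operator of order \<open>k\<close> lowers the degree by \<open>k\<close>. Writing
  \<open>K = l + k\<close> also covers \<open>K < k\<close>, where the last premise is vacuous and
  the result is zero everywhere.\<close>

lemma diff_op_support:
  "diff_op k A \<Longrightarrow> (\<And>x. x \<notin> msets K \<Longrightarrow> G x = 0) \<Longrightarrow> (\<And>l. K = l + k \<Longrightarrow> x \<notin> msets l) \<Longrightarrow> A G x = 0"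
proof (induction arbitrary: x rule: diff_op.induct)
  case (diff_op_D k A v)
  have "A G (add_mset b x) = 0" if b: "b < n" for b
  proof (rule diff_op_D.IH[OF diff_op_D.prems(1)])
    fix l assume l: "K = l + k"
    show "add_mset b x \<notin> msets l"
    proof (cases l)
      case (Suc l')
      then show ?thesis using diff_op_D.prems(2)[of l'] l by (auto simp: msets_def)
    qed (simp add: msets_def)
  qed
  then show ?case by (simp add: D_def)
qed (simp_all add: pscale_def)

text \<open>Dually, multiples of \<open>ws\<close> fill \<open>M\<close> in degree \<open>l\<close>
  and then in degree \<open>Suc l\<close>. So the power \<open>Suc l\<close> of \<open>v\<close>
  maps each generator of \<open>M\<close> to a combination of generators with coefficients in the
  ideal of \<open>ws\<close>, and the determinant trick yields an operator that kills the system and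
  equals a power of \<open>D v\<close> modulo that ideal.\<close>

lemma annihilating_operator:
  assumes g: "system g" and ker: "\<And>F. F \<in> g l \<Longrightarrow> (\<And>w. w \<in> set ws \<Longrightarrow> D w F = 0) \<Longrightarrow> F = 0"
  shows "\<exists>L Q. (\<forall>i. diff_op L (Q i)) \<and>
    (\<forall>j. \<forall>F\<in>g (j + Suc L). (D v ^^ Suc L) F = (\<Sum>i<length ws. D (ws ! i) (Q i F)))"
proof -
  have ker': "F = 0" if F: "F \<in> g (Suc l)" "\<And>w. w \<in> set ws \<Longrightarrow> D w F = 0" for F
  proof -
    have "D u F = 0" for u
    proof (rule ker)
      show "D u F \<in> g l" using systemD(3)[OF g] F(1) by blast
      show "D w (D u F) = 0" if "w \<in> set ws" for w
        using F(2)[OF that] by (subst D_comm) simp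
    qed
    then show ?thesis using eq_zero_of_D[of F l] F(1) systemD(2)[OF g] by blast
  qed
  let ?J = "{n..<n + d}" and ?I = "{..<length ws} \<times> idx l"
  \<comment> \<open>As a functional on \<open>g (Suc l)\<close>, \<open>f j\<close> is the generator
    with marker \<open>j\<close> multiplied by the power of \<open>v\<close>; the index
    \<open>{#j#}\<close> belongs to degree 0.\<close>
  define f where "f j F = (D v ^^ Suc l) F {#j#}" for j F
  have "\<exists>c. \<forall>F\<in>g (Suc l). f j F = (\<Sum>p\<in>?I. c p * D (ws ! fst p) F (snd p))" for j
  proof (rule functional_in_span[where s = "pscale (*)"])
    show "finite ?I" by (simp add: finite_idx)
    show "f j (F + G) = f j F + f j G" for F G
      using diff_op_add[OF diff_op_pow, of "Suc l" v F G] by (simp only: f_def plus_fun_apply)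
    show "f j (pscale (*) c F) = c * f j F" for c F
      using diff_op_lin[OF diff_op_pow, of "Suc l" v c F] by (simp only: f_def) (simp only: pscale_def)
    show "f j F = 0" if F: "F \<in> g (Suc l)" "\<And>p. p \<in> ?I \<Longrightarrow> D (ws ! fst p) F (snd p) = 0" for F
    proof -
      have DX: "D u F \<in> X l" for u using systemD(2,3)[OF g] F(1) by blast
      have "D (ws ! i) F x = 0" if "i < length ws" for i x
      proof (cases "x \<in> idx l")
        case True
        then show ?thesis using F(2)[of "(i, x)"] that by simp
      next
        case False
        then show ?thesis using DX[of "ws ! i"] by (simp add: X_def)
      qed
      note Di = this
      have Dws: "D w F = 0" if "w \<in> set ws" for w
      proof
        fix x show "D w F x = 0 x"
          using that Di by (auto simp: in_set_conv_nth)
      qed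
      have "F = 0" using Dws by (rule ker'[OF F(1)])
      then show ?thesis
        using diff_op_0[OF diff_op_pow[of "Suc l" v]] by (simp only: f_def zero_fun_apply)
    qed
    show "D (ws ! fst p) (pscale (*) c F) (snd p) = c * D (ws ! fst p) F (snd p)" for p c F
      unfolding D_scale by (simp only: pscale_def)
    show "pscale (*) c F \<in> g (Suc l)" if "F \<in> g (Suc l)" for c F
      using cf.subspace_scale[OF systemD(1)[OF g] that] .
    show "F + G \<in> g (Suc l)" if "F \<in> g (Suc l)" "G \<in> g (Suc l)" for F G
      using cf.subspace_add[OF systemD(1)[OF g] that] .
  qed (simp_all only: D_add plus_fun_apply system_zero[OF g])
  then obtain c where "\<forall>j. \<forall>F\<in>g (Suc l). f j F = (\<Sum>p\<in>?I. c j p * D (ws ! fst p) F (snd p))"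
    using choice[of "\<lambda>j c. \<forall>F\<in>g (Suc l). f j F = (\<Sum>p\<in>?I. c p * D (ws ! fst p) F (snd p))"] by blast
  then have c: "f j F = (\<Sum>p\<in>?I. c j p * D (ws ! fst p) F (snd p))" if "F \<in> g (Suc l)" for j F
    using that by blast
  \<comment> \<open>The coefficients \<open>c\<close> are read as polynomials in the partial
    derivatives, sorted by component \<open>j'\<close> and by vector \<open>ws ! i\<close>.
    \<open>C\<close> is the resulting matrix over the ideal, and \<open>R\<close> is the power of
    \<open>D v\<close> on the diagonal minus \<open>C\<close>.\<close>
  define B where "B j j' i F = (\<Sum>m\<in>msets l. pscale (*) (c j (i, add_mset j' m)) (shift m F))" for j j' i F
  define C where "C j j' F = (\<Sum>i<length ws. D (ws ! i) (B j j' i F))" for j j' F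
  define R where "R j j' = (if j = j' then (\<lambda>F. (D v ^^ Suc l) F - C j j' F) else (\<lambda>F. 0 - C j j' F))"
    for j j'
  have B_op: "diff_op l (B j j' i)" for j j' i
    unfolding B_def[abs_def] by (intro diff_op_sum_ops diff_op_scale diff_op_of_shift)
  have C_ideal: "ideal_op ws l (C j j')" for j j'
    unfolding ideal_op_def C_def using B_op by blast
  have C_op: "diff_op (Suc l) (C j j')" for j j'
    unfolding C_def[abs_def] by (intro diff_op_sum_ops diff_op_D B_op)
  have R_op: "diff_op (Suc l) (R j j')" for j j'
    using diff_op_minus[OF diff_op_pow C_op, of v j j'] diff_op_minus[OF diff_op_zero C_op, of j j']
    unfolding R_def by (cases "j = j'") (simp_all only: if_True if_False simp_thms)
  have R_off: "ideal_op ws l (R j j')" if "j \<noteq> j'" for j j'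
    using ideal_op_diff[OF ideal_op_zero C_ideal[of j j']] that unfolding R_def by (simp only: if_False)
  have R_diag: "ideal_op ws l (\<lambda>F. R j j F - (D v ^^ Suc l) F)" for j
  proof -
    have "(\<lambda>F. R j j F - (D v ^^ Suc l) F) = (\<lambda>F. 0 - C j j F)"
      by (simp add: R_def fun_eq_iff del: funpow.simps)
    then show ?thesis using ideal_op_diff[OF ideal_op_zero C_ideal[of j j]] by (simp only:)
  qed
  have "\<exists>L P. diff_op (Suc L) P \<and> ideal_op ws L (\<lambda>F. P F - (D v ^^ Suc L) F) \<and>
      (\<forall>q. (\<forall>i\<in>?J. (\<Sum>j\<in>?J. R i j (q j)) = 0) \<longrightarrow> (\<forall>j\<in>?J. P (q j) = 0))"
    by (rule elimination[OF finite_atLeastLessThan R_op R_diag]) (rule R_off)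
  then obtain L P where P: "diff_op (Suc L) P"
    "ideal_op ws L (\<lambda>F. P F - (D v ^^ Suc L) F)"
    and PJ: "\<And>q j. (\<forall>i\<in>?J. (\<Sum>j\<in>?J. R i j (q j)) = 0) \<Longrightarrow> j \<in> ?J \<Longrightarrow> P (q j) = 0"
    by blast
  \<comment> \<open>At the empty multiset the relation is the defining property of
    \<open>c\<close>.\<close>
  have rel0: "(\<Sum>j'\<in>?J. R j j' (shift {#j'#} F)) {#} = 0" if F: "F \<in> g (Suc l)" and j: "j \<in> ?J" for F j
  proof -
    have "(\<Sum>j'\<in>?J. R j j' (shift {#j'#} F)) {#}
      = (\<Sum>j'\<in>?J. if j' = j then (D v ^^ Suc l) (shift {#j'#} F) {#} else 0)
        - (\<Sum>j'\<in>?J. C j j' (shift {#j'#} F) {#})"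
      unfolding sum_apply sum_subtractf[symmetric] by (intro sum.cong) (auto simp: R_def simp del: funpow.simps)
    also have "(\<Sum>j'\<in>?J. if j' = j then (D v ^^ Suc l) (shift {#j'#} F) {#} else 0) = f j F"
    proof -
      have "(D v ^^ Suc l) (shift {#i#} F) {#} = f i F" for i
        unfolding diff_op_shift[OF diff_op_pow] by (simp add: f_def shift_def del: funpow.simps)
      then show ?thesis using j by (simp del: funpow.simps)
    qed
    also have "(\<Sum>j'\<in>?J. C j j' (shift {#j'#} F) {#})
      = (\<Sum>j'\<in>?J. \<Sum>i<length ws. \<Sum>m\<in>msets l. c j (i, add_mset j' m) * D (ws ! i) F (add_mset j' m))"
    proof (intro sum.cong refl)
      fix j'
      have "D (ws ! i) (B j j' i (shift {#j'#} F)) {#}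
        = (\<Sum>m\<in>msets l. c j (i, add_mset j' m) * D (ws ! i) F (add_mset j' m))" for i
      proof -
        have "D (ws ! i) (B j j' i (shift {#j'#} F)) = B j j' i (shift {#j'#} (D (ws ! i) F))"
          by (simp add: diff_op_comm_D[OF B_op, symmetric] shift_D)
        then show ?thesis by (simp add: B_def sum_apply pscale_def shift_def)
      qed
      then show "C j j' (shift {#j'#} F) {#}
        = (\<Sum>i<length ws. \<Sum>m\<in>msets l. c j (i, add_mset j' m) * D (ws ! i) F (add_mset j' m))"
        by (simp add: C_def sum_apply)
    qed
    also have "\<dots> = (\<Sum>i<length ws. \<Sum>j'\<in>?J. \<Sum>m\<in>msets l. c j (i, add_mset j' m) * D (ws ! i) F (add_mset j' m))"
      by (rule sum.swap)
    also have "\<dots> = (\<Sum>i<length ws. \<Sum>x\<in>idx l. c j (i, x) * D (ws ! i) F x)"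
      unfolding idx_eq by (subst sum.reindex[OF inj_on_idx]) (simp add: sum.cartesian_product case_prod_unfold)
    also have "\<dots> = f j F"
      using c[OF F, of j] by (simp add: sum.cartesian_product case_prod_unfold)
    finally show ?thesis by simp
  qed
  \<comment> \<open>The value at \<open>x\<close> is the value at the empty multiset for
    \<open>shift x F\<close>, provided this has degree \<open>Suc l\<close>; at all other
    \<open>x\<close> the sum vanishes for reasons of degree.\<close>
  have rel: "(\<Sum>j'\<in>?J. R j j' (shift {#j'#} F)) = 0" if F: "F \<in> g K" and j: "j \<in> ?J" for F j K
  proof
    fix x
    show "(\<Sum>j'\<in>?J. R j j' (shift {#j'#} F)) x = 0 x"
    proof (cases "\<exists>k'. K = k' + Suc l \<and> x \<in> msets k'")
      case True
      then obtain k' where k': "K = k' + Suc l" "x \<in> msets k'" by blast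
      have "shift x F \<in> g (Suc l)"
        using diff_op_system[OF diff_op_of_shift[OF k'(2)] g, of F "Suc l"] F k'(1) by (simp add: add.commute)
      from rel0[OF this j] have "(\<Sum>j'\<in>?J. R j j' (shift {#j'#} (shift x F)) {#}) = 0"
        by (simp add: sum_apply)
      moreover have "R j j' (shift {#j'#} (shift x F)) {#} = R j j' (shift {#j'#} F) x" for j'
        by (subst shift_shift, subst diff_op_shift[OF R_op], simp add: shift_def)
      ultimately show ?thesis by (simp add: sum_apply)
    next
      case False
      have "R j j' (shift {#j'#} F) x = 0" if "j' \<in> ?J" for j'
        by (rule diff_op_support[OF R_op shift_marker_support[of F K j']])
          (use F systemD(2)[OF g] that False in auto)
      then show ?thesis by (simp add: sum_apply)
    qed
  qed
  \<comment> \<open>\<open>P\<close> kills every component of \<open>F\<close> by elimination, and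
    it commutes with taking components.\<close>
  have P0: "P F = 0" if F: "F \<in> g (j + Suc L)" for F j
  proof
    fix x
    have PF: "P F \<in> X j" using diff_op_system[OF P(1) g F] systemD(2)[OF g] by blast
    show "P F x = 0 x"
    proof (cases "x \<in> idx j")
      case True
      then obtain i m where x: "x = add_mset i m" "i \<in> ?J" by (auto simp: idx_eq)
      have "P (shift {#i#} F) = 0"
        by (rule PJ[of "\<lambda>j'. shift {#j'#} F"]) (use rel[OF F] x in auto)
      then have "shift {#i#} (P F) m = 0 m" by (simp only: diff_op_shift[OF P(1)])
      then show ?thesis using x by (simp add: shift_def)
    next
      case False
      then show ?thesis using PF by (simp add: X_def)
    qed
  qed
  obtain Q where Q: "\<And>i. diff_op L (Q i)" "\<And>F. P F - (D v ^^ Suc L) F = (\<Sum>i<length ws. D (ws ! i) (Q i F))"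
    using P(2) unfolding ideal_op_def by blast
  have "(D v ^^ Suc L) F = (\<Sum>i<length ws. D (ws ! i) (0 - Q i F))" if "F \<in> g (j + Suc L)" for F j
  proof -
    have "(\<Sum>i<length ws. D (ws ! i) (0 - Q i F)) = - (\<Sum>i<length ws. D (ws ! i) (Q i F))"
      unfolding D_diff D_zero by (simp only: diff_0 sum_negf)
    also have "\<dots> = - (0 - (D v ^^ Suc L) F)" by (simp only: Q(2)[symmetric] P0[OF that])
    also have "\<dots> = (D v ^^ Suc L) F" by (simp only: diff_0 minus_minus)
    finally show ?thesis by (rule sym)
  qed
  moreover have "diff_op L (\<lambda>F. 0 - Q i F)" for i by (rule diff_op_minus[OF diff_op_zero Q(1)])
  ultimately show ?thesis by (intro exI[of _ L] exI[of _ "\<lambda>i F. 0 - Q i F"]) blast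
qed


subsection \<open>Propagation of characteristics\<close>

lemma koszul_system: "system g \<Longrightarrow> koszul D g"
  by (unfold_locales, rule D_add, rule D_comm)
    (blast intro: system_zero cf.subspace_diff dest: systemD)+

text \<open>The relation of exponent 1 that places \<open>D v\<close> in the ideal generated by the
  partial derivatives.\<close>

lemma D_expand_sum: "D v F = (\<Sum>b<n. D (unit_vec b) (pscale (*) (v b) F))"
  by (subst D_expand) (simp only: fun_eq_iff sum_apply D_scale, simp only: pscale_def simp_thms)

text \<open>The flag in \<open>reg\<close> may vary with \<open>k\<close>, and \<open>l\<close> may
  lie on either side of \<open>r\<close>; together with the relations modulo \<open>ws\<close>, this
  lets every vector outside \<open>ws\<close> be deleted from an exact Koszul complex.\<close>

lemma propagation:
  assumes g: "system g"
    and reg: "\<And>k. r \<le> k \<Longrightarrow> \<exists>fl. (\<forall>F\<in>g k. (\<forall>u\<in>set fl. D u F = 0) \<longrightarrow> F = 0) \<and>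
      (\<forall>i<length fl. \<forall>F\<in>g k. (\<forall>u\<in>set (take i fl). D u F = 0) \<longrightarrow>
        (\<exists>G\<in>g (Suc k). (\<forall>u\<in>set (take i fl). D u G = 0) \<and> D (fl ! i) G = F))"
    and ker: "\<And>F. F \<in> g l \<Longrightarrow> (\<And>w. w \<in> set ws \<Longrightarrow> D w F = 0) \<Longrightarrow> F = 0"
    and F: "F \<in> g r" "\<And>w. w \<in> set ws \<Longrightarrow> D w F = 0"
  shows "F = 0"
proof -
  interpret K: koszul D g by (rule koszul_system[OF g])
  define es where "es = map unit_vec [0..<n]"
  \<comment> \<open>Any \<open>v\<close> is a combination of the unit vectors, which stay in the
    list, so its removal has exponent 1 and uses exactness in degree \<open>k\<close> alone.\<close>
  have drop_any: "K.acyclic (es @ ws) k" if "K.acyclic (us @ es @ ws) k" for us k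
    using that
  proof (induction us)
    case (Cons v us)
    have "K.acyclic (us @ es @ ws) k"
    proof (rule K.acyclic_remove[where L = 1 and Q = "\<lambda>b. pscale (*) (v b)" and I = "{..<n}" and u = unit_vec])
      show "K.acyclic (v # us @ es @ ws) j" if "k \<le> j" "j < k + 1" for j
        using Cons.prems that by (simp add: le_less_Suc_eq)
      show "pscale (*) (v b) (D u F) = D u (pscale (*) (v b) F)" for b u F by (rule D_scale[symmetric])
      show "pscale (*) (v b) F \<in> g (Suc k)" if "F \<in> g (k + 1)" for b F
        using that cf.subspace_scale[OF systemD(1)[OF g]] by simp
      show "unit_vec b \<in> set (us @ es @ ws)" if "b \<in> {..<n}" for b
        using that by (simp add: es_def)
      show "(D v ^^ 1) F = (\<Sum>b<n. D (unit_vec b) (pscale (*) (v b) F))" for F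
        unfolding D_expand_sum[symmetric] by (simp only: One_nat_def funpow.simps comp_id)
    qed (simp_all only: cf.scale_right_diff_distrib finite_lessThan)
    then show ?case by (rule Cons.IH)
  qed simp
  have "\<forall>k\<ge>r. K.acyclic (es @ ws) k"
  proof (intro allI impI)
    fix k assume k: "r \<le> k"
    from reg[OF k] obtain fl where fl: "\<forall>F\<in>g k. (\<forall>u\<in>set fl. D u F = 0) \<longrightarrow> F = 0"
      "\<forall>i<length fl. \<forall>F\<in>g k. (\<forall>u\<in>set (take i fl). D u F = 0) \<longrightarrow>
        (\<exists>G\<in>g (Suc k). (\<forall>u\<in>set (take i fl). D u G = 0) \<and> D (fl ! i) G = F)"
      by (elim exE conjE) (rule that)
    have "K.acyclic (rev fl) k"
    proof (rule K.acyclic_of_quasi_regular)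
      fix i F assume iF: "i < length fl" "F \<in> g k" "\<And>u. u \<in> set (take i fl) \<Longrightarrow> D u F = 0"
      show "\<exists>G\<in>g (Suc k). (\<forall>u\<in>set (take i fl). D u G = 0) \<and> D (fl ! i) G = F"
        by (rule fl(2)[rule_format, OF iF(1,2)]) (rule iF(3))
    next
      fix F assume F: "F \<in> g k" "\<And>u. u \<in> set fl \<Longrightarrow> D u F = 0"
      show "F = 0" by (rule fl(1)[rule_format, OF F(1)]) (rule F(2))
    qed
    then have "K.acyclic (rev fl @ es @ ws) k" by (rule K.acyclic_append)
    then show "K.acyclic (es @ ws) k" by (rule drop_any)
  qed
  \<comment> \<open>The relation for a basis vector involves only \<open>ws\<close>, so it remains
    usable when other basis vectors are gone. Its exponent \<open>Suc L\<close> depends on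
    \<open>v\<close>, which is why all degrees from \<open>r\<close> on are treated
    together.\<close>
  then have "\<forall>k\<ge>r. K.acyclic ws k"
  proof (induction es)
    case (Cons v es)
    have "K.acyclic (es @ ws) k" if k: "r \<le> k" for k
    proof -
      have "\<exists>L Q. (\<forall>i. diff_op L (Q i)) \<and>
          (\<forall>j. \<forall>F\<in>g (j + Suc L). (D v ^^ Suc L) F = (\<Sum>i<length ws. D (ws ! i) (Q i F)))"
        by (rule annihilating_operator[OF g ker])
      then obtain L Q where Q: "\<And>i. diff_op L (Q i)"
        and fac: "\<And>j F. F \<in> g (j + Suc L) \<Longrightarrow> (D v ^^ Suc L) F = (\<Sum>i<length ws. D (ws ! i) (Q i F))"
        by blast
      show ?thesis
      proof (rule K.acyclic_remove[where L = "Suc L" and v = v and Q = Q and I = "{..<length ws}" and u = "(!) ws"])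
        show "K.acyclic (v # es @ ws) j" if "k \<le> j" "j < k + Suc L" for j
          using Cons.prems k that by simp
        show "Q i F \<in> g (Suc k)" if "F \<in> g (k + Suc L)" for i F
          by (rule diff_op_system[OF Q g]) (use that in simp)
        show "ws ! i \<in> set (es @ ws)" if "i \<in> {..<length ws}" for i using that by simp
      qed (simp_all only: finite_lessThan diff_op_diff[OF Q] diff_op_comm_D[OF Q] fac)
    qed
    then show ?case using Cons.IH by blast
  qed simp
  then show ?thesis using K.acyclic_kernel[of ws r F] F by blast
qed

lemma characteristic_vector_exists:
  assumes g: "system g"
    and reg: "\<And>k. r \<le> k \<Longrightarrow> \<exists>fl. (\<forall>F\<in>g k. (\<forall>u\<in>set fl. D u F = 0) \<longrightarrow> F = 0) \<and>
      (\<forall>i<length fl. \<forall>F\<in>g k. (\<forall>u\<in>set (take i fl). D u F = 0) \<longrightarrow>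
        (\<exists>G\<in>g (Suc k). (\<forall>u\<in>set (take i fl). D u G = 0) \<and> D (fl ! i) G = F))"
    and F: "F \<in> g r" "F \<noteq> 0" "\<And>w. w \<in> set ws \<Longrightarrow> D w F = 0"
  shows "\<exists>\<mu>. (\<exists>b<n. \<mu> b \<noteq> 0) \<and>
    (\<forall>k. \<exists>F\<in>g k. F \<noteq> 0 \<and> (\<forall>v. (\<Sum>b<n. v b * \<mu> b) = 0 \<longrightarrow> D v F = 0)) \<and>
    (\<forall>w\<in>set ws. (\<Sum>b<n. w b * \<mu> b) = 0)"
proof -
  let ?g = "\<lambda>k. {F \<in> g k. \<forall>w\<in>set ws. D w F = 0}"
  have "?g k \<noteq> {0}" for k
  proof
    assume k: "?g k = {0}"
    have "F = 0" by (rule propagation[OF g reg _ F(1,3), of k]) (use k in blast)+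
    then show False using F(2) by blast
  qed
  from nullstellensatz[OF system_kernel[OF g, of "set ws"] this] show ?thesis by blast
qed


subsection \<open>Coordinates and polynomial maps\<close>

text \<open>Divided powers: differentiation lowers one exponent without a numerical factor, which is
  what makes derivatives plain shifts of the coefficients.\<close>

definition dpow :: "nat multiset \<Rightarrow> (nat \<Rightarrow> complex) \<Rightarrow> complex" where
  "dpow m c = (\<Prod>b<n. c b ^ count m b / fact (count m b))"

definition taylor :: "nat \<Rightarrow> (nat multiset \<Rightarrow> complex) \<Rightarrow> (nat \<Rightarrow> complex) \<Rightarrow> complex" where
  "taylor k G c = (\<Sum>m\<in>msets k. G m * dpow m c)"

lemma dpow_remove:
  "b < n \<Longrightarrow> dpow m c = c b ^ count m b / fact (count m b) *
    (\<Prod>i\<in>{..<n} - {b}. c i ^ count m i / fact (count m i))"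
  unfolding dpow_def by (rule prod.remove) auto

lemma dpow_add_mset:
  assumes "b < n"
  shows "of_nat (Suc (count m b)) * dpow (add_mset b m) c = c b * dpow m c"
proof -
  let ?R = "\<Prod>i\<in>{..<n} - {b}. c i ^ count m i / fact (count m i)"
  have "dpow (add_mset b m) c = c b ^ Suc (count m b) / fact (Suc (count m b)) * ?R"
    unfolding dpow_remove[OF assms, of "add_mset b m"] by simp
  then show ?thesis
    unfolding dpow_remove[OF assms, of m] by (simp add: field_simps del: of_nat_Suc)
qed

lemma dpow_deriv:
  "((\<lambda>t. dpow m (\<lambda>b. c b + t * v b)) has_field_derivative
    (\<Sum>b<n. v b * (if b \<in># m then dpow (m - {#b#}) c else 0))) (at 0)"
proof -
  define f' where "f' b = (if b \<in># m then v b * (c b ^ (count m b - 1) / fact (count m b - 1)) else 0)" for b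
  have f': "((\<lambda>t. (c b + t * v b) ^ count m b / fact (count m b)) has_field_derivative f' b) (at 0)" for b
  proof (cases "count m b")
    case 0
    then have "b \<notin># m" by (simp add: not_in_iff)
    then show ?thesis by (simp add: f'_def 0)
  next
    case (Suc k)
    have 1: "((\<lambda>t. c b + t * v b) has_field_derivative v b) (at 0)"
      by (auto intro!: derivative_eq_intros)
    have "((\<lambda>t. (c b + t * v b) ^ Suc k / fact (Suc k)) has_field_derivative
        of_nat (Suc k) * (v b * (c b + 0 * v b) ^ (Suc k - Suc 0)) / fact (Suc k)) (at 0)"
      by (rule DERIV_cdivide[OF DERIV_power[OF 1]])
    moreover have "of_nat (Suc k) * (v b * (c b + 0 * v b) ^ (Suc k - Suc 0)) / fact (Suc k) = f' b"
    proof -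
      have "b \<in># m" using Suc by (metis count_greater_zero_iff zero_less_Suc)
      then show ?thesis using Suc by (simp add: f'_def del: of_nat_Suc)
    qed
    ultimately show ?thesis using Suc by simp
  qed
  have "((\<lambda>t. \<Prod>b<n. (c b + t * v b) ^ count m b / fact (count m b)) has_field_derivative
      (\<Sum>b<n. f' b * (\<Prod>i\<in>{..<n} - {b}. (c i + 0 * v i) ^ count m i / fact (count m i)))) (at 0)"
    by (rule has_field_derivative_prod) (rule f')
  moreover have "(\<Sum>b<n. f' b * (\<Prod>i\<in>{..<n} - {b}. (c i + 0 * v i) ^ count m i / fact (count m i))) =
      (\<Sum>b<n. v b * (if b \<in># m then dpow (m - {#b#}) c else 0))"
  proof (rule sum.cong[OF refl])
    fix b assume b: "b \<in> {..<n}"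
    have "(\<Prod>i\<in>{..<n} - {b}. (c i + 0 * v i) ^ count m i / fact (count m i)) =
        (\<Prod>i\<in>{..<n} - {b}. c i ^ count (m - {#b#}) i / fact (count (m - {#b#}) i))"
      by (intro prod.cong) auto
    then show "f' b * (\<Prod>i\<in>{..<n} - {b}. (c i + 0 * v i) ^ count m i / fact (count m i)) =
        v b * (if b \<in># m then dpow (m - {#b#}) c else 0)"
      using b dpow_remove[of b "m - {#b#}" c] by (auto simp: f'_def)
  qed
  ultimately show ?thesis by (simp add: dpow_def)
qed

lemma sum_msets_Suc:
  assumes b: "b < n" and h: "\<And>m. m \<in> msets (Suc k) \<Longrightarrow> b \<notin># m \<Longrightarrow> h m = 0"
  shows "(\<Sum>m\<in>msets (Suc k). h m) = (\<Sum>m\<in>msets k. h (add_mset b m))"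
proof -
  have "(\<Sum>m\<in>msets (Suc k). h m) = (\<Sum>m\<in>{m \<in> msets (Suc k). b \<in># m}. h m)"
    using finite_msets h by (intro sum.mono_neutral_right) auto
  also have "\<dots> = (\<Sum>m\<in>msets k. h (add_mset b m))"
    by (rule sum.reindex_bij_witness[where i = "add_mset b" and j = "\<lambda>m. m - {#b#}"])
      (use b in \<open>auto simp: msets_def size_Diff_singleton dest: in_diffD\<close>)
  finally show ?thesis .
qed

lemma taylor_deriv:
  "((\<lambda>t. taylor (Suc k) G (\<lambda>b. c b + t * v b)) has_field_derivative taylor k (D v G) c) (at 0)"
proof -
  have "((\<lambda>t. taylor (Suc k) G (\<lambda>b. c b + t * v b)) has_field_derivative
      (\<Sum>m\<in>msets (Suc k). G m * (\<Sum>b<n. v b * (if b \<in># m then dpow (m - {#b#}) c else 0)))) (at 0)"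
    unfolding taylor_def by (intro DERIV_sum DERIV_cmult dpow_deriv)
  also have "(\<Sum>m\<in>msets (Suc k). G m * (\<Sum>b<n. v b * (if b \<in># m then dpow (m - {#b#}) c else 0))) =
      (\<Sum>b<n. \<Sum>m\<in>msets (Suc k). G m * (v b * (if b \<in># m then dpow (m - {#b#}) c else 0)))"
    unfolding sum_distrib_left by (rule sum.swap)
  also have "\<dots> = (\<Sum>b<n. \<Sum>m\<in>msets k. G (add_mset b m) * (v b * dpow m c))"
  proof (rule sum.cong[OF refl])
    fix b assume "b \<in> {..<n}"
    then show "(\<Sum>m\<in>msets (Suc k). G m * (v b * (if b \<in># m then dpow (m - {#b#}) c else 0))) =
        (\<Sum>m\<in>msets k. G (add_mset b m) * (v b * dpow m c))"
      by (subst sum_msets_Suc[of b]) auto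
  qed
  also have "\<dots> = (\<Sum>m\<in>msets k. \<Sum>b<n. G (add_mset b m) * (v b * dpow m c))"
    by (rule sum.swap)
  also have "\<dots> = taylor k (D v G) c"
    by (simp add: taylor_def D_def sum_distrib_left sum_distrib_right ac_simps)
  finally show ?thesis .
qed

lemma msets_0: "msets 0 = {{#}}"
  by (auto simp: msets_def)

lemma taylor_0: "taylor 0 G c = G {#}"
  by (simp add: taylor_def msets_0 dpow_def)

lemma taylor_eq_zero:
  assumes "\<And>c. taylor k G c = 0" "m \<in> msets k"
  shows "G m = 0"
  using assms
proof (induction k arbitrary: G m)
  case 0
  then show ?case by (simp add: taylor_0 msets_0)
next
  case (Suc k)
  then obtain b m' where m: "m = add_mset b m'" by (cases m) (auto simp: msets_def)
  then have b: "b < n" "m' \<in> msets k" using Suc.prems(2) by (auto simp: msets_def)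
  have "taylor k (D (unit_vec b) G) c = 0" for c
    using taylor_deriv[of k G c "unit_vec b"] Suc.prems(1) by (auto dest: DERIV_unique[OF _ DERIV_const])
  then have "D (unit_vec b) G m' = 0" by (rule Suc.IH) (rule b)
  then show ?case using b m by (simp add: D_unit)
qed

text \<open>Multiplying a divided power by a variable produces the factor
  \<open>Suc (count m b)\<close>; after reindexing this is \<open>count m b\<close>, which is 0
  where \<open>b\<close> cannot be removed from \<open>m\<close>.\<close>

lemma taylor_mult:
  "taylor k G c * (\<Sum>b<n. a b * c b) =
    taylor (Suc k) (\<lambda>m. \<Sum>b<n. a b * (of_nat (count m b) * G (m - {#b#}))) c"
proof -
  have "taylor (Suc k) (\<lambda>m. \<Sum>b<n. a b * (of_nat (count m b) * G (m - {#b#}))) c =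
      (\<Sum>m\<in>msets (Suc k). \<Sum>b<n. a b * (of_nat (count m b) * G (m - {#b#})) * dpow m c)"
    by (simp add: taylor_def sum_distrib_right)
  also have "\<dots> = (\<Sum>b<n. \<Sum>m\<in>msets (Suc k). a b * (of_nat (count m b) * G (m - {#b#})) * dpow m c)"
    by (rule sum.swap)
  also have "\<dots> = (\<Sum>b<n. \<Sum>m\<in>msets k. a b * G m * (c b * dpow m c))"
  proof (rule sum.cong[OF refl])
    fix b assume b: "b \<in> {..<n}"
    have "(\<Sum>m\<in>msets (Suc k). a b * (of_nat (count m b) * G (m - {#b#})) * dpow m c) =
        (\<Sum>m\<in>msets k. a b * G m * (of_nat (Suc (count m b)) * dpow (add_mset b m) c))"
      by (subst sum_msets_Suc[of b]) (use b in \<open>auto simp: not_in_iff ac_simps\<close>)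
    also have "\<dots> = (\<Sum>m\<in>msets k. a b * G m * (c b * dpow m c))"
      using b by (subst dpow_add_mset) auto
    finally show "(\<Sum>m\<in>msets (Suc k). a b * (of_nat (count m b) * G (m - {#b#})) * dpow m c) =
        (\<Sum>m\<in>msets k. a b * G m * (c b * dpow m c))" .
  qed
  also have "\<dots> = taylor k G c * (\<Sum>b<n. a b * c b)"
    by (simp add: taylor_def sum_product ac_simps sum.swap[of _ "{..<n}"])
  finally show ?thesis by simp
qed

lemma taylor_cong:
  "(\<And>m. m \<in> msets k \<Longrightarrow> G m = G' m) \<Longrightarrow> (\<And>b. b < n \<Longrightarrow> c b = c' b) \<Longrightarrow> taylor k G c = taylor k G' c'"
  unfolding taylor_def dpow_def by (intro sum.cong arg_cong2[where f = "(*)"] prod.cong) auto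

lemma taylor_add: "taylor k (G + G') c = taylor k G c + taylor k G' c"
  by (simp add: taylor_def algebra_simps sum.distrib)

lemma taylor_scale: "taylor k (pscale (*) a G) c = a * taylor k G c"
  by (simp add: taylor_def pscale_def sum_distrib_left mult.assoc)

text \<open>Vectors are functions on all naturals of which only the first \<open>n\<close> entries
  count; \<open>crd (vec u)\<close> is known to agree with \<open>u\<close> just there.\<close>

lemma D_cong: "(\<And>b. b < n \<Longrightarrow> u b = v b) \<Longrightarrow> D u F = D v F"
  by (simp add: D_def)

end

lemma vector_space_pscale: "vector_space s \<Longrightarrow> vector_space (pscale s)"
  unfolding vector_space_def by (simp add: pscale_def fun_eq_iff)

section \<open>Polynomial maps in coordinates of \<open>T\<close> and \<open>N\<close>\<close>

locale symbol_spaces =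
  T: finite_dimensional_vector_space sT BT + N: finite_dimensional_vector_space sN BN + macaulay n d
  for sT :: "complex \<Rightarrow> 't::ab_group_add \<Rightarrow> 't" and BT and sN :: "complex \<Rightarrow> 'n::ab_group_add \<Rightarrow> 'n"
    and BN and n d +
  fixes bT :: "nat \<Rightarrow> 't" and bN :: "nat \<Rightarrow> 'n"
  assumes bT: "bij_betw bT {..<n} BT" and bN: "bij_betw bN {..<d} BN"
begin

definition crd :: "'t \<Rightarrow> nat \<Rightarrow> complex" where
  "crd x b = T.representation BT x (bT b)"

definition ncrd :: "'n \<Rightarrow> nat \<Rightarrow> complex" where
  "ncrd w j = N.representation BN w (bN j)"

definition vec :: "(nat \<Rightarrow> complex) \<Rightarrow> 't" where
  "vec u = (\<Sum>b<n. sT (u b) (bT b))"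

definition nvec :: "(nat \<Rightarrow> complex) \<Rightarrow> 'n" where
  "nvec u = (\<Sum>j<d. sN (u j) (bN j))"

lemma crd_add: "crd (x + y) = (\<lambda>b. crd x b + crd y b)"
  by (simp add: crd_def fun_eq_iff T.representation_add[OF T.independent_Basis] T.span_Basis)

lemma crd_scale: "crd (sT c x) = (\<lambda>b. c * crd x b)"
  by (simp add: crd_def fun_eq_iff T.representation_scale[OF T.independent_Basis] T.span_Basis)

lemma crd_sum: "crd (\<Sum>i\<in>I. f i) = (\<lambda>b. \<Sum>i\<in>I. crd (f i) b)"
  by (simp add: crd_def fun_eq_iff T.representation_sum[OF T.independent_Basis] T.span_Basis)

lemma ncrd_add: "ncrd (x + y) j = ncrd x j + ncrd y j"
  by (simp add: ncrd_def N.representation_add[OF N.independent_Basis] N.span_Basis)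

lemma ncrd_scale: "ncrd (sN c x) j = c * ncrd x j"
  by (simp add: ncrd_def N.representation_scale[OF N.independent_Basis] N.span_Basis)

lemma ncrd_sum: "ncrd (\<Sum>i\<in>I. f i) j = (\<Sum>i\<in>I. ncrd (f i) j)"
  by (simp add: ncrd_def N.representation_sum[OF N.independent_Basis] N.span_Basis)

lemma vec_crd: "vec (crd x) = x"
proof -
  have "(\<Sum>v\<in>BT. sT (T.representation BT x v) v) = x"
    by (rule T.sum_representation_eq) (auto simp: T.independent_Basis T.span_Basis T.finite_Basis)
  then show ?thesis
    unfolding vec_def crd_def
    using sum.reindex_bij_betw[OF bT, of "\<lambda>v. sT (T.representation BT x v) v"] by simp
qed

lemma nvec_ncrd: "nvec (ncrd w) = w"
proof -
  have "(\<Sum>v\<in>BN. sN (N.representation BN w v) v) = w"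
    by (rule N.sum_representation_eq) (auto simp: N.independent_Basis N.span_Basis N.finite_Basis)
  then show ?thesis
    unfolding nvec_def ncrd_def
    using sum.reindex_bij_betw[OF bN, of "\<lambda>v. sN (N.representation BN w v) v"] by simp
qed

lemma crd_vec: "b < n \<Longrightarrow> crd (vec u) b = u b"
proof -
  assume b: "b < n"
  have "crd (bT i) b = (if i = b then 1 else 0)" if "i < n" for i
  proof -
    have "bT i \<in> BT" using bT that by (auto simp: bij_betw_def)
    moreover have "bT b = bT i \<longleftrightarrow> i = b" using bT b that by (auto simp: bij_betw_def inj_on_def)
    ultimately show ?thesis
      unfolding crd_def by (subst T.representation_basis[OF T.independent_Basis]) auto
  qed
  then have "crd (vec u) b = (\<Sum>i<n. if i = b then u i else 0)"
    unfolding vec_def crd_sum crd_scale by (intro sum.cong) auto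
  then show ?thesis using b by simp
qed

lemma ncrd_nvec: "j < d \<Longrightarrow> ncrd (nvec u) j = u j"
proof -
  assume j: "j < d"
  have "ncrd (bN i) j = (if i = j then 1 else 0)" if "i < d" for i
  proof -
    have "bN i \<in> BN" using bN that by (auto simp: bij_betw_def)
    moreover have "bN j = bN i \<longleftrightarrow> i = j" using bN j that by (auto simp: bij_betw_def inj_on_def)
    ultimately show ?thesis
      unfolding ncrd_def by (subst N.representation_basis[OF N.independent_Basis]) auto
  qed
  then have "ncrd (nvec u) j = (\<Sum>i<d. if i = j then u i else 0)"
    unfolding nvec_def ncrd_sum ncrd_scale by (intro sum.cong) auto
  then show ?thesis using j by simp
qed

lemma dual_T_iff: "f \<in> dual_space sT \<longleftrightarrow> (\<forall>x y. f (x + y) = f x + f y) \<and> (\<forall>c x. f (sT c x) = c * f x)"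
  by (simp add: dual_space_def Vector_Spaces.linear_iff T.vector_space_axioms vector_space_over_itself.vector_space_axioms)

lemma dual_N_iff: "f \<in> dual_space sN \<longleftrightarrow> (\<forall>x y. f (x + y) = f x + f y) \<and> (\<forall>c x. f (sN c x) = c * f x)"
  by (simp add: dual_space_def Vector_Spaces.linear_iff N.vector_space_axioms vector_space_over_itself.vector_space_axioms)

lemma dual_T_sum:
  assumes "f \<in> dual_space sT"
  shows "f (\<Sum>i\<in>I. g i) = (\<Sum>i\<in>I. f (g i))"
proof -
  have "f 0 = 0" using assms dual_T_iff[of f] by (metis add_cancel_right_left)
  then show ?thesis using assms dual_T_iff[of f] by (induction I rule: infinite_finite_induct) auto
qed

lemma dual_N_sum:
  assumes "f \<in> dual_space sN"
  shows "f (\<Sum>i\<in>I. g i) = (\<Sum>i\<in>I. f (g i))"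
proof -
  have "f 0 = 0" using assms dual_N_iff[of f] by (metis add_cancel_right_left)
  then show ?thesis using assms dual_N_iff[of f] by (induction I rule: infinite_finite_induct) auto
qed

lemma dual_T_expand:
  assumes "f \<in> dual_space sT"
  shows "f x = (\<Sum>b<n. f (bT b) * crd x b)"
proof -
  have "f x = f (vec (crd x))" by (simp add: vec_crd)
  also have "\<dots> = (\<Sum>b<n. f (bT b) * crd x b)"
    using assms dual_T_iff[of f] by (simp add: vec_def dual_T_sum mult.commute)
  finally show ?thesis .
qed

lemma combination_dual: "(\<lambda>x. \<Sum>b<n. a b * crd x b) \<in> dual_space sT"
  by (simp add: dual_T_iff crd_add crd_scale algebra_simps sum.distrib sum_distrib_left)

lemma crd_dual: "(\<lambda>x. crd x b) \<in> dual_space sT"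
  by (simp add: dual_T_iff crd_add crd_scale)

lemma ncrd_dual: "(\<lambda>w. ncrd w j) \<in> dual_space sN"
  by (simp add: dual_N_iff ncrd_add ncrd_scale)

text \<open>The inverse of the encoding by iterated partial derivatives: component \<open>j\<close>
  is rebuilt as a Taylor polynomial at the origin.\<close>

definition Psi :: "nat \<Rightarrow> (nat multiset \<Rightarrow> complex) \<Rightarrow> 't \<Rightarrow> 'n" where
  "Psi k F x = nvec (\<lambda>j. taylor k (shift {#n + j#} F) (crd x))"

lemma nvec_add: "nvec (\<lambda>j. u j + u' j) = nvec u + nvec u'"
  by (simp add: nvec_def N.scale_left_distrib sum.distrib)

lemma nvec_scale: "nvec (\<lambda>j. c * u j) = sN c (nvec u)"
  by (simp add: nvec_def N.scale_sum_right)

lemma Psi_add: "Psi k (F + G) = Psi k F + Psi k G"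
  by (rule ext) (simp only: Psi_def shift_add taylor_add nvec_add plus_fun_apply)

lemma Psi_scale: "Psi k (pscale (*) c F) = pscale sN c (Psi k F)"
  by (rule ext) (simp only: Psi_def shift_scale taylor_scale nvec_scale, simp only: pscale_def Psi_def)

lemma Psi_deriv:
  assumes f: "f \<in> dual_space sN"
  shows "((\<lambda>t. f (Psi (Suc k) F (x + sT t v))) has_field_derivative f (Psi k (D (crd v) F) x)) (at 0)"
proof -
  have fn: "f (nvec u) = (\<Sum>j<d. u j * f (bN j))" for u
    using f dual_N_iff[of f] by (simp add: nvec_def dual_N_sum)
  have "((\<lambda>t. \<Sum>j<d. taylor (Suc k) (shift {#n + j#} F) (\<lambda>b. crd x b + t * crd v b) * f (bN j))
      has_field_derivative (\<Sum>j<d. taylor k (D (crd v) (shift {#n + j#} F)) (crd x) * f (bN j))) (at 0)"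
    by (intro DERIV_sum DERIV_cmult_right taylor_deriv)
  then show ?thesis unfolding Psi_def fn crd_add crd_scale shift_D .
qed

lemma dual_N_separates:
  assumes "\<And>f. f \<in> dual_space sN \<Longrightarrow> f w = f w'"
  shows "w = w'"
  using assms[OF ncrd_dual] nvec_ncrd by (metis ext)

text \<open>The \<open>THE\<close> in the weak derivative is resolved by \<open>Psi_deriv\<close>
  for existence and by the functionals separating points for uniqueness.\<close>

lemma dir_deriv_Psi: "dir_deriv sT sN v (Psi (Suc k) F) = Psi k (D (crd v) F)"
  unfolding dir_deriv_def
proof (rule ext, rule the_equality)
  fix x w
  assume w: "\<forall>f\<in>dual_space sN. ((\<lambda>t. f (Psi (Suc k) F (x + sT t v))) has_field_derivative f w) (at 0)"
  show "w = Psi k (D (crd v) F) x"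
    by (rule dual_N_separates) (use w Psi_deriv DERIV_unique in blast)
qed (simp add: Psi_deriv)

text \<open>\<open>Psi k\<close> reads only values on \<open>idx k\<close>, so membership in
  \<open>X k\<close> is what makes it injective.\<close>

lemma Psi_eq_zero:
  assumes F: "F \<in> X k" and z: "\<And>x. Psi k F x = 0"
  shows "F = 0"
proof
  fix y show "F y = 0 y"
  proof (cases "y \<in> idx k")
    case True
    then obtain i m where y: "y = add_mset i m" "n \<le> i" "i < n + d" "m \<in> msets k"
      by (auto simp: idx_eq)
    define j where "j = i - n"
    have j: "i = n + j" "j < d" using y by (auto simp: j_def)
    have "taylor k (shift {#n + j#} F) c = 0" for c
    proof -
      have "ncrd (Psi k F (vec c)) j = taylor k (shift {#n + j#} F) (crd (vec c))"
        unfolding Psi_def by (rule ncrd_nvec) (rule j)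
      also have "\<dots> = taylor k (shift {#n + j#} F) c" by (intro taylor_cong) (auto simp: crd_vec)
      also have "ncrd (Psi k F (vec c)) j = 0" using z ncrd_scale[of 0 0 j] by simp
      finally show ?thesis by simp
    qed
    then have "shift {#n + j#} F m = 0" by (rule taylor_eq_zero) (rule y)
    then show ?thesis using y j by (simp add: shift_def)
  qed (use F in \<open>simp add: X_def\<close>)
qed

lemma Psi_inj:
  assumes "F \<in> X k" "G \<in> X k" "Psi k F = Psi k G"
  shows "F = G"
proof -
  have "Psi k (F - G) x = 0" for x
    using Psi_add[of k "F - G" G] assms(3) by (simp add: fun_eq_iff)
  then have "F - G = 0" using assms(1,2) cf.subspace_diff[OF subspace_X] by (intro Psi_eq_zero) auto
  then show ?thesis by simp
qed

end

lemma prod_nth_count: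
  fixes f :: "nat \<Rightarrow> 'a::comm_monoid_mult"
  assumes "set xs \<subseteq> {..<n}"
  shows "(\<Prod>i<length xs. f (xs ! i)) = (\<Prod>b<n. f b ^ count (mset xs) b)"
  using assms
proof (induction xs)
  case (Cons x xs)
  have "(\<Prod>b<n. f b ^ count (mset (x # xs)) b) = (\<Prod>b<n. (if b = x then f b else 1) * f b ^ count (mset xs) b)"
    by (intro prod.cong) auto
  also have "\<dots> = f x * (\<Prod>b<n. f b ^ count (mset xs) b)"
    using Cons.prems by (simp add: prod.distrib)
  finally show ?case using Cons by (simp add: prod.lessThan_Suc_shift del: prod.lessThan_Suc)
qed simp

context symbol_spaces
begin

sublocale NF: vector_space "pscale sN :: complex \<Rightarrow> ('t \<Rightarrow> 'n) \<Rightarrow> 't \<Rightarrow> 'n"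
  by (rule vector_space_pscale[OF N.vector_space_axioms])

lemma Psi_zero: "Psi k 0 = 0"
  using Psi_add[of k 0 0] by simp

lemma Psi_sum: "Psi k (\<Sum>i\<in>I. f i) = (\<Sum>i\<in>I. Psi k (f i))"
proof (induction I rule: infinite_finite_induct)
  case (insert i I)
  then show ?case by (simp only: sum.insert[OF insert.hyps(1,2)] Psi_add)
qed (simp_all only: sum.infinite sum.empty Psi_zero not_False_eq_True)

lemma dpow_factor:
  assumes "m \<in> msets k"
  obtains a \<phi> where "\<And>i. \<phi> i \<in> dual_space sT" "\<And>x. dpow m (crd x) = a * (\<Prod>i<k. \<phi> i x)"
proof -
  obtain xs where xs: "mset xs = m" using ex_mset by blast
  then have len: "length xs = k" "set xs \<subseteq> {..<n}" using assms by (auto simp: msets_def)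
  have "dpow m (crd x) = inverse (\<Prod>b<n. fact (count m b)) * (\<Prod>i<k. crd x (xs ! i))" for x
    using prod_nth_count[OF len(2), of "crd x"] xs len(1)
    by (simp add: dpow_def prod_dividef field_simps)
  then show ?thesis using that[of "\<lambda>i x. crd x (xs ! i)"] crd_dual by blast
qed

lemma subspace_sym_tensor:
  fixes V :: "('t \<Rightarrow> complex) set"
  shows "NF.subspace (sym_tensor sN V k)"
  unfolding sym_tensor_def by (rule NF.subspace_span)

lemma generator_in_sym_tensor:
  fixes V :: "('t \<Rightarrow> complex) set"
  shows "(\<And>i. i < k \<Longrightarrow> \<phi> i \<in> V) \<Longrightarrow> (\<lambda>x. sN (\<Prod>i<k. \<phi> i x) w) \<in> sym_tensor sN V k"
  unfolding sym_tensor_def by (rule NF.span_base) blast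

lemma Psi_in_sym_tensor: "Psi k F \<in> sym_tensor sN (dual_space sT) k"
proof -
  define p where "p j m = (\<lambda>x. sN (F (add_mset (n + j) m) * dpow m (crd x)) (bN j))" for j m
  have "Psi k F = (\<Sum>j<d. \<Sum>m\<in>msets k. p j m)"
  proof
    fix x show "Psi k F x = (\<Sum>j<d. \<Sum>m\<in>msets k. p j m) x"
      by (simp add: Psi_def nvec_def taylor_def shift_def p_def sum_apply N.scale_sum_left)
  qed
  moreover have "p j m \<in> sym_tensor sN (dual_space sT) k" if m: "m \<in> msets k" for j m
  proof -
    obtain a \<phi> where \<phi>: "\<And>i. \<phi> i \<in> dual_space sT" "\<And>x. dpow m (crd x) = a * (\<Prod>i<k. \<phi> i x)"
      by (rule dpow_factor[OF m]) (rule that)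
    have "p j m = pscale sN (F (add_mset (n + j) m) * a) (\<lambda>x. sN (\<Prod>i<k. \<phi> i x) (bN j))"
      by (simp add: p_def pscale_def \<phi>(2) mult.assoc)
    then show ?thesis
      using NF.subspace_scale[OF subspace_sym_tensor] generator_in_sym_tensor \<phi>(1) by presburger
  qed
  ultimately show ?thesis by (auto intro!: NF.subspace_sum[OF subspace_sym_tensor])
qed

lemma product_is_taylor:
  assumes "\<forall>i<k. \<phi> i \<in> dual_space sT"
  shows "\<exists>G. \<forall>x. taylor k G (crd x) = (\<Prod>i<k. \<phi> i x)"
  using assms
proof (induction k)
  case 0
  show ?case by (intro exI[of _ "\<lambda>m. 1"]) (simp add: taylor_0)
next
  case (Suc k)
  then obtain G where G: "\<And>x. taylor k G (crd x) = (\<Prod>i<k. \<phi> i x)" by auto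
  have "(\<Prod>i<Suc k. \<phi> i x) = taylor k G (crd x) * (\<Sum>b<n. \<phi> k (bT b) * crd x b)" for x
    using dual_T_expand[of "\<phi> k" x] Suc.prems by (simp add: G)
  then have "\<And>x. taylor (Suc k)
      (\<lambda>m. \<Sum>b<n. \<phi> k (bT b) * (of_nat (count m b) * G (m - {#b#}))) (crd x) = (\<Prod>i<Suc k. \<phi> i x)"
    unfolding taylor_mult by (rule sym)
  then show ?case by blast
qed

lemma generator_is_Psi:
  assumes "\<forall>i<k. \<phi> i \<in> dual_space sT"
  shows "(\<lambda>x. sN (\<Prod>i<k. \<phi> i x) w) \<in> Psi k ` X k"
proof -
  obtain G where G: "\<And>x. taylor k G (crd x) = (\<Prod>i<k. \<phi> i x)" using product_is_taylor[OF assms] by blast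
  \<comment> \<open>At most one summand is nonzero: when the condition holds, \<open>n + j\<close>
    is the only marker in \<open>y\<close>.\<close>
  define F where "F y = (\<Sum>j<d. if n + j \<in># y \<and> y - {#n + j#} \<in> msets k
      then ncrd w j * G (y - {#n + j#}) else 0)" for y
  have "F \<in> X k" unfolding X_def mem_Collect_eq
  proof (intro allI impI)
    fix y assume y: "y \<notin> idx k"
    have "\<not> (n + j \<in># y \<and> y - {#n + j#} \<in> msets k)" if "j < d" for j
      using add_mset_msets[of "n + j" "y - {#n + j#}" k] y that by auto
    then show "F y = 0" unfolding F_def by (intro sum.neutral) auto
  qed
  moreover have "Psi k F x = sN (\<Prod>i<k. \<phi> i x) w" for x
  proof -
    have "shift {#n + j#} F m = pscale (*) (ncrd w j) G m" if m: "m \<in> msets k" and j: "j < d" for j m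
    proof -
      have nm: "n + i \<notin># m" for i using m by (auto simp: msets_def)
      have "F (add_mset (n + j) m) = (\<Sum>i<d. if i = j then ncrd w j * G m else 0)"
        unfolding F_def by (intro sum.cong) (use m nm in auto)
      then show ?thesis using j by (simp add: shift_def pscale_def)
    qed
    then have "taylor k (shift {#n + j#} F) (crd x) = ncrd w j * (\<Prod>i<k. \<phi> i x)" if "j < d" for j
      using that taylor_cong[of k "shift {#n + j#} F" "pscale (*) (ncrd w j) G" "crd x" "crd x"]
      by (simp add: taylor_scale G)
    then have "Psi k F x = nvec (\<lambda>j. (\<Prod>i<k. \<phi> i x) * ncrd w j)"
      unfolding Psi_def nvec_def by (intro sum.cong) (auto simp: mult.commute)
    then show ?thesis using nvec_scale[of "\<Prod>i<k. \<phi> i x" "ncrd w"] by (simp add: nvec_ncrd)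
  qed
  ultimately show ?thesis by (intro image_eqI[of _ _ F]) auto
qed

lemma subspace_Psi_image:
  assumes "cf.subspace S"
  shows "NF.subspace (Psi k ` S)"
proof (rule NF.subspaceI)
  show "0 \<in> Psi k ` S" using cf.subspace_0[OF assms] Psi_zero[of k] by (metis imageI)
  show "x + y \<in> Psi k ` S" if "x \<in> Psi k ` S" "y \<in> Psi k ` S" for x y
    using that cf.subspace_add[OF assms] Psi_add[of k] by (auto simp only: image_iff) metis
  show "pscale sN c x \<in> Psi k ` S" if "x \<in> Psi k ` S" for c x
    using that cf.subspace_scale[OF assms] Psi_scale[of k] by (auto simp only: image_iff) metis
qed

lemma sym_tensor_eq: "sym_tensor sN (dual_space sT) k = Psi k ` X k"
proof
  show "sym_tensor sN (dual_space sT) k \<subseteq> Psi k ` X k"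
    unfolding sym_tensor_def
    by (rule NF.span_minimal[OF _ subspace_Psi_image[OF subspace_X]]) (use generator_is_Psi in auto)
qed (use Psi_in_sym_tensor in auto)

lemma D_crd_add: "D (crd (x + y)) F = D (crd x) F + D (crd y) F"
  by (rule ext) (simp add: D_def crd_add distrib_right sum.distrib)

lemma D_crd_scale: "D (crd (sT c x)) F = pscale (*) c (D (crd x) F)"
  by (rule ext) (simp add: D_def crd_scale pscale_def sum_distrib_left mult.assoc)

lemma killed_span:
  assumes "\<And>w. w \<in> W \<Longrightarrow> D (crd w) F = 0" "w \<in> T.span W"
  shows "D (crd w) F = 0"
  using assms(2)
proof (induction rule: T.span_induct_alt)
  case base
  show ?case using D_crd_scale[of 0 0 F] by (simp only: T.scale_zero_left cf.scale_zero_left)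
next
  case (step c x y)
  then show ?case
    by (simp only: D_crd_add D_crd_scale assms(1) cf.scale_zero_right add_0_left)
qed

lemma ann_span: "ann sT (T.span W) = ann sT W"
proof -
  have "\<phi> w = 0" if \<phi>: "\<phi> \<in> ann sT W" and w: "w \<in> T.span W" for \<phi> w
    using w
  proof (induction rule: T.span_induct_alt)
    case base
    then show ?case using \<phi> dual_T_iff[of \<phi>] by (auto simp: ann_def) (metis add_cancel_right_left)
  next
    case (step c x y)
    then show ?case using \<phi> dual_T_iff[of \<phi>] by (auto simp: ann_def)
  qed
  then show ?thesis using T.span_base by (auto simp: ann_def)
qed

section \<open>Symmetric powers of an annihilator\<close>

text \<open>A derivative that vanishes on a whole line makes each functional of the map constant
  along it. Translation invariance is easy to check on products of functionals and passes to spans.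
  Degree 0 is treated apart, as \<open>Psi_deriv\<close> starts in degree 1.\<close>

lemma Psi_translation:
  assumes F: "F \<in> X k"
  shows "D (crd w) F = 0 \<longleftrightarrow> (\<forall>x t. Psi k F (x + sT t w) = Psi k F x)"
proof (cases k)
  case 0
  then show ?thesis using F D_X_0 by (simp add: Psi_def taylor_0)
next
  case (Suc l)
  show ?thesis
  proof
    assume z: "D (crd w) F = 0"
    show "\<forall>x t. Psi k F (x + sT t w) = Psi k F x"
    proof (intro allI dual_N_separates)
      fix x t f assume f: "f \<in> dual_space sN"
      have f0: "f 0 = 0" using f dual_N_iff[of f] by (metis add_cancel_right_left)
      define h where "h t = f (Psi (Suc l) F (x + sT t w))" for t
      have "(h has_field_derivative 0) (at s)" for s
      proof -
        have "((\<lambda>t. f (Psi (Suc l) F ((x + sT s w) + sT t w))) has_field_derivative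
            f (Psi l (D (crd w) F) (x + sT s w))) (at 0)"
          by (rule Psi_deriv[OF f])
        then have "((\<lambda>t. h (t + s)) has_field_derivative 0) (at 0)"
          unfolding z Psi_zero zero_fun_apply f0
          by (simp add: h_def T.scale_left_distrib ac_simps)
        then show ?thesis using DERIV_shift[of h 0 0 s] by simp
      qed
      then have "\<exists>c. \<forall>s\<in>UNIV. h s = c"
        by (intro has_field_derivative_zero_constant) (auto intro: has_field_derivative_at_within)
      then have "h t = h 0" by auto
      then show "f (Psi k F (x + sT t w)) = f (Psi k F x)" by (simp add: h_def Suc)
    qed
  next
    assume inv: "\<forall>x t. Psi k F (x + sT t w) = Psi k F x"
    have "Psi l (D (crd w) F) x = 0" for x
    proof (rule dual_N_separates)
      fix f assume f: "f \<in> dual_space sN"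
      have f0: "f 0 = 0" using f dual_N_iff[of f] by (metis add_cancel_right_left)
      have "((\<lambda>t. f (Psi (Suc l) F x)) has_field_derivative f (Psi l (D (crd w) F) x)) (at 0)"
        using Psi_deriv[OF f, of l F x w] inv Suc by simp
      then have "f (Psi l (D (crd w) F) x) = 0" using DERIV_unique[OF _ DERIV_const] by blast
      then show "f (Psi l (D (crd w) F) x) = f 0" by (simp add: f0)
    qed
    then show "D (crd w) F = 0" using F Suc D_X by (intro Psi_eq_zero[of _ l]) auto
  qed
qed

text \<open>The projection along the span of \<open>W\<close> onto a complement; pulling functionals
  back along it produces functionals that annihilate \<open>W\<close>.\<close>

lemma projection_exists:
  obtains \<pi> where "\<And>x y. \<pi> (x + y) = \<pi> x + \<pi> y" "\<And>c x. \<pi> (sT c x) = sT c (\<pi> x)"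
    "\<And>w. w \<in> W \<Longrightarrow> \<pi> w = 0" "\<And>x. x - \<pi> x \<in> T.span W"
proof -
  obtain B where B: "B \<subseteq> W" "T.independent B" "W \<subseteq> T.span B"
    using T.maximal_independent_subset[of W] by blast
  let ?E = "T.extend_basis B"
  interpret TT: vector_space_pair sT sT by unfold_locales
  obtain \<pi> where \<pi>: "Vector_Spaces.linear sT sT \<pi>" "\<And>x. x \<in> ?E \<Longrightarrow> \<pi> x = (if x \<in> B then 0 else x)"
    using TT.linear_independent_extend[OF T.independent_extend_basis[OF B(2)], of "\<lambda>x. if x \<in> B then 0 else x"]
    by blast
  have lin: "\<pi> (x + y) = \<pi> x + \<pi> y" "\<pi> (sT c x) = sT c (\<pi> x)" for x y c
    using \<pi>(1) by (auto simp: Vector_Spaces.linear_iff)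
  have \<pi>0: "\<pi> 0 = 0" using lin(1)[of 0 0] by simp
  have spanB: "T.span B = T.span W" using B by (metis T.span_mono T.span_span subset_antisym)
  have "\<pi> w = 0" if "w \<in> W" for w
  proof -
    have "w \<in> T.span B" using that B by blast
    then show ?thesis
    proof (induction rule: T.span_induct_alt)
      case (step c x y)
      then have "x \<in> ?E" using T.extend_basis_superset[OF B(2)] by blast
      then show ?case using step \<pi>(2)[of x] by (simp add: lin)
    qed (rule \<pi>0)
  qed
  moreover have "x - \<pi> x \<in> T.span B" for x
  proof -
    have "x \<in> T.span ?E" using T.span_extend_basis[OF B(2)] by simp
    then show ?thesis
    proof (induction rule: T.span_induct_alt)
      case base
      show ?case by (simp add: \<pi>0 T.span_zero)
    next
      case (step c x y)
      have "x - \<pi> x \<in> T.span B" using \<pi>(2)[OF step(1)] by (auto intro: T.span_base T.span_zero)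
      then have "sT c (x - \<pi> x) + (y - \<pi> y) \<in> T.span B" using step by (intro T.span_add T.span_scale)
      then show ?case by (simp add: lin T.scale_right_diff_distrib algebra_simps)
    qed
  qed
  ultimately show ?thesis using that lin spanB by blast
qed

lemma sym_tensor_mono:
  fixes V :: "('t \<Rightarrow> complex) set"
  shows "V \<subseteq> V' \<Longrightarrow> sym_tensor sN V k \<subseteq> sym_tensor sN V' k"
  unfolding sym_tensor_def by (rule NF.span_mono) blast

text \<open>Products of functionals vanishing on \<open>W\<close> are invariant under translation by
  \<open>W\<close>. Conversely an invariant map satisfies \<open>p x = p (\<pi> x)\<close> for the
  projection \<open>\<pi>\<close>, and pullback by \<open>\<pi>\<close> turns each generator into a
  product of functionals in the annihilator.\<close>

lemma sym_tensor_ann_eq: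
  "sym_tensor sN (ann sT W) k = Psi k ` {F \<in> X k. \<forall>w\<in>W. D (crd w) F = 0}" (is "?L = ?R")
proof
  have sub: "ann sT W \<subseteq> dual_space sT" by (auto simp: ann_def)
  show "?L \<subseteq> ?R"
  proof
    fix p assume p: "p \<in> ?L"
    then obtain F where F: "F \<in> X k" "p = Psi k F"
      using sym_tensor_mono[OF sub, of k] sym_tensor_eq[of k] by auto
    have "?L \<subseteq> {p. \<forall>w\<in>W. \<forall>x t. p (x + sT t w) = p x}"
      unfolding sym_tensor_def
    proof (rule NF.span_minimal)
      show "NF.subspace {p. \<forall>w\<in>W. \<forall>x t. p (x + sT t w) = p x}"
        by (rule NF.subspaceI) (auto simp: pscale_def)
      show "{\<lambda>x. sN (\<Prod>i<k. \<phi> i x) w | \<phi> w. \<forall>i<k. \<phi> i \<in> ann sT W} \<subseteq>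
          {p. \<forall>w\<in>W. \<forall>x t. p (x + sT t w) = p x}"
      proof (intro subsetI CollectI ballI allI)
        fix p w x t
        assume "p \<in> {\<lambda>x. sN (\<Prod>i<k. \<phi> i x) w | \<phi> w. \<forall>i<k. \<phi> i \<in> ann sT W}" and w: "w \<in> W"
        then obtain \<phi> w' where p: "p = (\<lambda>x. sN (\<Prod>i<k. \<phi> i x) w')"
          and \<phi>: "\<forall>i<k. \<phi> i \<in> ann sT W" by blast
        have "\<phi> i (x + sT t w) = \<phi> i x" if "i < k" for i
          using \<phi> w that dual_T_iff[of "\<phi> i"] by (auto simp: ann_def)
        then have "(\<Prod>i<k. \<phi> i (x + sT t w)) = (\<Prod>i<k. \<phi> i x)" by (intro prod.cong) auto
        then show "p (x + sT t w) = p x" by (simp add: p)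
      qed
    qed
    then have "\<forall>w\<in>W. D (crd w) F = 0" using Psi_translation[OF F(1)] p F(2) by blast
    then show "p \<in> ?R" using F by blast
  qed
  show "?R \<subseteq> ?L"
  proof
    fix p assume "p \<in> ?R"
    then obtain F where F: "F \<in> X k" "\<And>w. w \<in> W \<Longrightarrow> D (crd w) F = 0" "p = Psi k F" by auto
    obtain \<pi> where \<pi>: "\<And>x y. \<pi> (x + y) = \<pi> x + \<pi> y" "\<And>c x. \<pi> (sT c x) = sT c (\<pi> x)"
      "\<And>w. w \<in> W \<Longrightarrow> \<pi> w = 0" "\<And>x. x - \<pi> x \<in> T.span W"
      by (rule projection_exists[of W]) (rule that)
    have "p x = p (\<pi> x)" for x
    proof -
      have "D (crd (x - \<pi> x)) F = 0" by (rule killed_span[OF F(2) \<pi>(4)])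
      then have "p (\<pi> x + sT 1 (x - \<pi> x)) = p (\<pi> x)" using Psi_translation[OF F(1)] F(3) by blast
      then show ?thesis by simp
    qed
    then have "p = (\<lambda>x. p (\<pi> x))" by blast
    moreover have "sym_tensor sN (dual_space sT) k \<subseteq> {p. (\<lambda>x. p (\<pi> x)) \<in> ?L}"
      unfolding sym_tensor_def[of _ "dual_space sT"]
    proof (rule NF.span_minimal)
      note sub = subspace_sym_tensor[of "ann sT W" k]
      show "NF.subspace {p. (\<lambda>x. p (\<pi> x)) \<in> ?L}"
        unfolding NF.subspace_def mem_Collect_eq
      proof (intro conjI ballI allI)
        show "(\<lambda>x. (0 :: 't \<Rightarrow> 'n) (\<pi> x)) \<in> ?L"
          using NF.subspace_0[OF sub] by (simp add: zero_fun_def)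
        show "(\<lambda>x. (p + q) (\<pi> x)) \<in> ?L" if "p \<in> {p. (\<lambda>x. p (\<pi> x)) \<in> ?L}" "q \<in> {p. (\<lambda>x. p (\<pi> x)) \<in> ?L}" for p q
          using NF.subspace_add[OF sub, of "\<lambda>x. p (\<pi> x)" "\<lambda>x. q (\<pi> x)"] that by (simp add: plus_fun_def)
        show "(\<lambda>x. pscale sN c p (\<pi> x)) \<in> ?L" if "p \<in> {p. (\<lambda>x. p (\<pi> x)) \<in> ?L}" for c p
          using NF.subspace_scale[OF sub, of "\<lambda>x. p (\<pi> x)" c] that by (simp add: pscale_def)
      qed
      show "{\<lambda>x. sN (\<Prod>i<k. \<phi> i x) w | \<phi> w. \<forall>i<k. \<phi> i \<in> dual_space sT} \<subseteq> {p. (\<lambda>x. p (\<pi> x)) \<in> ?L}"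
      proof clarify
        fix \<phi> and w :: 'n assume \<phi>: "\<forall>i<k. \<phi> i \<in> dual_space sT"
        have "\<forall>i<k. (\<lambda>x. \<phi> i (\<pi> x)) \<in> ann sT W"
        proof (intro allI impI)
          fix i assume "i < k"
          then have i: "\<phi> i \<in> dual_space sT" using \<phi> by blast
          then have "\<phi> i 0 = 0" using dual_T_iff[of "\<phi> i"] by (metis add_cancel_right_left)
          then show "(\<lambda>x. \<phi> i (\<pi> x)) \<in> ann sT W"
            using i \<pi>(1,2,3) dual_T_iff[of "\<phi> i"] dual_T_iff[of "\<lambda>x. \<phi> i (\<pi> x)"] by (simp add: ann_def)
        qed
        then show "(\<lambda>x. sN (\<Prod>i<k. \<phi> i (\<pi> x)) w) \<in> ?L"
          by (intro generator_in_sym_tensor) blast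
      qed
    qed
    ultimately show "p \<in> ?L" using F(3) Psi_in_sym_tensor[of k F] by (metis (no_types, lifting) mem_Collect_eq subsetD)
  qed
qed

text \<open>Elements of \<open>tensor_dual\<close> take values in \<open>h\<close> because
  \<open>h\<close> is a subspace; conversely the Spencer image is expanded over the coordinate
  functionals, with the partial derivatives as coefficients.\<close>

lemma prolongation_iff:
  assumes h: "NF.subspace h"
  shows "Psi (Suc k) F \<in> prolongation sT sN k h \<longleftrightarrow> (\<forall>v. Psi k (D (crd v) F) \<in> h)"
proof -
  interpret NFF: vector_space "pscale (pscale sN) :: complex \<Rightarrow> ('t \<Rightarrow> 't \<Rightarrow> 'n) \<Rightarrow> 't \<Rightarrow> 't \<Rightarrow> 'n"
    by (rule vector_space_pscale[OF NF.vector_space_axioms])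
  have sp: "spencer sT sN (Psi (Suc k) F) = (\<lambda>v. Psi k (D (crd v) F))"
    by (simp add: spencer_def dir_deriv_Psi)
  have "(\<lambda>v. Psi k (D (crd v) F)) \<in> tensor_dual sT sN h \<longleftrightarrow> (\<forall>v. Psi k (D (crd v) F) \<in> h)"
  proof
    have "tensor_dual sT sN h \<subseteq> {P. \<forall>v. P v \<in> h}"
      unfolding tensor_dual_def
    proof (rule NFF.span_minimal)
      show "NFF.subspace {P. \<forall>v. P v \<in> h}"
        using NF.subspace_0[OF h] NF.subspace_add[OF h] NF.subspace_scale[OF h]
        by (intro NFF.subspaceI CollectI allI) (simp_all add: pscale_def[of "pscale sN"])
      show "{\<lambda>v. pscale sN (\<phi> v) q |\<phi> q. \<phi> \<in> dual_space sT \<and> q \<in> h} \<subseteq> {P. \<forall>v. P v \<in> h}"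
        using NF.subspace_scale[OF h] by blast
    qed
    then show "(\<lambda>v. Psi k (D (crd v) F)) \<in> tensor_dual sT sN h \<Longrightarrow> \<forall>v. Psi k (D (crd v) F) \<in> h"
      by blast
  next
    assume *: "\<forall>v. Psi k (D (crd v) F) \<in> h"
    have unit: "Psi k (D (unit_vec b) F) \<in> h" for b
      using *[rule_format, of "vec (unit_vec b)"] D_cong[of "crd (vec (unit_vec b))" "unit_vec b" F]
      by (simp add: crd_vec)
    have "(\<lambda>v. Psi k (D (crd v) F)) = (\<Sum>b<n. (\<lambda>v. pscale sN (crd v b) (Psi k (D (unit_vec b) F))))"
    proof
      fix v
      have "Psi k (D (crd v) F) = (\<Sum>b<n. pscale sN (crd v b) (Psi k (D (unit_vec b) F)))"
        by (subst D_expand_sum) (simp only: D_scale Psi_sum Psi_scale)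
      then show "Psi k (D (crd v) F) = (\<Sum>b<n. (\<lambda>v. pscale sN (crd v b) (Psi k (D (unit_vec b) F)))) v"
        by (simp only: sum_apply)
    qed
    also have "\<dots> \<in> tensor_dual sT sN h"
      unfolding tensor_dual_def
    proof (intro NFF.span_sum NFF.span_base CollectI)
      fix b show "\<exists>\<phi> q. (\<lambda>v. pscale sN (crd v b) (Psi k (D (unit_vec b) F))) = (\<lambda>v. pscale sN (\<phi> v) q) \<and>
          \<phi> \<in> dual_space sT \<and> q \<in> h"
        by (intro exI[of _ "\<lambda>v. crd v b"] exI[of _ "Psi k (D (unit_vec b) F)"] conjI refl crd_dual unit)
    qed
    finally show "(\<lambda>v. Psi k (D (crd v) F)) \<in> tensor_dual sT sN h" .
  qed
  then show ?thesis unfolding prolongation_def mem_Collect_eq sp using Psi_in_sym_tensor by blast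
qed


subsection \<open>Involutive systems\<close>

definition enc :: "(nat \<Rightarrow> ('t \<Rightarrow> 'n) set) \<Rightarrow> nat \<Rightarrow> (nat multiset \<Rightarrow> complex) set" where
  "enc g k = {F \<in> X k. Psi k F \<in> g k}"

lemma symbolic_systemD:
  assumes "symbolic_system sT sN g"
  shows "NF.subspace (g k)" "g k \<subseteq> Psi k ` X k" "g (Suc k) \<subseteq> prolongation sT sN k (g k)"
    "g 0 = Psi 0 ` X 0"
proof -
  show "g (Suc k) \<subseteq> prolongation sT sN k (g k)"
    using assms unfolding symbolic_system_def by (metis diff_Suc_1 le_add1 plus_1_eq_Suc)
qed (use assms in \<open>auto simp: symbolic_system_def sym_tensor_eq\<close>)

lemma system_enc:
  assumes g: "symbolic_system sT sN g"
  shows "system (enc g)"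
  unfolding system_def
proof (intro allI conjI ballI)
  note sub = symbolic_systemD(1)[OF g]
  fix k
  show "cf.subspace (enc g k)"
  proof (rule cf.subspaceI)
    show "0 \<in> enc g k"
      using cf.subspace_0[OF subspace_X[of k]] NF.subspace_0[OF sub] unfolding enc_def by (simp only: mem_Collect_eq Psi_zero)
    show "F + G \<in> enc g k" if "F \<in> enc g k" "G \<in> enc g k" for F G
      using that cf.subspace_add[OF subspace_X[of k]] NF.subspace_add[OF sub] unfolding enc_def by (simp only: mem_Collect_eq Psi_add)
    show "pscale (*) c F \<in> enc g k" if "F \<in> enc g k" for c F
      using that cf.subspace_scale[OF subspace_X[of k]] NF.subspace_scale[OF sub] unfolding enc_def by (simp only: mem_Collect_eq Psi_scale)
  qed
  show "enc g k \<subseteq> X k" by (auto simp: enc_def)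
next
  fix k v F assume F: "F \<in> enc g (Suc k)"
  then have "Psi (Suc k) F \<in> prolongation sT sN k (g k)"
    using symbolic_systemD(3)[OF g] by (auto simp: enc_def)
  then have "Psi k (D (crd (vec v)) F) \<in> g k"
    using prolongation_iff[OF symbolic_systemD(1)[OF g]] by blast
  then show "D v F \<in> enc g k"
    using F D_X[of F k v] D_cong[of "crd (vec v)" v F] by (simp add: enc_def crd_vec)
qed

text \<open>An order is the degree where equality fails, one more than the degree that is prolonged;
  hence the image under \<open>Suc\<close>.\<close>

lemma finite_orders_symbolic:
  assumes g: "symbolic_system sT sN g"
  shows "finite (orders sT sN g)"
proof (rule finite_subset)
  let ?O = "{k. \<exists>F\<in>X (Suc k). (\<forall>v. D v F \<in> enc g k) \<and> F \<notin> enc g (Suc k)}"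
  show "finite (Suc ` ?O)" using finite_orders[OF system_enc[OF g]] by simp
  show "orders sT sN g \<subseteq> Suc ` ?O"
  proof
    fix l assume "l \<in> orders sT sN g"
    then obtain k where k: "l = Suc k" "g (Suc k) \<noteq> prolongation sT sN k (g k)"
      by (cases l) (auto simp: orders_def)
    then obtain p where p: "p \<in> prolongation sT sN k (g k)" "p \<notin> g (Suc k)"
      using symbolic_systemD(3)[OF g] by blast
    then obtain F where F: "F \<in> X (Suc k)" "p = Psi (Suc k) F"
      by (auto simp: prolongation_def sym_tensor_eq)
    have "D v F \<in> enc g k" for v
    proof -
      have "Psi k (D (crd (vec v)) F) \<in> g k"
        using p(1) F(2) prolongation_iff[OF symbolic_systemD(1)[OF g]] by blast
      then show ?thesis
        using D_X[OF F(1), of v] D_cong[of "crd (vec v)" v F] by (simp add: enc_def crd_vec)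
    qed
    then show "l \<in> Suc ` ?O" using F p(2) k(1) by (auto simp: enc_def)
  qed
qed

lemma prolongation_beyond_r_max:
  assumes g: "symbolic_system sT sN g" and k: "r_max sT sN g \<le> k"
  shows "g (Suc k) = prolongation sT sN k (g k)"
proof (rule ccontr)
  assume "g (Suc k) \<noteq> prolongation sT sN k (g k)"
  then have "Suc k \<in> orders sT sN g" by (simp add: orders_def)
  then have "Suc k \<le> r_max sT sN g"
    using Max_ge[OF finite_orders_symbolic[OF g]] by (auto simp: r_max_def)
  then show False using k by simp
qed

text \<open>In degree at least 1 an element killed by all derivatives vanishes, as the flag
  condition in degree \<open>r_max\<close> requires.\<close>

lemma r_max_pos:
  assumes "symbolic_system sT sN g"
  shows "1 \<le> r_max sT sN g"
proof (cases "orders sT sN g = {}")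
  case False
  then have "Max (orders sT sN g) \<in> orders sT sN g"
    using Max_in finite_orders_symbolic[OF assms] by blast
  then show ?thesis using False by (simp add: r_max_def orders_def)
qed (simp add: r_max_def)

text \<open>Involutivity makes the derivatives onto from the prolongation, and from
  \<open>r_max\<close> on the prolongation is the next component of \<open>g\<close>. One basis from
  the generic set is picked for each \<open>k\<close>.\<close>

lemma quasi_regular_flag:
  assumes g: "involutive_system sT sN g" and k: "r_max sT sN g \<le> k"
  shows "\<exists>fl. (\<forall>F\<in>enc g k. (\<forall>u\<in>set fl. D u F = 0) \<longrightarrow> F = 0) \<and>
      (\<forall>i<length fl. \<forall>F\<in>enc g k. (\<forall>u\<in>set (take i fl). D u F = 0) \<longrightarrow>
        (\<exists>G\<in>enc g (Suc k). (\<forall>u\<in>set (take i fl). D u G = 0) \<and> D (fl ! i) G = F))"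
proof -
  have sys: "symbolic_system sT sN g" and inv: "involutive_subspace sT sN k (g k)"
    using g by (auto simp: involutive_system_def)
  define A where "A i vs = sym_tensor sN (ann sT (T.span (set (take i vs))))" for i and vs :: "'t list"
  have A: "A i vs l = Psi l ` {F \<in> X l. \<forall>w\<in>set (take i vs). D (crd w) F = 0}" for i vs l
    unfolding A_def ann_span sym_tensor_ann_eq ..
  obtain vs where basis: "ordered_basis sT vs"
    and onto: "\<And>i. i < length vs \<Longrightarrow>
      dir_deriv sT sN (vs ! i) ` (prolongation sT sN k (g k) \<inter> A i vs (Suc k)) = g k \<inter> A i vs k"
    using inv unfolding involutive_subspace_def for_generic_basis_def A_def by blast
  obtain l where l: "k = Suc l" using r_max_pos[OF sys] k by (cases k) auto
  show ?thesis
  proof (intro exI[of _ "map crd vs"] conjI ballI allI impI)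
    fix F assume F: "F \<in> enc g k" and z: "\<forall>u\<in>set (map crd vs). D u F = 0"
    have "D (crd w) F = 0" for w
      by (rule killed_span[of "set vs"]) (use z basis in \<open>auto simp: ordered_basis_def\<close>)
    then have "D v F = 0" for v
      using D_cong[of "crd (vec v)" v F] by (metis crd_vec)
    then show "F = 0" using eq_zero_of_D[of F l] F by (simp add: enc_def l)
  next
    fix i F assume i: "i < length (map crd vs)" and F: "F \<in> enc g k"
      and z: "\<forall>u\<in>set (take i (map crd vs)). D u F = 0"
    have "Psi k F \<in> g k \<inter> A i vs k" using F z by (auto simp: enc_def A take_map)
    moreover have "i < length vs" using i by simp
    ultimately have "Psi k F \<in> dir_deriv sT sN (vs ! i) ` (prolongation sT sN k (g k) \<inter> A i vs (Suc k))"
      by (simp only: onto)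
    then obtain q where q: "q \<in> prolongation sT sN k (g k)" "q \<in> A i vs (Suc k)"
      "Psi k F = dir_deriv sT sN (vs ! i) q"
      by blast
    then obtain G where G: "G \<in> X (Suc k)" "\<forall>w\<in>set (take i vs). D (crd w) G = 0" "q = Psi (Suc k) G"
      by (auto simp: A)
    have "G \<in> enc g (Suc k)"
      using G q(1) prolongation_beyond_r_max[OF sys k] by (simp add: enc_def)
    moreover have "D (map crd vs ! i) G = F"
    proof (rule Psi_inj)
      show "F \<in> X k" using F by (simp add: enc_def)
      show "D (map crd vs ! i) G \<in> X k" using D_X[OF G(1)] .
      show "Psi k (D (map crd vs ! i) G) = Psi k F" using q(3) G(3) i by (simp add: dir_deriv_Psi)
    qed
    ultimately show "\<exists>G\<in>enc g (Suc k). (\<forall>u\<in>set (take i (map crd vs)). D u G = 0) \<and> D (map crd vs ! i) G = F"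
      using G(2) by (intro bexI[of _ G]) (auto simp: take_map)
  qed
qed

section \<open>Double annihilators and characteristic covectors\<close>

text \<open>Used for a basis of \<open>V\<close>, to recover \<open>V\<close> from its zero set, and
  for a single covector, whose kernel has a line as annihilator.\<close>

lemma ann_kernel_of_functionals:
  assumes I: "finite I" "I \<subseteq> dual_space sT" and \<phi>: "\<phi> \<in> ann sT {x. \<forall>\<psi>\<in>I. \<psi> x = 0}"
  shows "\<exists>c. \<phi> = (\<lambda>x. \<Sum>\<psi>\<in>I. c \<psi> * \<psi> x)"
proof -
  have d: "\<phi> \<in> dual_space sT" using \<phi> by (simp add: ann_def)
  \<comment> \<open>Functions outside \<open>I\<close> are replaced by 0, since
    \<open>functional_in_span\<close> asks for linearity at every index.\<close>
  define l where "l \<psi> = (if \<psi> \<in> I then \<psi> else (\<lambda>x. 0))" for \<psi>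
  have l: "l \<psi> (x + y) = l \<psi> x + l \<psi> y" "l \<psi> (sT c x) = c * l \<psi> x" for \<psi> x y c
    using I(2) dual_T_iff[of \<psi>] by (auto simp: l_def)
  have "\<exists>c. \<forall>x\<in>UNIV. \<phi> x = (\<Sum>\<psi>\<in>I. c \<psi> * l \<psi> x)"
  proof (rule functional_in_span[where s = sT, OF I(1)])
    show "\<phi> x = 0" if "\<And>\<psi>. \<psi> \<in> I \<Longrightarrow> l \<psi> x = 0" for x
      using that \<phi> by (auto simp: l_def ann_def)
  qed (use d dual_T_iff[of \<phi>] l in auto)
  then obtain c where "\<And>x. \<phi> x = (\<Sum>\<psi>\<in>I. c \<psi> * l \<psi> x)" by blast
  then have "\<phi> = (\<lambda>x. \<Sum>\<psi>\<in>I. c \<psi> * \<psi> x)" by (auto simp: l_def intro!: sum.cong)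
  then show ?thesis by blast
qed

text \<open>The zero set of a finite basis of \<open>V\<close> has annihilator \<open>V\<close>.
  Finiteness comes from the coordinate functionals spanning the dual space, and a list is produced
  because Koszul complexes are built over lists.\<close>

lemma subspace_is_ann:
  assumes V: "V \<subseteq> dual_space sT" "cf.subspace V"
  obtains ws where "V = ann sT (set ws)"
proof -
  obtain B where B: "B \<subseteq> V" "cf.independent B" "V \<subseteq> cf.span B"
    using cf.maximal_independent_subset[of V] by blast
  let ?C = "(\<lambda>b x. crd x b) ` {..<n}"
  have "dual_space sT \<subseteq> cf.span ?C"
  proof
    fix f assume f: "f \<in> dual_space sT"
    have "f = (\<Sum>b<n. pscale (*) (f (bT b)) (\<lambda>x. crd x b))"
      by (rule ext, subst dual_T_expand[OF f]) (simp add: sum_apply pscale_def)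
    also have "\<dots> \<in> cf.span ?C" by (intro cf.span_sum cf.span_scale cf.span_base) auto
    finally show "f \<in> cf.span ?C" .
  qed
  then have finB: "finite B"
    using cf.independent_span_bound[of ?C B] B V(1) by blast
  let ?W = "{x. \<forall>\<psi>\<in>B. \<psi> x = 0}"
  have Bd: "B \<subseteq> dual_space sT" using B(1) V(1) by blast
  have subW: "T.subspace ?W"
  proof (rule T.subspaceI)
    have B_dual: "\<psi> (x + y) = \<psi> x + \<psi> y" "\<psi> (sT c x) = c * \<psi> x" if "\<psi> \<in> B" for \<psi> x y c
      using Bd that dual_T_iff[of \<psi>] by auto
    show "0 \<in> ?W" using B_dual(2)[of _ 0 0] by simp
    show "x + y \<in> ?W" if "x \<in> ?W" "y \<in> ?W" for x y
    proof (intro CollectI ballI)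
      fix \<psi> assume \<psi>: "\<psi> \<in> B"
      then have "\<psi> x = 0" "\<psi> y = 0" using that by blast+
      then show "\<psi> (x + y) = 0" by (simp add: B_dual(1)[OF \<psi>])
    qed
    show "sT c x \<in> ?W" if "x \<in> ?W" for c x
    proof (intro CollectI ballI)
      fix \<psi> assume \<psi>: "\<psi> \<in> B"
      then have "\<psi> x = 0" using that by blast
      then show "\<psi> (sT c x) = 0" by (simp add: B_dual(2)[OF \<psi>])
    qed
  qed
  obtain E where E: "E \<subseteq> ?W" "T.independent E" "?W \<subseteq> T.span E"
    using T.maximal_independent_subset[of ?W] by blast
  then have "finite E" using T.finiteI_independent by blast
  then obtain ws where ws: "set ws = E" using finite_list by blast
  have spanE: "T.span E = ?W" 
    by (rule subset_antisym[OF T.span_minimal[OF E(1) subW] E(3)])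
  have "ann sT (set ws) = ann sT ?W" using ann_span[of E] by (simp only: ws spanE)
  also have "\<dots> = V"
  proof
    show "ann sT ?W \<subseteq> V"
    proof
      fix \<phi> assume "\<phi> \<in> ann sT ?W"
      then obtain c where "\<phi> = (\<lambda>x. \<Sum>\<psi>\<in>B. c \<psi> * \<psi> x)"
        using ann_kernel_of_functionals[OF finB Bd] by blast
      then have "\<phi> = (\<Sum>\<psi>\<in>B. pscale (*) (c \<psi>) \<psi>)" by (auto simp: sum_apply pscale_def)
      also have "\<dots> \<in> V" using B(1) V(2) by (intro cf.subspace_sum cf.subspace_scale) auto
      finally show "\<phi> \<in> V" .
    qed
    have "cf.span B \<subseteq> {\<phi>. \<forall>x\<in>?W. \<phi> x = 0}"
      by (rule cf.span_minimal) (auto intro!: cf.subspaceI simp: pscale_def)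
    then show "V \<subseteq> ann sT ?W" using B(3) V(1) by (auto simp: ann_def)
  qed
  finally show ?thesis using that by blast
qed

text \<open>A power of a characteristic covector in \<open>V\<close>, times a vector of
  \<open>N\<close>, is itself the required element in degree \<open>r_max\<close>. For the converse,
  maps killed by the kernel of a covector are pure powers of it with values in \<open>N\<close>,
  which turns the point found by the Nullstellensatz into a covector characteristic in every
  degree.\<close>

lemma strongly_characteristic_iff:
  assumes g: "involutive_system sT sN g" and V: "V \<subseteq> dual_space sT" "cf.subspace V"
  shows "strongly_characteristic sT sN g V \<longleftrightarrow> (\<exists>v\<in>V. characteristic sT sN g v)"
proof
  let ?r = "r_max sT sN g"
  have sys: "symbolic_system sT sN g" using g by (simp add: involutive_system_def)
  note subg = symbolic_systemD(1)[OF sys]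
  {
    assume "\<exists>v\<in>V. characteristic sT sN g v"
    then obtain v w where v: "v \<in> V" "v \<noteq> 0" and w: "w \<noteq> 0" "(\<lambda>x. sN (v x ^ ?r) w) \<in> g ?r"
      unfolding characteristic_def characteristic_at_def by blast
    have "(\<lambda>x. sN (\<Prod>i<?r. v x) w) \<in> sym_tensor sN V ?r"
      by (rule generator_in_sym_tensor) (rule v)
    then have "(\<lambda>x. sN (v x ^ ?r) w) \<in> sym_tensor sN V ?r" by simp
    moreover obtain x where "v x \<noteq> 0" using v(2) by (auto simp: fun_eq_iff)
    then have "sN (v x ^ ?r) w \<noteq> 0" using w(1) by simp
    then have "(\<lambda>x. sN (v x ^ ?r) w) \<noteq> 0" by (auto simp: fun_eq_iff)
    ultimately show "strongly_characteristic sT sN g V"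
      unfolding strongly_characteristic_def using w(2) by blast
  }
  assume "strongly_characteristic sT sN g V"
  moreover have "0 \<in> g ?r \<inter> sym_tensor sN V ?r"
    using NF.subspace_0[OF subg] NF.subspace_0[OF subspace_sym_tensor] by blast
  ultimately obtain p where p: "p \<in> g ?r" "p \<in> sym_tensor sN V ?r" "p \<noteq> 0"
    unfolding strongly_characteristic_def by blast
  obtain ws where ws: "V = ann sT (set ws)" by (rule subspace_is_ann[OF V])
  obtain F where F: "F \<in> X ?r" "\<And>w. w \<in> set ws \<Longrightarrow> D (crd w) F = 0" "p = Psi ?r F"
    using p(2) unfolding ws sym_tensor_ann_eq by blast
  have F0: "F \<noteq> 0" using p(3) F(3) Psi_zero by metis
  have "\<exists>\<mu>. (\<exists>b<n. \<mu> b \<noteq> 0) \<and>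
      (\<forall>k. \<exists>F\<in>enc g k. F \<noteq> 0 \<and> (\<forall>v. (\<Sum>b<n. v b * \<mu> b) = 0 \<longrightarrow> D v F = 0)) \<and>
      (\<forall>w\<in>set (map crd ws). (\<Sum>b<n. w b * \<mu> b) = 0)"
  proof (rule characteristic_vector_exists[OF system_enc[OF sys] quasi_regular_flag[OF g] _ F0])
    show "F \<in> enc g ?r" using F p(1) by (simp add: enc_def)
    show "D w F = 0" if "w \<in> set (map crd ws)" for w using that F(2) by auto
  qed
  then obtain \<mu> where \<mu>: "\<exists>b<n. \<mu> b \<noteq> 0" "\<And>w. w \<in> set ws \<Longrightarrow> (\<Sum>b<n. crd w b * \<mu> b) = 0"
    and line: "\<And>k. \<exists>F\<in>enc g k. F \<noteq> 0 \<and> (\<forall>v. (\<Sum>b<n. v b * \<mu> b) = 0 \<longrightarrow> D v F = 0)"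
    by auto
  \<comment> \<open>The covector with coordinates \<open>\<mu>\<close>: its kernel consists of the
    vectors that pair to zero with \<open>\<mu>\<close>.\<close>
  define \<phi> where "\<phi> = (\<lambda>x. \<Sum>b<n. \<mu> b * crd x b)"
  have \<phi>: "\<phi> \<in> dual_space sT" unfolding \<phi>_def by (rule combination_dual)
  have \<phi>V: "\<phi> \<in> V" using \<phi> \<mu>(2) by (simp add: ws ann_def \<phi>_def mult.commute)
  have \<phi>0: "\<phi> \<noteq> 0"
  proof
    assume z: "\<phi> = 0"
    obtain b where b: "b < n" "\<mu> b \<noteq> 0" using \<mu>(1) by blast
    have "\<phi> (vec (unit_vec b)) = (\<Sum>i<n. if i = b then \<mu> i else 0)"
      unfolding \<phi>_def by (intro sum.cong) (auto simp: crd_vec unit_vec_def)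
    then show False using b z by simp
  qed
  have "characteristic_at sT sN k (g k) \<phi>" for k
  proof -
    obtain F where F: "F \<in> enc g k" "F \<noteq> 0" "\<And>v. (\<Sum>b<n. v b * \<mu> b) = 0 \<Longrightarrow> D v F = 0"
      using line by blast
    \<comment> \<open>The annihilator of the kernel of \<open>\<phi>\<close> is the line of
      \<open>\<phi>\<close>, so \<open>Psi k F\<close> is a sum of terms \<open>\<phi> x ^ k\<close>
      times vectors of \<open>N\<close>, and such a sum is a single term of this form.\<close>
    let ?K = "{x. \<forall>\<psi>\<in>{\<phi>}. \<psi> x = 0}"
    have "Psi k F \<in> sym_tensor sN (ann sT ?K) k"
      unfolding sym_tensor_ann_eq
      using F by (auto simp: enc_def \<phi>_def mult.commute intro!: imageI)
    also have "sym_tensor sN (ann sT ?K) k \<subseteq> range (\<lambda>w x. sN (\<phi> x ^ k) w)"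
      unfolding sym_tensor_def
    proof (rule NF.span_minimal)
      show "NF.subspace (range (\<lambda>w x. sN (\<phi> x ^ k) w))"
      proof (rule NF.subspaceI)
        show "0 \<in> range (\<lambda>w x. sN (\<phi> x ^ k) w)" by (rule image_eqI[of _ _ 0]) auto
        show "p + q \<in> range (\<lambda>w x. sN (\<phi> x ^ k) w)"
          if p: "p \<in> range (\<lambda>w x. sN (\<phi> x ^ k) w)" and q: "q \<in> range (\<lambda>w x. sN (\<phi> x ^ k) w)" for p q
        proof -
          obtain w w' where "p = (\<lambda>x. sN (\<phi> x ^ k) w)" "q = (\<lambda>x. sN (\<phi> x ^ k) w')" using p q by blast
          then show ?thesis by (intro image_eqI[of _ _ "w + w'"]) (auto simp: N.scale_right_distrib)
        qed
        show "pscale sN c p \<in> range (\<lambda>w x. sN (\<phi> x ^ k) w)"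
          if p: "p \<in> range (\<lambda>w x. sN (\<phi> x ^ k) w)" for c p
        proof -
          obtain w where "p = (\<lambda>x. sN (\<phi> x ^ k) w)" using p by blast
          then show ?thesis by (intro image_eqI[of _ _ "sN c w"]) (auto simp: pscale_def mult.commute)
        qed
      qed
      show "{\<lambda>x. sN (\<Prod>i<k. \<psi> i x) w | \<psi> w. \<forall>i<k. \<psi> i \<in> ann sT ?K} \<subseteq> range (\<lambda>w x. sN (\<phi> x ^ k) w)"
      proof clarify
        fix \<psi> and w :: 'n assume \<psi>: "\<forall>i<k. \<psi> i \<in> ann sT ?K"
        have "\<exists>a. \<forall>x. \<psi> i x = a * \<phi> x" if i: "i < k" for i
        proof -
          obtain c where "\<psi> i = (\<lambda>x. \<Sum>\<psi>\<in>{\<phi>}. c \<psi> * \<psi> x)"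
            using ann_kernel_of_functionals[of "{\<phi>}" "\<psi> i"] \<phi> \<psi> i by blast
          then show ?thesis by (intro exI[of _ "c \<phi>"]) simp
        qed
        then obtain a where a: "\<And>i x. i < k \<Longrightarrow> \<psi> i x = a i * \<phi> x" by metis
        have "(\<Prod>i<k. \<psi> i x) = \<phi> x ^ k * (\<Prod>i<k. a i)" for x
          using a by (simp add: prod.distrib mult.commute)
        then show "(\<lambda>x. sN (\<Prod>i<k. \<psi> i x) w) \<in> range (\<lambda>w x. sN (\<phi> x ^ k) w)"
          by (intro image_eqI[of _ _ "sN (\<Prod>i<k. a i) w"]) auto
      qed
    qed
    finally obtain w where w: "Psi k F = (\<lambda>x. sN (\<phi> x ^ k) w)" by blast
    have "w \<noteq> 0"
    proof
      assume "w = 0"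
      then have "Psi k F x = 0" for x by (simp add: w)
      then show False using Psi_eq_zero[of F k] F(1,2) by (simp add: enc_def)
    qed
    moreover have "(\<lambda>x. sN (\<phi> x ^ k) w) \<in> g k" using F(1) w by (simp add: enc_def)
    ultimately show ?thesis using \<phi> \<phi>0 unfolding characteristic_at_def by blast
  qed
  then show "\<exists>v\<in>V. characteristic sT sN g v" using \<phi>V unfolding characteristic_def by blast
qed

end

theorem theorem2:
  fixes sT :: "complex \<Rightarrow> 't::ab_group_add \<Rightarrow> 't" and BT :: "'t set"
    and sN :: "complex \<Rightarrow> 'n::ab_group_add \<Rightarrow> 'n" and BN :: "'n set"
    and g :: "nat \<Rightarrow> ('t \<Rightarrow> 'n) set"
    and V :: "('t \<Rightarrow> complex) set"
  assumes "finite_dimensional_vector_space sT BT"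
    and "finite_dimensional_vector_space sN BN"
    and "involutive_system sT sN g"
    and "V \<subseteq> dual_space sT"
    and "module.subspace (pscale (*)) V"
  shows "strongly_characteristic sT sN g V \<longleftrightarrow> (\<exists>v\<in>V. characteristic sT sN g v)"
proof -
  interpret T: finite_dimensional_vector_space sT BT by fact
  interpret N: finite_dimensional_vector_space sN BN by fact
  obtain bT where "bij_betw bT {0..<card BT} BT" using ex_bij_betw_nat_finite[OF T.finite_Basis] by blast
  moreover obtain bN where "bij_betw bN {0..<card BN} BN"
    using ex_bij_betw_nat_finite[OF N.finite_Basis] by blast
  ultimately interpret symbol_spaces sT BT sN BN "card BT" "card BN" bT bN
    by unfold_locales (simp_all add: atLeast0LessThan)
  show ?thesis using assms(3-5) by (rule strongly_characteristic_iff)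
qed

end
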